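(* Let $0<p<1$ and let $T_{\mathbb{R}_-}=\inf\{n\ge 1: S_n\in\mathbb{R}_-\}$ be the first time $n\ge1$ at which the greedy walk started at $S_0=0$ is in $\mathbb{R}_-=(-\infty,0]$. Then $$\mathbb{E}^1[T_{\mathbb{R}_-}]=\infty,$$ where $\mathbb{E}^1$ is the expectation with respect to $\mathbb{P}^1$.
   Context: Fix $0<p<1$. Under $\mathbb{P}$, let $\mathcal{X}$ be a Poisson point process of intensity $1$ on $\mathbb{R}$ and let $\mathcal{Y}$ be a $p$-thinning of $\mathcal{X}$ (conditionally on $\mathcal{X}$, each point of $\mathcal{X}$ is kept in $\mathcal{Y}$ independently with probability $p$). Point processes are viewed both as integer-valued measures and as random subsets of $\mathbb{R}$. Put $\omega=\mathcal{X}+\mathcal{Y}$, so points of $\mathcal{Y}$ carry two marks and the other points of $\mathcal{X}$ carry one mark; $\omega(x)=\omega(\{x\})$ is the number of marks at $x$. $\mathbb{P}^1$ denotes $\mathbb{P}$ conditioned on $0\in\mathcal{X}$ in the Palm sense: under $\mathbb{P}^1$, $\mathcal{X}$ is a Poisson point process of intensity $1$ with an additional point at $0$, and each point of $\mathcal{X}$ (including $0$) belongs to $\mathcal{Y}$ independently with probability $p$. Greedy walk started at $0$ (under $\mathbb{P}^1$): $\omega_0=\omega$, $S_0=0$, and for all $n\ge 0$, $$\omega_{n+1}=\omega_n-\delta_{S_n},\qquad S_{n+1}=\operatorname{arg\,min}\{|y-S_n| : y\in\mathbb{R},\ y\neq S_n,\ \omega_n(y)\ge 1\}.$$ $\mathbb{P}^1$-a.s.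 the $\operatorname{arg\,min}$ is always unique, so $(S_n)_{n\ge0}$ and $(\omega_n)_{n\ge 0}$ are well defined. Convention: $\inf\emptyset=\infty$. *)

theory Defs
  imports "HOL-Probability.Probability"
begin

text \<open>
  A (simple) point process on the real line is a random locally finite subset, given by its set of
  points \<open>X \<omega>\<close>; the associated counting measure of \<open>B\<close> is \<open>card (X \<omega> \<inter> B)\<close>.
\<close>

locale point_process = prob_space M for M :: "'w measure" +
  fixes X :: "'w \<Rightarrow> real set"
  assumes locally_finite: "\<And>\<omega> B. \<omega> \<in> space M \<Longrightarrow> bounded B \<Longrightarrow> finite (X \<omega> \<inter> B)"
    and measurable_count: "\<And>B. B \<in> sets borel \<Longrightarrow> bounded B \<Longrightarrow>
      (\<lambda>\<omega>. card (X \<omega> \<inter> B)) \<in> M \<rightarrow>\<^sub>M count_space UNIV"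

definition generated_algebra :: "'w measure \<Rightarrow> ('w \<Rightarrow> real set) \<Rightarrow> 'w measure" where
  "generated_algebra M X =
    sigma (space M) {{\<omega> \<in> space M. card (X \<omega> \<inter> B) = k} | B k. B \<in> sets borel \<and> bounded B}"

text \<open>
  The Poisson probabilities are written out because \<^const>\<open>poisson_pmf\<close> is specified for
  positive rates only, whereas \<open>B\<close> may be a null set.
\<close>

locale poisson_process = point_process M X for M :: "'w measure" and X +
  fixes intensity :: real
  assumes intensity_nonneg: "0 \<le> intensity"
    and count_poisson: "\<And>B k. B \<in> sets borel \<Longrightarrow> bounded B \<Longrightarrow>
      prob {\<omega> \<in> space M. card (X \<omega> \<inter> B) = k} =
        (intensity * measure lborel B) ^ k / fact k * exp (- (intensity * measure lborel B))"
    and count_indep: "\<And>\<B>. finite \<B> \<Longrightarrow> disjoint \<B> \<Longrightarrow> (\<forall>B\<in>\<B>. B \<in> sets borel \<and> bounded B) \<Longrightarrow>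
      indep_vars (\<lambda>_. count_space UNIV) (\<lambda>B \<omega>. card (X \<omega> \<inter> B)) \<B>"

text \<open>
  \<open>Y\<close> is a \<open>p\<close>-thinning of \<open>X\<close>: conditionally on \<open>X\<close>, any \<open>n\<close> distinct points of \<open>X\<close> (chosen
  measurably as functions of \<open>X\<close>) are all kept in \<open>Y\<close> with probability \<open>p ^ n\<close>. As \<open>n\<close> is arbitrary,
  this is conditional independence of the retention events, each of conditional probability \<open>p\<close>.
  The implication inside \<open>AE\<close> allows selections that are points of \<open>X\<close> on part of the space only,
  so that the condition is also meaningful if \<open>X\<close> may have fewer than \<open>n\<close> points.
\<close>

locale thinning = X: point_process M X + Y: point_process M Y
  for M :: "'w measure" and X Y :: "'w \<Rightarrow> real set" +
  fixes p :: real
  assumes thinning_subset: "\<And>\<omega>. \<omega> \<in> space M \<Longrightarrow> Y \<omega> \<subseteq> X \<omega>"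
    and thinning_cond: "\<And>(n :: nat) (\<xi> :: nat \<Rightarrow> 'w \<Rightarrow> real).
      (\<forall>i<n. \<xi> i \<in> borel_measurable (generated_algebra M X)) \<Longrightarrow>
      AE \<omega> in M. inj_on (\<lambda>i. \<xi> i \<omega>) {..<n} \<and> (\<forall>i<n. \<xi> i \<omega> \<in> X \<omega>) \<longrightarrow>
        real_cond_exp M (generated_algebra M X)
          (indicator {\<omega> \<in> space M. \<forall>i<n. \<xi> i \<omega> \<in> Y \<omega>}) \<omega> = p ^ n"

text \<open>The number of marks at each point, for the environment \<open>X + Y\<close>.\<close>

definition marks :: "real set \<Rightarrow> real set \<Rightarrow> real \<Rightarrow> nat" where
  "marks X Y x = indicator X x + indicator Y x"

text \<open>
  The walk \<open>greedy_walk w x\<close> in the environment \<open>w\<close> started at \<open>x\<close>, and the environments it leaves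
  behind. The truncated subtraction is harmless whenever \<open>w x \<ge> 1\<close> and the minima exist, as the
  walk then always sits at a marked point. If the minimum is not attained or not unique, the value of
  \<^const>\<open>arg_min\<close> is an arbitrary choice.
\<close>

fun greedy_walk :: "(real \<Rightarrow> nat) \<Rightarrow> real \<Rightarrow> nat \<Rightarrow> real"
  and greedy_env :: "(real \<Rightarrow> nat) \<Rightarrow> real \<Rightarrow> nat \<Rightarrow> real \<Rightarrow> nat" where
  "greedy_walk w x 0 = x"
| "greedy_walk w x (Suc n) =
    (ARG_MIN (\<lambda>y. \<bar>y - greedy_walk w x n\<bar>) y. y \<noteq> greedy_walk w x n \<and> greedy_env w x n y \<ge> 1)"
| "greedy_env w x 0 = w"
| "greedy_env w x (Suc n) = (\<lambda>y. greedy_env w x n y - indicator {greedy_walk w x n} y)"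

definition hitting_time :: "(nat \<Rightarrow> real) \<Rightarrow> real set \<Rightarrow> enat" where
  "hitting_time S A = Inf (enat ` {n. n \<ge> 1 \<and> S n \<in> A})"

text \<open>The infimum of the empty set is infinite.\<close>

lemma hitting_time_never: "(\<And>n. n \<ge> 1 \<Longrightarrow> S n \<notin> A) \<Longrightarrow> hitting_time S A = \<infinity>"
  by (auto simp: hitting_time_def Inf_enat_def)

end

theory Submission
  imports Defs
begin

text \<open>
  Let \<open>0 = x\<^sub>0 < x\<^sub>1 < \<dots>\<close> be the points on the right, \<open>g\<close> the distance from \<open>0\<close> to the first point on
  the left, and suppose that \<open>0\<close> carries one mark. Let \<open>R\<^sub>i\<close> be the number of points discovered by the
  walk that starts at \<open>x\<^sub>i\<^sub>+\<^sub>1\<close>, with everything from \<open>x\<^sub>i\<^sub>+\<^sub>1\<close> on still untouched and the nearest mark to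
  the left at \<open>x\<^sub>i\<close>, before it jumps back to \<open>x\<^sub>i\<close>.

  If the walk ever jumps from \<open>x\<^sub>i\<close> over the gap of length \<open>x\<^sub>i + g\<close> to its left, then the next point on
  the right is at least as far, and all points discovered beyond \<open>x\<^sub>i\<close> were discovered between the two
  visits to \<open>x\<^sub>i\<close>. So the walk stays positive for ever if \<open>x (i + R\<^sub>i + 1) - x i < x i + g\<close> for all \<open>i\<close>.
  The \<open>R\<^sub>i\<close> are identically distributed. If their mean is finite, then \<open>R\<^sub>i\<close> is eventually smaller than
  any fixed multiple of \<open>i\<close>, the condition fails for finitely many \<open>i\<close> only, and it holds for all
  \<open>i\<close> with positive probability because \<open>g\<close> is independent of the rest and unbounded. Hence the hitting
  time is infinite with positive probability. Conversely, the hitting time dominates a variable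
  comparable to \<open>R\<^sub>0\<close>, so its mean is infinite if that of the \<open>R\<^sub>i\<close> is.
\<close>

section \<open>Greedy walks on a half-line\<close>

text \<open>The law of the return numbers is never computed, since either alternative for their mean
  ends in an infinite expectation. What is needed is that the gaps and the second marks are jointly
  independent, with one law for all gaps and one for all marks. The Poisson axioms speak of counts
  on fixed sets only, so this has to be derived at random points.

  The obstacle is to phrase returns as events of this sequence instead of events of the walk. Hence
  a return is described by the existence of a finite list of indices obeying the greedy rule: a
  countable condition that ignores the left half-line and is transported by reindexing the sequence.
  Such lists may break ties arbitrarily. This is harmless when a list is read off the walk; for the
  converse, ties are excluded almost surely.

  For the lower bound on the hitting time, the walk at \<open>x 1\<close> really faces a left gap of
  at least \<open>x 1 + g\<close>. It is lowered to \<open>g\<close>, so that the return no longer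
  depends on the first gap on the right and has the common law.\<close>

text \<open>
  Walks are coded by the indices of the points they visit. In \<open>reaches\<close> the point \<open>0\<close> is
  a marked point that the walk must not have entered yet.
\<close>

definition greedy_path :: "(nat \<Rightarrow> real) \<Rightarrow> (nat \<Rightarrow> nat) \<Rightarrow> nat list \<Rightarrow> bool" where
  "greedy_path x b l \<longleftrightarrow> (\<forall>t. Suc t < length l \<longrightarrow>
    l ! Suc t \<noteq> l ! t \<and> count_list (take t l) (l ! Suc t) < b (l ! Suc t) \<and>
    (\<forall>k. k \<noteq> l ! t \<and> count_list (take t l) k < b k \<longrightarrow>
      \<bar>x (l ! Suc t) - x (l ! t)\<bar> \<le> \<bar>x k - x (l ! t)\<bar>))"

text \<open>\<open>take t l\<close> leaves out the current position, because the environment after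
  \<open>t\<close> steps still holds the mark under the walk; the current point is excluded
  separately by \<open>k \<noteq> l ! t\<close>.\<close>

lemma greedy_pathD:
  assumes "greedy_path x b l" "Suc t < length l"
  shows "l ! Suc t \<noteq> l ! t" "count_list (take t l) (l ! Suc t) < b (l ! Suc t)"
    and "k \<noteq> l ! t \<Longrightarrow> count_list (take t l) k < b k \<Longrightarrow>
      \<bar>x (l ! Suc t) - x (l ! t)\<bar> \<le> \<bar>x k - x (l ! t)\<bar>"
  using assms unfolding greedy_path_def by blast+

definition reaches :: "(nat \<Rightarrow> real) \<Rightarrow> (nat \<Rightarrow> nat) \<Rightarrow> nat \<Rightarrow> bool" where
  "reaches x b n \<longleftrightarrow> (\<exists>l. l \<noteq> [] \<and> hd l = 1 \<and> 0 \<notin> set l \<and> n \<in> set l \<and> greedy_path x b l)"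

lemma count_list_map_upt:
  "count_list (map f [m..<n]) k = card {t. m \<le> t \<and> t < n \<and> f t = k}"
proof -
  have "{t. m \<le> t \<and> t < n \<and> f t = k} = set (filter (\<lambda>t. f t = k) [m..<n])"
    by auto
  moreover have "card (set (filter (\<lambda>t. f t = k) [m..<n])) = length (filter (\<lambda>t. f t = k) [m..<n])"
    by (intro distinct_card) simp
  moreover have "count_list (map f xs) k = length (filter (\<lambda>t. f t = k) xs)" for xs :: "nat list"
    by (induction xs) auto
  ultimately show ?thesis by simp
qed

text \<open>A point never visited still has a mark and is nearer than anything beyond it, so new
  points are discovered one by one. Hence the largest index reached counts the discovered
  points.\<close>

lemma greedy_path_contiguous:
  assumes x: "strict_mono x" and b: "\<And>k. 1 \<le> b k"
    and l: "l \<noteq> []" "hd l = 1" "0 \<notin> set l" and g: "greedy_path x b l"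
  shows "t < length l \<Longrightarrow> {1..l ! t} \<subseteq> set (take (Suc t) l)"
proof (induction t)
  case 0
  then show ?case using l by (auto simp: hd_conv_nth take_Suc_conv_app_nth)
next
  case (Suc t)
  let ?c = "l ! t" and ?d = "l ! Suc t"
  have sub: "set (take (Suc t) l) \<subseteq> set (take (Suc (Suc t)) l)"
    by (rule set_take_subset_set_take) simp
  have IH: "{1..?c} \<subseteq> set (take (Suc t) l)" using Suc by auto
  show ?case
  proof
    fix k assume k: "k \<in> {1..?d}"
    show "k \<in> set (take (Suc (Suc t)) l)"
    proof (rule ccontr)
      assume nk: "k \<notin> set (take (Suc (Suc t)) l)"
      then have "k \<notin> set (take (Suc t) l)" using sub by auto
      then have ck: "?c < k" using IH k by (meson atLeastAtMost_iff not_le subsetD)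
      have "?d \<in> set (take (Suc (Suc t)) l)" using Suc.prems by (simp add: take_Suc_conv_app_nth)
      then have kd: "k < ?d" using nk k by (cases "k = ?d") auto
      have "set (take t l) \<subseteq> set (take (Suc (Suc t)) l)"
        by (rule set_take_subset_set_take) simp
      then have "k \<notin> set (take t l)" using nk by auto
      then have "count_list (take t l) k < b k"
        using b[of k] count_list_0_iff[of "take t l" k] by linarith
      with ck g Suc.prems have "\<bar>x ?d - x ?c\<bar> \<le> \<bar>x k - x ?c\<bar>"
        unfolding greedy_path_def by auto
      moreover have "x ?c < x k" "x k < x ?d" using ck kd x by (auto simp: strict_mono_def)
      ultimately show False by auto
    qed
  qed
qed

lemma reaches_contiguous:
  assumes "strict_mono x" "\<And>k. 1 \<le> b k" "l \<noteq> []" "hd l = 1" "0 \<notin> set l" "greedy_path x b l"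
    and "n \<in> set l"
  shows "{1..n} \<subseteq> set l"
proof -
  obtain t where t: "t < length l" "l ! t = n" using assms(7) by (auto simp: in_set_conv_nth)
  show ?thesis
    using greedy_path_contiguous[OF assms(1-6), of t] t set_take_subset[of "Suc t" l] by auto
qed

lemma reaches_antimono:
  assumes "strict_mono x" "\<And>k. 1 \<le> b k" "reaches x b n" "1 \<le> m" "m \<le> n"
  shows "reaches x b m"
proof -
  obtain l where l: "l \<noteq> []" "hd l = 1" "0 \<notin> set l" "n \<in> set l" "greedy_path x b l"
    using assms(3) unfolding reaches_def by auto
  have "{1..n} \<subseteq> set l" using reaches_contiguous[OF assms(1,2) l(1-3,5,4)] .
  then have "m \<in> set l" using assms by auto
  then show ?thesis using l unfolding reaches_def by blast
qed

lemma reaches_1: "reaches x b 1"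
  unfolding reaches_def by (rule exI[of _ "[1]"]) (simp add: greedy_path_def)

lemma not_reaches_0: "\<not> reaches x b 0"
  by (auto simp: reaches_def)

text \<open>Only the point 0 moves relative to the others, and away from them, so a path avoiding it
  stays greedy.\<close>

lemma reaches_mono_gap:
  assumes "reaches x b n" "strict_mono x"
    and eq: "\<And>k c. 1 \<le> k \<Longrightarrow> 1 \<le> c \<Longrightarrow> x' k - x' c = x k - x c"
    and gap: "x 1 - x 0 \<le> x' 1 - x' 0"
  shows "reaches x' b n"
proof -
  obtain l where l: "l \<noteq> []" "hd l = 1" "0 \<notin> set l" "n \<in> set l" and g: "greedy_path x b l"
    using assms(1) unfolding reaches_def by auto
  have "greedy_path x' b l"
    unfolding greedy_path_def
  proof (intro allI impI conjI)
    fix t assume t: "Suc t < length l"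
    show "l ! Suc t \<noteq> l ! t" "count_list (take t l) (l ! Suc t) < b (l ! Suc t)"
      using g t unfolding greedy_path_def by auto
    fix k assume k: "k \<noteq> l ! t \<and> count_list (take t l) k < b k"
    have pos: "1 \<le> l ! t" "1 \<le> l ! Suc t"
      using l(3) t by (metis One_nat_def Suc_leI Suc_lessD neq0_conv nth_mem)+
    have "\<bar>x (l ! Suc t) - x (l ! t)\<bar> \<le> \<bar>x k - x (l ! t)\<bar>"
      using g t k unfolding greedy_path_def by auto
    moreover have "\<bar>x k - x (l ! t)\<bar> \<le> \<bar>x' k - x' (l ! t)\<bar>"
    proof (cases "k = 0")
      case True
      have "x' (l ! t) - x' 1 = x (l ! t) - x 1" "x 0 < x (l ! t)"
        using eq[of "l ! t" 1] pos assms(2) by (auto simp: strict_mono_def)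
      then show ?thesis using gap True by auto
    next
      case False
      then show ?thesis using eq[of k "l ! t"] pos by simp
    qed
    ultimately show "\<bar>x' (l ! Suc t) - x' (l ! t)\<bar> \<le> \<bar>x' k - x' (l ! t)\<bar>"
      using eq[of "l ! Suc t" "l ! t"] pos by simp
  qed
  then show ?thesis using l unfolding reaches_def by blast
qed

section \<open>The full walk on a line with points on both sides of 0\<close>

lemma greedy_env_eq:
  "greedy_env w a n y = w y - count_list (map (greedy_walk w a) [0..<n]) y"
  by (induction n) (auto simp: indicator_def)

declare greedy_walk.simps(2) [simp del] greedy_env.simps(2) [simp del]

text \<open>The geometry on the left is reduced to \<open>neg\<close>: no point there is closer to 0
  than \<open>g\<close>.\<close>

locale marked_line =
  fixes X Y :: "real set" and x :: "nat \<Rightarrow> real" and g :: real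
  assumes x0: "x 0 = 0" and mono: "strict_mono x" and rng: "range x = X \<inter> {0..}"
    and neg: "\<And>y. y \<in> X \<Longrightarrow> y < 0 \<Longrightarrow> y \<le> - g" and g_pos: "0 < g"
    and sub: "Y \<subseteq> X" and loc_fin: "\<And>B. bounded B \<Longrightarrow> finite (X \<inter> B)"
    and single: "0 \<notin> Y"
begin

abbreviation "w \<equiv> marks X Y"
abbreviation "S \<equiv> greedy_walk w 0"

definition b :: "nat \<Rightarrow> nat" where "b k = w (x k)"

lemma x_in: "x k \<in> X"
  using rng by auto

lemma x_eq_iff: "x i = x j \<longleftrightarrow> i = j"
  using mono by (simp add: strict_mono_eq)

lemma x_le_iff: "x i \<le> x j \<longleftrightarrow> i \<le> j"
  using mono by (simp add: strict_mono_less_eq)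

lemma x_less_iff: "x i < x j \<longleftrightarrow> i < j"
  using mono by (simp add: strict_mono_less)

lemma x_nonneg: "0 \<le> x k"
  using x_le_iff[of 0 k] x0 by simp

lemma b_bounds: "1 \<le> b k" "b k \<le> 2"
  using x_in[of k] by (auto simp: b_def marks_def indicator_def)

lemma b_0: "b 0 = 1"
  using single x_in[of 0] x0 by (simp add: b_def marks_def)

lemma marked_imp: "1 \<le> w y \<Longrightarrow> y \<in> X"
  using sub by (cases "y \<in> X"; cases "y \<in> Y") (auto simp: marks_def)

text \<open>\<open>ARG_MIN\<close> is meaningful because a minimum exists: infinitely many points
  lie on the right, finitely many have been visited, and local finiteness leaves finitely many
  candidates as near as a given one.\<close>

lemma walk_step:
  shows "S (Suc n) \<noteq> S n" "1 \<le> greedy_env w 0 n (S (Suc n))"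
    and "\<And>y. y \<noteq> S n \<Longrightarrow> 1 \<le> greedy_env w 0 n y \<Longrightarrow> \<bar>S (Suc n) - S n\<bar> \<le> \<bar>y - S n\<bar>"
proof -
  let ?P = "\<lambda>y. y \<noteq> S n \<and> 1 \<le> greedy_env w 0 n y"
  let ?f = "\<lambda>y. \<bar>y - S n\<bar>"
  have PX: "?P y \<Longrightarrow> y \<in> X" for y
    using marked_imp[of y] by (auto simp: greedy_env_eq)
  have "infinite (range x)" using mono by (simp add: range_inj_infinite strict_mono_imp_inj_on)
  then have "\<exists>z\<in>range x. z \<notin> insert (S n) (set (map S [0..<n]))"
    by (meson finite_insert finite_set finite_subset subsetI)
  then obtain z where z: "z \<in> range x" "z \<noteq> S n" "z \<notin> set (map S [0..<n])" by auto
  have "count_list (map S [0..<n]) z = 0" using z by (simp add: count_list_0_iff)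
  moreover have "1 \<le> w z" using z(1) b_bounds by (auto simp: b_def)
  ultimately have Pz: "?P z" using z by (simp add: greedy_env_eq)
  let ?C = "{y. ?P y \<and> ?f y \<le> ?f z}"
  have "?C \<subseteq> X \<inter> cball (S n) (?f z)" using PX by (auto simp: dist_real_def abs_minus_commute)
  then have fin: "finite ?C" by (rule finite_subset[OF _ loc_fin]) simp
  have "?C \<noteq> {}" using Pz by auto
  then obtain m where m: "is_arg_min ?f (\<lambda>y. y \<in> ?C) m"
    using ex_is_arg_min_if_finite[OF fin] by blast
  then have mC: "?P m" "?f m \<le> ?f z" and mm: "\<And>y. y \<in> ?C \<Longrightarrow> ?f m \<le> ?f y"
    by (auto simp: is_arg_min_def not_less)
  have mmin: "?f m \<le> ?f y" if "?P y" for y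
    using mm[of y] that mC(2) by (cases "?f y \<le> ?f z") auto
  have "?P (S (Suc n)) \<and> (\<forall>y. ?P y \<longrightarrow> ?f (S (Suc n)) \<le> ?f y)"
    unfolding greedy_walk.simps(2)
    by (rule arg_minI[where x = m]) (use mC mmin in \<open>auto simp: not_less\<close>)
  then show "S (Suc n) \<noteq> S n" "1 \<le> greedy_env w 0 n (S (Suc n))"
    and "\<And>y. y \<noteq> S n \<Longrightarrow> 1 \<le> greedy_env w 0 n y \<Longrightarrow> \<bar>S (Suc n) - S n\<bar> \<le> \<bar>y - S n\<bar>"
    by auto
qed

lemma walk_in: "S n \<in> X"
proof (cases n)
  case 0 then show ?thesis using x_in[of 0] x0 by simp
next
  case (Suc m) then show ?thesis
    using walk_step(2)[of m] marked_imp[of "S n"] by (auto simp: greedy_env_eq)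
qed

text \<open>The only mark at 0 is removed by the first step, so entering \<open>{..0}\<close> later
  means entering a negative point.\<close>

lemma walk_nonzero: "S (Suc n) \<noteq> 0"
proof
  assume *: "S (Suc n) = 0"
  have "1 \<le> greedy_env w 0 n 0" using walk_step(2)[of n] * by simp
  moreover have "w 0 = 1" using b_0 x0 by (simp add: b_def)
  ultimately have "count_list (map S [0..<n]) 0 = 0" by (simp add: greedy_env_eq)
  then have "0 \<notin> set (map S [0..<n])" by (simp only: count_list_0_iff not_False_eq_True)
  then have "n = 0" using greedy_walk.simps(1)[of w 0] by force
  then show False using * walk_step(1)[of 0] by simp
qed

lemma walk_index: "0 \<le> S n \<Longrightarrow> \<exists>k. S n = x k"
  using walk_in[of n] rng by blast

text \<open>
  At a first jump below \<open>0\<close>, from the point \<open>j\<close>, consider the maximal visited index \<open>m\<close>. If \<open>m > j\<close>, the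
  walk moved from \<open>j\<close> to \<open>j + 1\<close> after the first visit to \<open>j\<close> and stayed beyond \<open>j\<close> until the second,
  because it cannot skip \<open>j\<close> while a mark is left there.
\<close>

lemma never_nonpos:
  assumes trap: "\<And>i m. reaches (\<lambda>k. x (i + k) - x i) (\<lambda>k. if k = 0 then 1 else b (i + k)) m \<Longrightarrow>
      x (i + m + 1) - x i < x i + g"
  shows "0 < S (Suc n)"
proof (rule ccontr)
  assume "\<not> 0 < S (Suc n)"
  then have "\<exists>n. \<not> 0 < S (Suc n)" by blast
  then obtain n where n: "\<not> 0 < S (Suc n)" and least: "\<And>m. m < n \<Longrightarrow> 0 < S (Suc m)"
    using exists_least_iff[of "\<lambda>n. \<not> 0 < S (Suc n)"] by auto
  have nn: "0 \<le> S t" if "t \<le> n" for t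
    using least[of "t - 1"] that by (cases t) auto
  obtain l where l: "S t = x (l t)" if "t \<le> n" for t
    using walk_index nn by metis
  have l0: "l 0 = 0" using l[of 0] x0 x_eq_iff[of "l 0" 0] by simp
  have far: "S (Suc n) \<le> - g" using n walk_nonzero[of n] neg[OF walk_in[of "Suc n"]] by auto
  define cnt where "cnt t k = count_list (map l [0..<t]) k" for t k
  have cnt: "cnt t k = card {s. s < t \<and> l s = k}" for t k
    unfolding cnt_def count_list_map_upt by simp
  have env: "greedy_env w 0 t (x k) = b k - cnt t k" if "t \<le> n" for t k
  proof -
    have "{s. 0 \<le> s \<and> s < t \<and> S s = x k} = {s. s < t \<and> l s = k}"
      using that l x_eq_iff by auto
    then show ?thesis unfolding greedy_env_eq count_list_map_upt cnt b_def by simp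
  qed
  have cnt_mono: "cnt s k \<le> cnt t k" if "s \<le> t" for s t k
    unfolding cnt using that by (intro card_mono) auto
  have step_ne: "l (Suc t) \<noteq> l t" if "t < n" for t
    using walk_step(1)[of t] l[of t] l[of "Suc t"] that by auto
  have step_ok: "cnt t (l (Suc t)) < b (l (Suc t))" if "t < n" for t
    using walk_step(2)[of t] l[of "Suc t"] env[of t] that by auto
  have step_min: "\<bar>x (l (Suc t)) - x (l t)\<bar> \<le> \<bar>x k - x (l t)\<bar>"
    if "t < n" "k \<noteq> l t" "cnt t k < b k" for t k
    using walk_step(3)[of "x k" t] l[of t] l[of "Suc t"] env[of t] that x_eq_iff by auto
  have no_skip: "b k \<le> cnt t k" if "t < n" "l t < k \<and> k < l (Suc t) \<or> l (Suc t) < k \<and> k < l t" for t k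
  proof (rule ccontr)
    assume "\<not> b k \<le> cnt t k"
    then have "\<bar>x (l (Suc t)) - x (l t)\<bar> \<le> \<bar>x k - x (l t)\<bar>"
      using that step_min[of t k] by auto
    then show False
      using that x_less_iff[of "l t" k] x_less_iff[of k "l t"] x_less_iff[of "l (Suc t)" k]
        x_less_iff[of k "l (Suc t)"] by auto
  qed
  define j where "j = l n"
  define m where "m = Max (l ` {0..n})"
  have m_le: "l t \<le> m" if "t \<le> n" for t
    unfolding m_def using that by (intro Max_ge) auto
  have "m \<in> l ` {0..n}" unfolding m_def by (intro Max_in) auto
  then obtain t\<^sub>m where tm: "t\<^sub>m \<le> n" "l t\<^sub>m = m" by auto
  \<comment> \<open>Index \<open>Suc m\<close> is untouched, so the jump to the left is no longer
    than a step from \<open>x j\<close> to \<open>x (Suc m)\<close> would be.\<close>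
  have fresh: "cnt n (Suc m) = 0"
    unfolding cnt using m_le by (auto simp: card_eq_0_iff) (metis less_imp_le not_less_eq_eq order_refl)
  have "greedy_env w 0 n (x (Suc m)) \<ge> 1" using env[of n "Suc m"] fresh b_bounds(1)[of "Suc m"] by simp
  moreover have "x (Suc m) \<noteq> S n" using l[of n] m_le[of n] x_eq_iff by auto
  ultimately have "\<bar>S (Suc n) - S n\<bar> \<le> \<bar>x (Suc m) - S n\<bar>" by (intro walk_step(3))
  moreover have "S n = x j" using l j_def by auto
  moreover have "x j < x (Suc m)" using m_le[of n] x_less_iff j_def by simp
  ultimately have esc: "x j + g \<le> x (Suc m) - x j" using far x_nonneg[of j] by auto
  have jm: "j \<le> m" using m_le[of n] j_def by simp
  show False
  proof (cases "m = j")
    case True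
    \<comment> \<open>Nothing beyond \<open>j\<close> was visited, but the least reachable index is
      1. The hypothesis for it bounds even the distance to \<open>x (j + 2)\<close>.\<close>
    have "x (j + 1 + 1) - x j < x j + g" by (rule trap[OF reaches_1])
    moreover have "x (Suc m) < x (j + 1 + 1)" using True x_less_iff by simp
    ultimately show False using esc by simp
  next
    case False
    then have mj: "j < m" using jm by simp
    define v where "v = (LEAST t. j < l t)"
    have v: "j < l v" unfolding v_def by (rule LeastI[of _ t\<^sub>m]) (use mj tm in simp)
    have before: "l t \<le> j" if "t < v" for t using not_less_Least[of t "\<lambda>t. j < l t"] that
      by (auto simp: v_def[symmetric])
    have "v \<le> t\<^sub>m" unfolding v_def by (rule Least_le) (use mj tm in simp)
    then have "v \<le> n" using tm by simp
    moreover have "v \<noteq> n" using v j_def by auto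
    ultimately have vn: "v < n" by simp
    obtain u where u: "v = Suc u" using v l0 by (cases v) auto
    \<comment> \<open>The visit to \<open>j\<close> at time \<open>n\<close> uses a mark present at
      time \<open>n - 1\<close>, so \<open>j\<close> carries a mark at all earlier times
      too.\<close>
    have jcnt: "cnt (n - 1) j < b j"
      using step_ok[of "n - 1"] vn j_def by simp
    have lv: "l v = j + 1"
    proof (rule ccontr)
      assume "l v \<noteq> j + 1"
      then have "b (Suc j) \<le> cnt u (Suc j)" using no_skip[of u "Suc j"] v before[of u] u vn by simp
      moreover have "l s \<noteq> Suc j" if "s < u" for s using before[of s] u that by simp
      then have "cnt u (Suc j) = 0" unfolding cnt by auto
      ultimately show False using b_bounds(1)[of "Suc j"] by simp
    qed
    have lu: "l u = j"
    proof (rule ccontr)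
      assume "l u \<noteq> j"
      then have "b j \<le> cnt u j" using no_skip[of u j] v before[of u] u vn by simp
      also have "\<dots> \<le> cnt (n - 1) j" using cnt_mono u vn by simp
      finally show False using jcnt by simp
    qed
    \<comment> \<open>A return to \<open>j\<close> before time \<open>n\<close> would, with the
      visit at \<open>u\<close>, make two visits before time \<open>n - 1\<close>. But
      \<open>j\<close> has at most two marks and one must still be left then.\<close>
    have after: "j < l t" if "v \<le> t" "t < n" for t
      using that
    proof (induction t rule: dec_induct)
      case base then show ?case using v by simp
    next
      case (step t)
      have tn: "t < n" using step by simp
      show ?case
      proof (rule ccontr)
        assume *: "\<not> j < l (Suc t)"
        have "l (Suc t) = j"
        proof (rule ccontr)
          assume "l (Suc t) \<noteq> j"
          then have "b j \<le> cnt t j" using no_skip[of t j] * step tn by simp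
          also have "\<dots> \<le> cnt (n - 1) j" using cnt_mono step by simp
          finally show False using jcnt by simp
        qed
        then have "Suc t \<noteq> n - 1" using step_ne[of "n - 1"] vn j_def by auto
        then have "{u, Suc t} \<subseteq> {s. s < n - 1 \<and> l s = j}"
          using lu \<open>l (Suc t) = j\<close> step u by auto
        then have "card {u, Suc t} \<le> cnt (n - 1) j" unfolding cnt by (intro card_mono) auto
        moreover have "card {u, Suc t} = 2" using step u by auto
        ultimately show False using jcnt b_bounds(2)[of j] by simp
      qed
    qed
    \<comment> \<open>The excursion beyond \<open>j\<close>, without the return at time
      \<open>n\<close>, in indices relative to \<open>j\<close>. No point beyond \<open>j\<close> is
      visited before \<open>v\<close>, so counts along the excursion are counts along the whole
      walk.\<close>
    let ?L = "map (\<lambda>t. l t - j) [v..<n]"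
    have take: "count_list (take t ?L) k = cnt (v + t) (j + k)" if "v + t \<le> n" "k \<noteq> 0" for t k
    proof -
      have "take t ?L = map (\<lambda>t. l t - j) [v..<v + t]"
        using that by (simp add: take_map take_upt)
      then have "count_list (take t ?L) k = card {s. v \<le> s \<and> s < v + t \<and> l s - j = k}"
        by (simp add: count_list_map_upt)
      also have "{s. v \<le> s \<and> s < v + t \<and> l s - j = k} = {s. s < v + t \<and> l s = j + k}"
        using before after that by (force simp: not_le)
      finally show ?thesis unfolding cnt .
    qed
    have "greedy_path (\<lambda>k. x (j + k) - x j) (\<lambda>k. if k = 0 then 1 else b (j + k)) ?L"
      unfolding greedy_path_def
    proof (intro allI impI conjI)
      fix t assume "Suc t < length ?L"
      then have t: "v + Suc t < n" by simp
      have nth: "?L ! t = l (v + t) - j" "?L ! Suc t = l (v + Suc t) - j" using t by auto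
      have gt: "j < l (v + t)" "j < l (Suc (v + t))" using after[of "v + t"] after[of "v + Suc t"] t by auto
      show "?L ! Suc t \<noteq> ?L ! t" unfolding nth using step_ne[of "v + t"] gt t by auto
      show "count_list (take t ?L) (?L ! Suc t) < (if ?L ! Suc t = 0 then 1 else b (j + ?L ! Suc t))"
        unfolding nth using take[of t "l (v + Suc t) - j"] step_ok[of "v + t"] gt t by simp
      fix k assume k: "k \<noteq> ?L ! t \<and> count_list (take t ?L) k < (if k = 0 then 1 else b (j + k))"
      \<comment> \<open>The relative index 0 stands for \<open>j\<close>, and the one mark it has in
        the relative environment is present in the walk throughout the excursion.\<close>
      have "cnt (v + t) (j + k) < b (j + k)"
      proof (cases "k = 0")
        case True
        have "cnt (v + t) j \<le> cnt (n - 1) j" using t by (intro cnt_mono) simp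
        then show ?thesis using jcnt True by simp
      next
        case False
        then show ?thesis using k take[of t k] t by simp
      qed
      then show "\<bar>x (j + ?L ! Suc t) - x j - (x (j + ?L ! t) - x j)\<bar> \<le>
          \<bar>x (j + k) - x j - (x (j + ?L ! t) - x j)\<bar>"
        using step_min[of "v + t" "j + k"] k t gt unfolding nth by (auto simp: nat_diff_split)
    qed
    moreover have "?L \<noteq> []" "hd ?L = 1" using vn lv by (auto simp: hd_map)
    moreover have "0 \<notin> set ?L" using after by force
    moreover have "m - j \<in> set ?L"
    proof -
      have "t\<^sub>m < n" "v \<le> t\<^sub>m" using tm mj before[of t\<^sub>m] j_def by (force simp: le_less, force simp: not_less[symmetric])
      then show ?thesis using tm(2) by force
    qed
    ultimately have "reaches (\<lambda>k. x (j + k) - x j) (\<lambda>k. if k = 0 then 1 else b (j + k)) (m - j)"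
      unfolding reaches_def by blast
    from trap[OF this] have "x (m + 1) - x j < x j + g" using mj by simp
    then show False using esc by simp
  qed
qed

text \<open>As \<open>x 1 < g\<close>, the first step goes to \<open>x 1\<close>. With 0 exhausted,
  any mark left of 0 is then at distance at least \<open>x 1 + g\<close>, so a path that never
  prefers a mark at distance \<open>g\<close> from \<open>x 1\<close> is the path of the walk, and
  it visits \<open>n\<close> distinct positive points.\<close>

lemma hitting_time_ge:
  assumes gap: "x 1 < g"
    and no_ties: "\<And>i j k. i < j \<Longrightarrow> j < k \<Longrightarrow> x j - x i \<noteq> x k - x j"
    and reach: "reaches (\<lambda>k. if k = 0 then 0 else g + x k - x 1) (\<lambda>k. if k = 0 then 1 else b k) n"
  shows "enat n \<le> hitting_time S {..0}"
proof -
  let ?x = "\<lambda>k. if k = 0 then 0 else g + x k - x 1" and ?b = "\<lambda>k. if k = 0 then 1 else b k"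
  obtain l where l: "l \<noteq> []" "hd l = 1" "0 \<notin> set l" "n \<in> set l" and gr: "greedy_path ?x ?b l"
    using reach unfolding reaches_def by auto
  have pos: "1 \<le> l ! t" if "t < length l" for t
    using l(3) nth_mem[OF that] by (metis One_nat_def Suc_leI neq0_conv)
  \<comment> \<open>Equal distances could only come from opposite sides; excluding them identifies
    each step of the walk with that of the list.\<close>
  have ne: "x i - x c \<noteq> x c - x k" if "i \<noteq> k" for i c k
    using no_ties[of i c k] no_ties[of k c i] that x_less_iff[of i c] x_less_iff[of c i]
      x_less_iff[of k c] x_less_iff[of c k] x_eq_iff[of i c] x_eq_iff[of c k]
    by (smt (verit) linorder_neqE_nat)
  have walk: "\<forall>s\<le>t. S (Suc s) = x (l ! s)" if "t < length l" for t
    using that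
  proof (induction t)
    case 0
    have "1 \<le> greedy_env w 0 0 (x 1)" using b_bounds(1)[of 1] by (simp add: b_def)
    moreover have "x 1 \<noteq> S 0" using x_eq_iff[of 1 0] x0 by simp
    ultimately have le: "\<bar>S (Suc 0) - 0\<bar> \<le> \<bar>x 1 - 0\<bar>" using walk_step(3)[of "x 1" 0] by simp
    have "0 < x 1" using x_less_iff[of 0 1] x0 by simp
    then have "0 \<le> S (Suc 0)" using neg[OF walk_in, of "Suc 0"] le gap by force
    then obtain k where k: "S (Suc 0) = x k" using walk_index by blast
    have "k \<noteq> 0" using walk_nonzero[of 0] k x0 by metis
    moreover have "x k \<le> x 1" using le k x_nonneg[of k] x_nonneg[of 1] by simp
    ultimately have "k = 1" using x_le_iff[of k 1] by simp
    then show ?case using k l by (simp add: hd_conv_nth)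
  next
    case (Suc t)
    then have IH: "S (Suc s) = x (l ! s)" if "s \<le> t" for s using that by auto
    let ?c = "l ! t" and ?d = "l ! Suc t"
    have cd: "1 \<le> ?c" "1 \<le> ?d" using pos[of t] pos[of "Suc t"] Suc.prems by auto
    \<comment> \<open>List position \<open>s\<close> is walk time \<open>Suc s\<close>. The extra
      time 0 is spent at the point 0, hence the restriction to \<open>k \<noteq> 0\<close>.\<close>
    have cnt: "count_list (map S [0..<Suc t]) (x k) = count_list (take t l) k" if "k \<noteq> 0" for k
    proof -
      have "take t l = map (\<lambda>s. l ! s) [0..<t]" using Suc.prems by (intro nth_equalityI) auto
      then have "count_list (take t l) k = card {s. s < t \<and> l ! s = k}" by (simp add: count_list_map_upt)
      also have "\<dots> = card (Suc ` {s. s < t \<and> l ! s = k})" by (simp add: card_image)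
      also have "Suc ` {s. s < t \<and> l ! s = k} = {s. 0 \<le> s \<and> s < Suc t \<and> S s = x k}"
      proof -
        have "S 0 \<noteq> x k" using that x_eq_iff[of 0 k] x0 by simp
        moreover have "S (Suc s) = x k \<longleftrightarrow> l ! s = k" if "s < t" for s
          using IH[of s] that x_eq_iff by simp
        ultimately have "s \<in> Suc ` {s. s < t \<and> l ! s = k} \<longleftrightarrow> s < Suc t \<and> S s = x k" for s
          by (cases s) (auto)
        then show ?thesis by auto
      qed
      finally show ?thesis by (simp only: count_list_map_upt)
    qed
    have env: "greedy_env w 0 (Suc t) (x k) = b k - count_list (take t l) k" if "k \<noteq> 0" for k
      using cnt[OF that] by (simp only: greedy_env_eq b_def)
    have grt: "?d \<noteq> ?c" "count_list (take t l) ?d < b ?d"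
      using greedy_pathD(1,2)[OF gr Suc.prems] cd by simp_all
    have mn: "\<bar>?x ?d - ?x ?c\<bar> \<le> \<bar>?x k - ?x ?c\<bar>" if "k \<noteq> ?c" "count_list (take t l) k < ?b k" for k
      by (rule greedy_pathD(3)[OF gr Suc.prems that])
    have ST: "S (Suc t) = x ?c" using IH by simp
    have le: "\<bar>S (Suc (Suc t)) - x ?c\<bar> \<le> \<bar>x ?d - x ?c\<bar>"
      using walk_step(3)[of "x ?d" "Suc t"] env[of ?d] grt cd ST x_eq_iff by auto
    \<comment> \<open>The list never enters 0, so the mark there competes at each step and bounds
      its length by \<open>g + x ?c - x 1\<close>, less than the distance to any negative
      point.\<close>
    have "0 \<notin> set (take t l)" using l(3) by (meson in_set_takeD)
    then have "count_list (take t l) 0 = 0" by (simp add: count_list_0_iff)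
    then have "\<bar>?x ?d - ?x ?c\<bar> \<le> \<bar>?x 0 - ?x ?c\<bar>" using mn[of 0] cd by simp
    then have d0: "\<bar>x ?d - x ?c\<bar> \<le> g + x ?c - x 1" using cd x_le_iff[of 1 ?c] g_pos by simp
    have "0 < x 1" using x_less_iff[of 0 1] x0 by simp
    then have "\<bar>x ?d - x ?c\<bar> < x ?c + g" using d0 by simp
    then have "0 \<le> S (Suc (Suc t))" using neg[OF walk_in, of "Suc (Suc t)"] le by force
    then obtain k where k: "S (Suc (Suc t)) = x k" using walk_index by blast
    have k0: "k \<noteq> 0" using walk_nonzero[of "Suc t"] k x0 by metis
    have kc: "k \<noteq> ?c" using walk_step(1)[of "Suc t"] k ST by auto
    have "count_list (take t l) k < ?b k"
      using walk_step(2)[of "Suc t"] env[OF k0] k k0 by simp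
    then have "\<bar>x ?d - x ?c\<bar> \<le> \<bar>x k - x ?c\<bar>" using mn[of k] kc cd k0 by simp
    then have eq: "\<bar>x ?d - x ?c\<bar> = \<bar>x k - x ?c\<bar>" using le k by simp
    have "k = ?d"
    proof (rule ccontr)
      assume "k \<noteq> ?d"
      then show False using eq ne[of k ?d ?c] x_eq_iff[of k ?d] by (auto simp: abs_if split: if_splits)
    qed
    then show ?case using IH k by (simp add: le_Suc_eq)
  qed
  have "strict_mono ?x"
  proof (rule strict_monoI)
    fix i k :: nat assume ik: "i < k"
    then have "x 1 \<le> x k" "x i < x k" using x_le_iff[of 1 k] x_less_iff by auto
    then show "?x i < ?x k" using ik g_pos by auto
  qed
  then have "{1..n} \<subseteq> set l"
    by (rule reaches_contiguous) (use l gr b_bounds in auto)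
  then have "card {1..n} \<le> card (set l)" by (intro card_mono) auto
  then have len: "n \<le> length l" using card_length[of l] by simp
  have "n \<le> m" if "1 \<le> m" "S m \<le> 0" for m
  proof (rule ccontr)
    assume "\<not> n \<le> m"
    then have "m - 1 < length l" using len by simp
    then have "S (Suc (m - 1)) = x (l ! (m - 1))" "1 \<le> l ! (m - 1)" using walk pos by auto
    then have "0 < S m" using x_less_iff[of 0 "l ! (m - 1)"] x0 that by simp
    then show False using that by simp
  qed
  then show ?thesis unfolding hitting_time_def by (auto intro!: Inf_greatest)
qed

end

section \<open>Enumeration of the points\<close>

primrec nth_point :: "real set \<Rightarrow> nat \<Rightarrow> real" where
  "nth_point A 0 = 0"
| "nth_point A (Suc n) = Inf (A \<inter> {nth_point A n<..})"

declare nth_point.simps(2) [simp del]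

definition left_gap :: "real set \<Rightarrow> real" where
  "left_gap A = - Sup (A \<inter> {..<0})"

text \<open>Stated through counts on countably many bounded windows, so that it becomes a measurable
  condition.\<close>

definition right_unbounded :: "real set \<Rightarrow> bool" where
  "right_unbounded A \<longleftrightarrow> (\<forall>k. \<exists>m::nat. k \<le> card (A \<inter> {0<..real m}))"

definition left_inhabited :: "real set \<Rightarrow> bool" where
  "left_inhabited A \<longleftrightarrow> (\<exists>m::nat. 1 \<le> card (A \<inter> {- real m..<0}))"

definition locally_finite_set :: "real set \<Rightarrow> bool" where
  "locally_finite_set A \<longleftrightarrow> (\<forall>B. bounded B \<longrightarrow> finite (A \<inter> B))"

lemma locally_finite_setD: "locally_finite_set A \<Longrightarrow> bounded B \<Longrightarrow> finite (A \<inter> B)"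
  by (simp add: locally_finite_set_def)

context
  fixes A :: "real set"
  assumes lf: "locally_finite_set A" and ru: "right_unbounded A"
begin

lemma nth_point_step:
  shows nth_point_in: "nth_point A (Suc n) \<in> A"
    and nth_point_less: "nth_point A n < nth_point A (Suc n)"
    and nth_point_least: "y \<in> A \<Longrightarrow> nth_point A n < y \<Longrightarrow> nth_point A (Suc n) \<le> y"
proof -
  let ?a = "nth_point A n"
  obtain m :: nat where m: "Suc (card (A \<inter> {0<..?a})) \<le> card (A \<inter> {0<..real m})"
    using ru unfolding right_unbounded_def by blast
  have "finite (A \<inter> {0<..?a})" by (rule locally_finite_setD[OF lf]) simp
  then have "\<not> A \<inter> {0<..real m} \<subseteq> A \<inter> {0<..?a}"
    using m card_mono[of "A \<inter> {0<..?a}" "A \<inter> {0<..real m}"] by linarith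
  then obtain z where "z \<in> A \<inter> {0<..real m}" "z \<notin> A \<inter> {0<..?a}" unfolding subset_iff by blast
  then have z: "z \<in> A" "?a < z" by auto
  let ?F = "A \<inter> {?a<..z}"
  have fin: "finite ?F" by (rule locally_finite_setD[OF lf]) simp
  have ne: "?F \<noteq> {}" using z by auto
  have mem: "Min ?F \<in> ?F" using fin ne by (rule Min_in)
  have least: "Min ?F \<le> y" if "y \<in> A \<inter> {?a<..}" for y
  proof (cases "y \<le> z")
    case True then show ?thesis using that fin by (intro Min_le) auto
  next
    case False then show ?thesis using mem by auto
  qed
  have "Min ?F \<in> A \<inter> {?a<..}" using mem by simp
  then have eq: "nth_point A (Suc n) = Min ?F"
    unfolding nth_point.simps(2) using least by (rule cInf_eq_minimum)
  show "nth_point A (Suc n) \<in> A" "nth_point A n < nth_point A (Suc n)"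
    unfolding eq using mem by auto
  show "nth_point A (Suc n) \<le> y" if "y \<in> A" "nth_point A n < y"
    unfolding eq using least[of y] that by simp
qed

lemma nth_point_strict_mono: "strict_mono (nth_point A)"
  using nth_point_less by (simp add: strict_mono_Suc_iff)

lemma nth_point_pos: "0 < n \<Longrightarrow> 0 < nth_point A n"
  using strict_monoD[OF nth_point_strict_mono, of 0 n] by simp

lemma nth_point_nonneg: "0 \<le> nth_point A n"
  using nth_point_pos[of n] by (cases n) auto

lemma nth_point_surj:
  assumes "y \<in> A" "0 < y"
  shows "\<exists>n. y = nth_point A n"
proof (rule ccontr)
  assume ne: "\<nexists>n. y = nth_point A n"
  have less: "nth_point A n < y" for n
  proof (induction n)
    case (Suc n)
    then have "nth_point A (Suc n) \<le> y" by (rule nth_point_least[OF assms(1)])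
    moreover have "y \<noteq> nth_point A (Suc n)" using ne by blast
    ultimately show ?case by simp
  qed (use assms in simp)
  have "range (\<lambda>n. nth_point A (Suc n)) \<subseteq> A \<inter> {0..y}"
    using nth_point_in nth_point_nonneg less_imp_le[OF less] by (auto)
  moreover have "finite (A \<inter> {0..y})" by (rule locally_finite_setD[OF lf]) simp
  moreover have "inj (\<lambda>n. nth_point A (Suc n))"
    using strict_mono_eq[OF nth_point_strict_mono] by (intro injI) simp
  ultimately show False using range_inj_infinite[of "\<lambda>n. nth_point A (Suc n)"] infinite_super by blast
qed

lemma range_nth_point: "range (nth_point A) = insert 0 A \<inter> {0..}"
proof
  show "range (nth_point A) \<subseteq> insert 0 A \<inter> {0..}"
  proof safe
    fix n assume "nth_point A n \<notin> A"
    then show "nth_point A n = 0" using nth_point_in by (cases n) auto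
  qed (simp add: nth_point_nonneg)
  show "insert 0 A \<inter> {0..} \<subseteq> range (nth_point A)"
  proof
    fix y assume y: "y \<in> insert 0 A \<inter> {0..}"
    show "y \<in> range (nth_point A)"
    proof (cases "y = 0")
      case True
      then have "y = nth_point A 0" by simp
      then show ?thesis by (rule range_eqI)
    next
      case False
      then have "\<exists>n. y = nth_point A n" using y by (intro nth_point_surj) auto
      then show ?thesis by (elim exE) (rule range_eqI)
    qed
  qed
qed

text \<open>Translates the position of a point into a count on a fixed window, which is what is
  known to be measurable.\<close>

lemma nth_point_le_iff:
  assumes "1 \<le> n"
  shows "nth_point A n \<le> s \<longleftrightarrow> n \<le> card (A \<inter> {0<..s})"
proof
  have fin: "finite (A \<inter> {0<..s})" by (rule locally_finite_setD[OF lf]) simp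
  have inj: "inj_on (nth_point A) B" for B
    by (rule strict_mono_on_imp_inj_on)
      (use nth_point_strict_mono in \<open>auto simp: strict_mono_def strict_mono_on_def\<close>)
  {
    assume le: "nth_point A n \<le> s"
    have "nth_point A ` {1..n} \<subseteq> A \<inter> {0<..s}"
    proof
      fix y assume "y \<in> nth_point A ` {1..n}"
      then obtain k where k: "1 \<le> k" "k \<le> n" "y = nth_point A k" by auto
      then have "nth_point A k \<in> A" using nth_point_in[of "k - 1"] by simp
      moreover have "nth_point A k \<le> nth_point A n"
        using strict_mono_less_eq[OF nth_point_strict_mono] k by simp
      ultimately show "y \<in> A \<inter> {0<..s}" using k le nth_point_pos[of k] by auto
    qed
    then have "card (nth_point A ` {1..n}) \<le> card (A \<inter> {0<..s})" using fin by (intro card_mono)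
    then show "n \<le> card (A \<inter> {0<..s})" by (simp add: card_image inj)
  }
  {
    assume le: "n \<le> card (A \<inter> {0<..s})"
    show "nth_point A n \<le> s"
    proof (rule ccontr)
      assume gt: "\<not> nth_point A n \<le> s"
      have "A \<inter> {0<..s} \<subseteq> nth_point A ` {1..<n}"
      proof
        fix y assume y: "y \<in> A \<inter> {0<..s}"
        then obtain k where k: "y = nth_point A k" using nth_point_surj by auto
        then have "nth_point A k < nth_point A n" using y gt by auto
        then have "k < n" using strict_mono_less[OF nth_point_strict_mono] by simp
        moreover have "k \<noteq> 0" using y k by (intro notI) simp
        ultimately show "y \<in> nth_point A ` {1..<n}" using k by auto
      qed
      then have "card (A \<inter> {0<..s}) \<le> card (nth_point A ` {1..<n})" by (intro card_mono) auto
      also have "\<dots> \<le> n - 1" using card_image_le[of "{1..<n}" "nth_point A"] by simp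
      finally show False using le assms by simp
    qed
  }
qed

text \<open>The enumeration up to level \<open>b\<close> sees only the points in
  \<open>{0<..b}\<close>; this makes it a function of the past of \<open>b\<close>.\<close>

lemma nth_point_cong:
  assumes "A \<inter> {0<..b} = A' \<inter> {0<..b}"
  shows "nth_point A n \<le> b \<Longrightarrow> nth_point A' n = nth_point A n"
proof (induction n)
  case (Suc n)
  let ?z = "nth_point A (Suc n)"
  have eq: "nth_point A' n = nth_point A n" using Suc nth_point_less[of n] by simp
  have z: "0 < ?z" "?z \<in> A" "nth_point A n < ?z"
    using nth_point_pos[of "Suc n"] nth_point_in[of n] nth_point_less[of n] by simp_all
  have "Inf (A' \<inter> {nth_point A n<..}) = ?z"
  proof (rule cInf_eq_minimum)
    have "?z \<in> A \<inter> {0<..b}" using z Suc.prems by simp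
    then have "?z \<in> A'" unfolding assms by simp
    then show "?z \<in> A' \<inter> {nth_point A n<..}" using z by simp
    fix y assume y: "y \<in> A' \<inter> {nth_point A n<..}"
    show "?z \<le> y"
    proof (cases "y \<le> b")
      case True
      then have "y \<in> A' \<inter> {0<..b}" using y nth_point_nonneg[of n] by auto
      then have "y \<in> A" unfolding assms[symmetric] by simp
      then show ?thesis using nth_point_least[of y n] y by simp
    qed (use Suc.prems in simp)
  qed
  then show ?case using eq by (simp add: nth_point.simps(2))
qed simp

end

lemma left_gap_props:
  assumes lf: "locally_finite_set A" and li: "left_inhabited A"
  shows left_gap_pos: "0 < left_gap A"
    and left_gap_le: "y \<in> A \<Longrightarrow> y < 0 \<Longrightarrow> y \<le> - left_gap A"
    and less_left_gap_iff: "t < left_gap A \<longleftrightarrow> card (A \<inter> {- t..<0}) = 0"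
proof -
  obtain m :: nat where "1 \<le> card (A \<inter> {- real m..<0})" using li unfolding left_inhabited_def by blast
  then have "A \<inter> {- real m..<0} \<noteq> {}" by (metis card.empty not_one_le_zero)
  then obtain z where z: "z \<in> A" "z < 0" by auto
  let ?F = "A \<inter> {z..<0}"
  have fin: "finite ?F" by (rule locally_finite_setD[OF lf]) simp
  have mem: "Max ?F \<in> ?F" using fin z by (intro Max_in) auto
  have ge: "y \<le> Max ?F" if "y \<in> A \<inter> {..<0}" for y
  proof (cases "z \<le> y")
    case True then show ?thesis using that fin by (intro Max_ge) auto
  next
    case False then show ?thesis using mem by auto
  qed
  have "Max ?F \<in> A \<inter> {..<0}" using mem by simp
  then have "Sup (A \<inter> {..<0}) = Max ?F"
    using ge by (rule cSup_eq_maximum)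
  then have eq: "left_gap A = - Max ?F" by (simp add: left_gap_def)
  show "0 < left_gap A" using mem eq by auto
  show "y \<in> A \<Longrightarrow> y < 0 \<Longrightarrow> y \<le> - left_gap A" using ge[of y] eq by auto
  have "finite (A \<inter> {- t..<0})" by (rule locally_finite_setD[OF lf]) simp
  then have "card (A \<inter> {- t..<0}) = 0 \<longleftrightarrow> A \<inter> {- t..<0} = {}" by simp
  also have "\<dots> \<longleftrightarrow> t < left_gap A"
  proof
    assume "A \<inter> {- t..<0} = {}"
    then show "t < left_gap A" using mem eq by force
  next
    assume "t < left_gap A"
    then show "A \<inter> {- t..<0} = {}" using ge eq by force
  qed
  finally show "t < left_gap A \<longleftrightarrow> card (A \<inter> {- t..<0}) = 0" by simp
qed

section \<open>Regularized configurations and measurability of the enumeration\<close>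

definition generic :: "real set \<Rightarrow> bool" where
  "generic A \<longleftrightarrow> right_unbounded A \<and> left_inhabited A"

text \<open>
  Replacing degenerate configurations by \<open>\<int>\<close>, and the unknown future by integers, makes the
  enumeration total and measurable with respect to the relevant sub-algebras.
\<close>

definition regularized :: "real set \<Rightarrow> real set" where
  "regularized A = (if generic A then A else \<int>)"

definition past_completed :: "real \<Rightarrow> real set \<Rightarrow> real set" where
  "past_completed b A = A \<inter> {0<..b} \<union> \<int> \<inter> {b<..}"

lemma locally_finite_Ints: "locally_finite_set \<int>"
  unfolding locally_finite_set_def
proof (intro allI impI)
  fix B :: "real set" assume "bounded B"
  then obtain a where a: "\<And>x. x \<in> B \<Longrightarrow> \<bar>x\<bar> \<le> a" by (auto simp: bounded_real)
  have "\<int> \<inter> B \<subseteq> of_int ` {- \<lceil>a\<rceil>..\<lceil>a\<rceil>}"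
  proof
    fix x assume x: "x \<in> \<int> \<inter> B"
    then obtain i where i: "x = of_int i" by (auto elim: Ints_cases)
    then have "\<bar>real_of_int i\<bar> \<le> a" using a x by blast
    then have "\<bar>i\<bar> \<le> \<lceil>a\<rceil>" by linarith
    then show "x \<in> of_int ` {- \<lceil>a\<rceil>..\<lceil>a\<rceil>}" using i by (auto simp: abs_le_iff)
  qed
  then show "finite (\<int> \<inter> B)" by (rule finite_subset) simp
qed

lemma right_unbounded_of_Ints:
  assumes lf: "locally_finite_set A" and ge: "\<And>m::nat. c \<le> m \<Longrightarrow> real m \<in> A"
  shows "right_unbounded A"
  unfolding right_unbounded_def
proof
  fix k
  have "real ` {c + 1..c + k} \<subseteq> A \<inter> {0<..real (c + k)}"
    by (intro image_subsetI IntI ge) simp_all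
  then have "card (real ` {c + 1..c + k}) \<le> card (A \<inter> {0<..real (c + k)})"
    by (intro card_mono locally_finite_setD[OF lf]) auto
  then have "k \<le> card (A \<inter> {0<..real (c + k)})" by (simp add: card_image)
  then show "\<exists>m::nat. k \<le> card (A \<inter> {0<..real m})" by blast
qed

lemma generic_Ints: "generic \<int>"
  unfolding generic_def
proof
  show "right_unbounded \<int>" by (rule right_unbounded_of_Ints[OF locally_finite_Ints, of 0]) simp
  have "- 1 \<in> (\<int> :: real set) \<inter> {- real 1..<0}" by simp
  moreover have "finite ((\<int> :: real set) \<inter> {- real 1..<0})"
    by (rule locally_finite_setD[OF locally_finite_Ints]) simp
  ultimately have "0 < card ((\<int> :: real set) \<inter> {- real 1..<0})" using card_gt_0_iff by blast
  then show "left_inhabited \<int>" unfolding left_inhabited_def by (intro exI[of _ 1]) linarith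
qed

lemma generic_regularized: "generic (regularized A)"
  using generic_Ints by (simp add: regularized_def)

lemma locally_finite_regularized: "locally_finite_set A \<Longrightarrow> locally_finite_set (regularized A)"
  using locally_finite_Ints by (simp add: regularized_def)

lemma locally_finite_past_completed: "locally_finite_set A \<Longrightarrow> locally_finite_set (past_completed b A)"
  using locally_finite_Ints
  by (auto simp: past_completed_def locally_finite_set_def Int_Un_distrib2 Int_assoc
      intro: bounded_Int)

lemma right_unbounded_past_completed:
  assumes "locally_finite_set A" shows "right_unbounded (past_completed b A)"
proof (rule right_unbounded_of_Ints[OF locally_finite_past_completed[OF assms], of "nat \<lceil>b\<rceil> + 1"])
  fix m :: nat assume "nat \<lceil>b\<rceil> + 1 \<le> m"
  then show "real m \<in> past_completed b A" unfolding past_completed_def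
    by (auto simp: nat_le_iff) linarith
qed

lemma measurable_nth_point:
  assumes good: "\<And>\<omega>. \<omega> \<in> space N \<Longrightarrow> locally_finite_set (Z \<omega>) \<and> right_unbounded (Z \<omega>)"
    and meas: "\<And>s. (\<lambda>\<omega>. card (Z \<omega> \<inter> {0<..s})) \<in> N \<rightarrow>\<^sub>M count_space UNIV"
  shows "(\<lambda>\<omega>. nth_point (Z \<omega>) n) \<in> borel_measurable N"
proof (cases "n = 0")
  case False
  show ?thesis
  proof (rule borel_measurable_iff_le[THEN iffD2], rule allI)
    fix s
    have "{\<omega> \<in> space N. nth_point (Z \<omega>) n \<le> s} = {\<omega> \<in> space N. n \<le> card (Z \<omega> \<inter> {0<..s})}"
    proof (rule Collect_cong, rule conj_cong[OF refl])
      fix \<omega> assume "\<omega> \<in> space N"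
      then show "nth_point (Z \<omega>) n \<le> s \<longleftrightarrow> n \<le> card (Z \<omega> \<inter> {0<..s})"
        using nth_point_le_iff[of "Z \<omega>" n s] good[of \<omega>] False by linarith
    qed
    also have "\<dots> = (\<lambda>\<omega>. card (Z \<omega> \<inter> {0<..s})) -` {n..} \<inter> space N" by auto
    also have "\<dots> \<in> sets N" by (rule measurable_sets[OF meas]) simp
    finally show "{\<omega> \<in> space N. nth_point (Z \<omega>) n \<le> s} \<in> sets N" .
  qed
qed simp

lemma measurable_left_gap:
  assumes good: "\<And>\<omega>. \<omega> \<in> space N \<Longrightarrow> locally_finite_set (Z \<omega>) \<and> left_inhabited (Z \<omega>)"
    and meas: "\<And>s. (\<lambda>\<omega>. card (Z \<omega> \<inter> {- s..<0})) \<in> N \<rightarrow>\<^sub>M count_space UNIV"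
  shows "(\<lambda>\<omega>. left_gap (Z \<omega>)) \<in> borel_measurable N"
proof (rule borel_measurable_iff_greater[THEN iffD2], rule allI)
  fix s
  have "{\<omega> \<in> space N. s < left_gap (Z \<omega>)} = {\<omega> \<in> space N. card (Z \<omega> \<inter> {- s..<0}) = 0}"
    using less_left_gap_iff good by (intro Collect_cong) blast
  also have "\<dots> = (\<lambda>\<omega>. card (Z \<omega> \<inter> {- s..<0})) -` {0} \<inter> space N" by auto
  also have "\<dots> \<in> sets N" by (rule measurable_sets[OF meas]) simp
  finally show "{\<omega> \<in> space N. s < left_gap (Z \<omega>)} \<in> sets N" .
qed

text \<open>Only sets avoiding 0 are used, because the algebra generated by
  \<open>insert 0 (X \<omega>)\<close> does not reveal whether \<open>X \<omega>\<close> itself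
  contains 0.\<close>

lemma measurable_generic:
  assumes "\<And>B. B \<in> sets borel \<Longrightarrow> bounded B \<Longrightarrow> 0 \<notin> B \<Longrightarrow>
      (\<lambda>\<omega>. card (X \<omega> \<inter> B)) \<in> N \<rightarrow>\<^sub>M count_space UNIV"
  shows "{\<omega> \<in> space N. generic (X \<omega>)} \<in> sets N"
proof -
  have [measurable]: "(\<lambda>\<omega>. card (X \<omega> \<inter> {0<..real m})) \<in> N \<rightarrow>\<^sub>M count_space UNIV"
    "(\<lambda>\<omega>. card (X \<omega> \<inter> {- real m..<0})) \<in> N \<rightarrow>\<^sub>M count_space UNIV" for m :: nat
    by (rule assms; simp)+
  show ?thesis unfolding generic_def right_unbounded_def left_inhabited_def by measurable
qed

lemma measurable_card_regularized:
  assumes "\<And>B. B \<in> sets borel \<Longrightarrow> bounded B \<Longrightarrow> 0 \<notin> B \<Longrightarrow>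
      (\<lambda>\<omega>. card (X \<omega> \<inter> B)) \<in> N \<rightarrow>\<^sub>M count_space UNIV"
    and "B \<in> sets borel" "bounded B" "0 \<notin> B"
  shows "(\<lambda>\<omega>. card (regularized (X \<omega>) \<inter> B)) \<in> N \<rightarrow>\<^sub>M count_space UNIV"
proof -
  have "(\<lambda>\<omega>. card (regularized (X \<omega>) \<inter> B)) =
      (\<lambda>\<omega>. if generic (X \<omega>) then card (X \<omega> \<inter> B) else card (\<int> \<inter> B))"
    by (auto simp: regularized_def)
  also have "\<dots> \<in> N \<rightarrow>\<^sub>M count_space UNIV"
    by (rule measurable_If[OF assms(1)[OF assms(2-4)] _ measurable_generic[OF assms(1)]]) auto
  finally show ?thesis .
qed

section \<open>The gaps of a Poisson process\<close>

locale unit_poisson = poisson_process M X 1 for M :: "'w measure" and X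
begin

section \<open>Independence of the past from a later empty window\<close>

definition past :: "real \<Rightarrow> 'w measure" where
  "past b = sigma (space M)
    {{\<omega> \<in> space M. card (X \<omega> \<inter> B) = k} | B k. B \<in> sets borel \<and> bounded B \<and> B \<subseteq> {..b}}"

text \<open>The generators of \<open>past b\<close> prescribe one count and are not closed under
  intersection; prescribing finitely many counts gives a pi-system.\<close>

definition cylinders :: "real \<Rightarrow> 'w set set" where
  "cylinders b = {{\<omega> \<in> space M. \<forall>B\<in>\<B>. card (X \<omega> \<inter> B) = \<kappa> B} | \<B> \<kappa>.
    finite \<B> \<and> (\<forall>B\<in>\<B>. B \<in> sets borel \<and> bounded B \<and> B \<subseteq> {..b})}"

lemma space_past: "space (past b) = space M"
  unfolding past_def by (rule space_measure_of) auto

lemma sets_past: "sets (past b) = sigma_sets (space M)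
    {{\<omega> \<in> space M. card (X \<omega> \<inter> B) = k} | B k. B \<in> sets borel \<and> bounded B \<and> B \<subseteq> {..b}}"
  unfolding past_def by (rule sets_measure_of) auto

lemma count_sets: "B \<in> sets borel \<Longrightarrow> bounded B \<Longrightarrow> {\<omega> \<in> space M. card (X \<omega> \<inter> B) = k} \<in> sets M"
  using measurable_sets[OF measurable_count, of B "{k}"] by (simp add: vimage_def Int_def conj_commute)

lemma cylinders_sets: "cylinders b \<subseteq> sets M"
proof
  fix E assume "E \<in> cylinders b"
  then obtain \<B> \<kappa> where E: "E = {\<omega> \<in> space M. \<forall>B\<in>\<B>. card (X \<omega> \<inter> B) = \<kappa> B}" "finite \<B>"
    "\<forall>B\<in>\<B>. B \<in> sets borel \<and> bounded B \<and> B \<subseteq> {..b}"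
    unfolding cylinders_def by blast
  have "E = (\<Inter>B\<in>\<B>. {\<omega> \<in> space M. card (X \<omega> \<inter> B) = \<kappa> B}) \<inter> space M"
    unfolding E(1) by auto
  also have "\<dots> \<in> sets M"
  proof (cases "\<B> = {}")
    case False
    show ?thesis
      by (intro sets.Int sets.top sets.finite_INT[OF E(2) False] count_sets) (use E(3) in auto)
  qed simp
  finally show "E \<in> sets M" .
qed

lemma Int_stable_cylinders: "Int_stable (cylinders b)"
proof (rule Int_stableI)
  fix E F assume "E \<in> cylinders b" "F \<in> cylinders b"
  then obtain \<B> \<kappa> \<C> \<nu> where
    E: "E = {\<omega> \<in> space M. \<forall>B\<in>\<B>. card (X \<omega> \<inter> B) = \<kappa> B}" "finite \<B>"
      "\<forall>B\<in>\<B>. B \<in> sets borel \<and> bounded B \<and> B \<subseteq> {..b}"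
    and F: "F = {\<omega> \<in> space M. \<forall>B\<in>\<C>. card (X \<omega> \<inter> B) = \<nu> B}" "finite \<C>"
      "\<forall>B\<in>\<C>. B \<in> sets borel \<and> bounded B \<and> B \<subseteq> {..b}"
    unfolding cylinders_def by blast
  show "E \<inter> F \<in> cylinders b"
  proof (cases "\<forall>B\<in>\<B> \<inter> \<C>. \<kappa> B = \<nu> B")
    case True
    have "E \<inter> F = {\<omega> \<in> space M. \<forall>B\<in>\<B> \<union> \<C>. card (X \<omega> \<inter> B) = (if B \<in> \<B> then \<kappa> B else \<nu> B)}"
      unfolding E(1) F(1) using True by auto
    then show ?thesis unfolding cylinders_def
      using E(2,3) F(2,3)
      by (intro CollectI exI[of _ "\<B> \<union> \<C>"] exI[of _ "\<lambda>B. if B \<in> \<B> then \<kappa> B else \<nu> B"]) auto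
  next
    case False
    \<comment> \<open>Contradictory prescriptions give the empty event, which is a cylinder too: the
      empty set never has count 1.\<close>
    then have "E \<inter> F = {\<omega> \<in> space M. \<forall>B\<in>{{}}. card (X \<omega> \<inter> B) = 1}"
      unfolding E(1) F(1) by auto
    then show ?thesis unfolding cylinders_def
      by (intro CollectI exI[of _ "{{}}"] exI[of _ "\<lambda>_. 1"]) auto
  qed
qed

lemma past_sub_cylinders: "sets (past b) \<subseteq> sigma_sets (space M) (cylinders b)"
  unfolding sets_past
proof (rule sigma_sets_mono, safe)
  fix B :: "real set" and k
  assume B: "B \<in> sets borel" "bounded B" "B \<subseteq> {..b}"
  have "{\<omega> \<in> space M. card (X \<omega> \<inter> B) = k} \<in> cylinders b"
    unfolding cylinders_def using B
    by (intro CollectI exI[of _ "{B}"] exI[of _ "\<lambda>_. k"]) auto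
  then show "{\<omega> \<in> space M. card (X \<omega> \<inter> B) = k} \<in> sigma_sets (space M) (cylinders b)" ..
qed

lemma prob_no_points:
  assumes "0 \<le> t"
  shows "prob {\<omega> \<in> space M. card (X \<omega> \<inter> {c<..c + t}) = 0} = exp (- t)"
    "prob {\<omega> \<in> space M. card (X \<omega> \<inter> {c - t..<c}) = 0} = exp (- t)"
  using count_poisson[of "{c<..c + t}" 0] count_poisson[of "{c - t..<c}" 0] assms by simp_all

text \<open>A cylinder event is a function of the counts of the atoms of the finite algebra generated by
  the sets involved, and these atoms are disjoint.\<close>

lemma cylinder_indep:
  assumes E: "E \<in> cylinders b" and bc: "b \<le> c" and t: "0 < t"
  shows "prob (E \<inter> {\<omega> \<in> space M. card (X \<omega> \<inter> {c<..c + t}) = 0}) =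
    prob E * prob {\<omega> \<in> space M. card (X \<omega> \<inter> {c<..c + t}) = 0}"
proof -
  obtain \<B> \<kappa> where E: "E = {\<omega> \<in> space M. \<forall>B\<in>\<B>. card (X \<omega> \<inter> B) = \<kappa> B}" "finite \<B>"
    and B: "\<And>B. B \<in> \<B> \<Longrightarrow> B \<in> sets borel" "\<And>B. B \<in> \<B> \<Longrightarrow> bounded B" "\<And>B. B \<in> \<B> \<Longrightarrow> B \<subseteq> {..b}"
    using E unfolding cylinders_def by blast
  define atom where "atom S = \<Inter>S - \<Union>(\<B> - S)" for S
  \<comment> \<open>The empty index set is left out, since its atom is the unbounded complement of
    all the sets.\<close>
  define \<A> where "\<A> = atom ` (Pow \<B> - {{}})"
  let ?C = "{c<..c + t}"
  have finA: "finite \<A>" unfolding \<A>_def using E(2) by simp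
  have atom_props: "a \<in> sets borel \<and> bounded a \<and> a \<subseteq> {..b}" if aA: "a \<in> \<A>" for a
  proof -
    obtain S where S: "S \<subseteq> \<B>" "S \<noteq> {}" "a = atom S"
      using aA unfolding \<A>_def by (elim imageE) auto
    have "finite S" using S(1) E(2) finite_subset by blast
    then have "(\<Inter>B\<in>S. B) \<in> sets borel" using S(1,2) B(1) by (intro sets.finite_INT) auto
    moreover have "\<Union>(\<B> - S) \<in> sets borel" using B(1) E(2) by (intro sets.finite_Union) auto
    ultimately have "a \<in> sets borel" unfolding S(3) atom_def by (intro sets.Diff) simp_all
    obtain B where BS: "B \<in> S" using S(2) by auto
    then have "a \<subseteq> B" unfolding S(3) atom_def by auto
    then show ?thesis using \<open>a \<in> sets borel\<close> BS S(1) B(2,3)[of B] bounded_subset[of B a] by auto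
  qed
  have atom_inter: "S \<subseteq> S'" if "S \<subseteq> \<B>" "y \<in> atom S" "y \<in> atom S'" for S S' y
  proof
    fix B assume B: "B \<in> S"
    then have "y \<in> B" "B \<in> \<B>" using that(1,2) unfolding atom_def by auto
    then show "B \<in> S'" using that(3) unfolding atom_def by auto
  qed
  have disj: "disjoint \<A>"
  proof (rule disjointI)
    fix a a' assume a: "a \<in> \<A>" "a' \<in> \<A>" "a \<noteq> a'"
    obtain S S' where S: "S \<subseteq> \<B>" "S' \<subseteq> \<B>" "a = atom S" "a' = atom S'"
      using a(1,2) unfolding \<A>_def by auto
    show "a \<inter> a' = {}"
    proof (rule ccontr)
      assume "a \<inter> a' \<noteq> {}"
      then obtain y where "y \<in> a" "y \<in> a'" by auto
      then have "S = S'" using atom_inter[of S y S'] atom_inter[of S' y S] S by simp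
      then show False using a S by simp
    qed
  qed
  have decomp: "B = \<Union>{a \<in> \<A>. a \<subseteq> B}" if "B \<in> \<B>" for B
  proof
    show "B \<subseteq> \<Union>{a \<in> \<A>. a \<subseteq> B}"
    proof
      fix y assume y: "y \<in> B"
      define S where "S = {B' \<in> \<B>. y \<in> B'}"
      have S: "B \<in> S" "S \<subseteq> \<B>" using y that unfolding S_def by auto
      have "y \<in> atom S" unfolding atom_def S_def by auto
      moreover have "atom S \<subseteq> B" using S(1) unfolding atom_def by auto
      moreover have "atom S \<in> \<A>" unfolding \<A>_def using S by (intro imageI) auto
      ultimately show "y \<in> \<Union>{a \<in> \<A>. a \<subseteq> B}" by auto
    qed
  qed auto
  have count: "card (X \<omega> \<inter> B) = (\<Sum>a\<in>{a \<in> \<A>. a \<subseteq> B}. card (X \<omega> \<inter> a))" if "B \<in> \<B>" "\<omega> \<in> space M" for B \<omega>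
  proof -
    have "X \<omega> \<inter> B = X \<omega> \<inter> \<Union>{a \<in> \<A>. a \<subseteq> B}"
      using decomp[OF that(1)] by (rule arg_cong)
    also have "\<dots> = (\<Union>a\<in>{a \<in> \<A>. a \<subseteq> B}. X \<omega> \<inter> a)" by auto
    also have "card \<dots> = (\<Sum>a\<in>{a \<in> \<A>. a \<subseteq> B}. card (X \<omega> \<inter> a))"
    proof (rule card_UN_disjoint)
      show "\<forall>i\<in>{a \<in> \<A>. a \<subseteq> B}. finite (X \<omega> \<inter> i)"
        using locally_finite[OF that(2)] atom_props by simp
      show "\<forall>i\<in>{a \<in> \<A>. a \<subseteq> B}. \<forall>j\<in>{a \<in> \<A>. a \<subseteq> B}. i \<noteq> j \<longrightarrow> X \<omega> \<inter> i \<inter> (X \<omega> \<inter> j) = {}"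
        using disj by (auto dest: disjointD)
    qed (use finA in simp)
    finally show ?thesis .
  qed
  \<comment> \<open>The point \<open>c + t\<close> lies in the window and beyond \<open>b\<close>,
    so the window is not itself one of the atoms; this uses \<open>0 < t\<close>.\<close>
  have C_props: "?C \<in> sets borel" "bounded ?C" "c + t \<in> ?C" "?C \<inter> {..b} = {}"
    using bc t by auto
  then have "?C \<notin> \<A>" using atom_props[of ?C] by (metis IntI empty_iff subsetD)
  have "?C \<inter> a = {}" if "a \<in> \<A>" for a using atom_props[OF that] C_props(4) by auto
  then have "disjoint (insert ?C \<A>)"
    using disj by (auto simp: pairwise_insert disjnt_def Int_commute)
  then have ind: "indep_vars (\<lambda>_. count_space UNIV) (\<lambda>B \<omega>. card (X \<omega> \<inter> B)) (insert ?C \<A>)"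
    using finA atom_props C_props by (intro count_indep) auto
  let ?r = "\<lambda>K \<omega>. restrict (\<lambda>B. card (X \<omega> \<inter> B)) K"
  have iv: "indep_var (PiM \<A> (\<lambda>_. count_space UNIV)) (?r \<A>) (PiM {?C} (\<lambda>_. count_space UNIV)) (?r {?C})"
    using \<open>?C \<notin> \<A>\<close> by (intro indep_var_restrict[OF ind]) auto
  let ?SA = "{f \<in> space (PiM \<A> (\<lambda>_. count_space (UNIV::nat set))). \<forall>B\<in>\<B>. (\<Sum>a\<in>{a \<in> \<A>. a \<subseteq> B}. f a) = \<kappa> B}"
  let ?SC = "{f \<in> space (PiM {?C} (\<lambda>_. count_space (UNIV::nat set))). f ?C = 0}"
  have SA: "?SA \<in> sets (PiM \<A> (\<lambda>_. count_space UNIV))"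
  proof -
    have "(\<lambda>f. \<Sum>a\<in>{a \<in> \<A>. a \<subseteq> B}. f a) \<in> PiM \<A> (\<lambda>_. count_space UNIV) \<rightarrow>\<^sub>M count_space (UNIV :: nat set)" for B
    proof -
      have "(\<lambda>f. \<Sum>a\<in>{a \<in> \<A>. a \<subseteq> B}. f a) \<in> borel_measurable (PiM \<A> (\<lambda>_. count_space (UNIV :: nat set)))"
        by (intro borel_measurable_sum) (auto intro!: measurable_compose[OF measurable_component_singleton])
      then show ?thesis by simp
    qed
    then show ?thesis using E(2) by measurable
  qed
  have SC: "?SC \<in> sets (PiM {?C} (\<lambda>_. count_space UNIV))"
    by measurable
  have "(\<Sum>a\<in>{a \<in> \<A>. a \<subseteq> B}. ?r \<A> \<omega> a) = card (X \<omega> \<inter> B)" if "B \<in> \<B>" "\<omega> \<in> space M" for B \<omega>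
    unfolding count[OF that] by (intro sum.cong) auto
  then have "?r \<A> -` ?SA \<inter> space M = E"
    unfolding E(1) by (auto simp: space_PiM simp del: restrict_apply)
  moreover have "?r {?C} -` ?SC \<inter> space M = {\<omega> \<in> space M. card (X \<omega> \<inter> ?C) = 0}"
    by (auto simp: space_PiM)
  moreover have "(\<lambda>\<omega>. (?r \<A> \<omega>, ?r {?C} \<omega>)) -` (?SA \<times> ?SC) \<inter> space M =
      (?r \<A> -` ?SA \<inter> space M) \<inter> (?r {?C} -` ?SC \<inter> space M)"
    by auto
  ultimately show ?thesis using indep_varD[OF iv SA SC] by simp
qed

text \<open>Empty windows suffice as future events: a gap exceeds \<open>t\<close> exactly if the
  window of length \<open>t\<close> after its left endpoint is empty.\<close>

lemma past_indep:
  assumes E: "E \<in> sets (past b)" and bc: "b \<le> c" and t: "0 \<le> t"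
  shows "prob (E \<inter> {\<omega> \<in> space M. card (X \<omega> \<inter> {c<..c + t}) = 0}) = prob E * exp (- t)"
proof (cases "t = 0")
  case True
  have "E \<subseteq> space M" using sets.sets_into_space[OF E] by (simp add: space_past)
  then have "E \<inter> {\<omega> \<in> space M. card (X \<omega> \<inter> {c<..c + t}) = 0} = E" using True by auto
  then show ?thesis using True by simp
next
  case False
  then have t: "0 < t" using t by simp
  let ?F = "{\<omega> \<in> space M. card (X \<omega> \<inter> {c<..c + t}) = 0}"
  have F: "?F \<in> sets M" by (rule count_sets) auto
  have "indep_set (cylinders b) {?F}"
    by (rule indep_setI) (use cylinders_sets F cylinder_indep[OF _ bc t] in auto)
  then have "indep_set (sigma_sets (space M) (cylinders b)) (sigma_sets (space M) {?F})"
    by (rule indep_set_sigma_sets) (rule Int_stable_cylinders, simp add: Int_stable_def)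
  moreover have "E \<in> sigma_sets (space M) (cylinders b)" using E past_sub_cylinders by blast
  moreover have "?F \<in> sigma_sets (space M) {?F}" by auto
  ultimately have "prob (E \<inter> ?F) = prob E * prob ?F" by (rule indep_setD)
  then show ?thesis using prob_no_points(1)[of t c] t by simp
qed

lemma measurable_count_past:
  assumes "B \<in> sets borel" "bounded B" "B \<subseteq> {..b}"
  shows "(\<lambda>\<omega>. card (X \<omega> \<inter> B)) \<in> past b \<rightarrow>\<^sub>M count_space UNIV"
proof (subst measurable_count_space_eq2_countable, intro conjI ballI)
  fix k
  have "(\<lambda>\<omega>. card (X \<omega> \<inter> B)) -` {k} \<inter> space (past b) = {\<omega> \<in> space M. card (X \<omega> \<inter> B) = k}"
    by (auto simp: space_past)
  also have "\<dots> \<in> sets (past b)" unfolding sets_past using assms by (intro sigma_sets.Basic) blast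
  finally show "(\<lambda>\<omega>. card (X \<omega> \<inter> B)) -` {k} \<inter> space (past b) \<in> sets (past b)" .
qed auto

lemma locally_finite_X: "\<omega> \<in> space M \<Longrightarrow> locally_finite_set (X \<omega>)"
  using locally_finite by (simp add: locally_finite_set_def)

lemma measurable_past_point:
  assumes "0 \<le> b"
  shows "(\<lambda>\<omega>. nth_point (past_completed b (X \<omega>)) n) \<in> borel_measurable (past b)"
proof (rule measurable_nth_point)
  fix s
  have eq: "card (past_completed b (X \<omega>) \<inter> {0<..s}) =
      card (X \<omega> \<inter> {0<..min b s}) + card (\<int> \<inter> {b<..s})" if "\<omega> \<in> space M" for \<omega>
  proof -
    have "past_completed b (X \<omega>) \<inter> {0<..s} = X \<omega> \<inter> {0<..min b s} \<union> \<int> \<inter> {b<..s}"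
      using assms by (auto simp: past_completed_def)
    moreover have "finite (X \<omega> \<inter> {0<..min b s})" "finite (\<int> \<inter> {b<..s})"
      by (rule locally_finite_setD[OF locally_finite_X[OF that]] locally_finite_setD[OF locally_finite_Ints]; simp)+
    ultimately show ?thesis by (simp only:) (rule card_Un_disjoint, auto)
  qed
  have "(\<lambda>\<omega>. card (X \<omega> \<inter> {0<..min b s}) + card (\<int> \<inter> {b<..s})) \<in> past b \<rightarrow>\<^sub>M count_space UNIV"
    by (rule measurable_compose[OF measurable_count_past]) auto
  then show "(\<lambda>\<omega>. card (past_completed b (X \<omega>) \<inter> {0<..s})) \<in> past b \<rightarrow>\<^sub>M count_space UNIV"
    by (subst measurable_cong[of _ _ "\<lambda>\<omega>. card (X \<omega> \<inter> {0<..min b s}) + card (\<int> \<inter> {b<..s})"])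
      (auto simp: eq space_past)
qed (auto simp: space_past locally_finite_X locally_finite_past_completed right_unbounded_past_completed)

text \<open>Having fewer than \<open>k\<close> points in every window \<open>{0<..real m}\<close> is
  bounded by a lower Poisson tail that vanishes as \<open>m\<close> grows; on the left the void
  probability plays this role.\<close>

lemma AE_generic: "AE \<omega> in M. generic (X \<omega>)"
proof -
  have "AE \<omega> in M. \<exists>m::nat. k \<le> card (X \<omega> \<inter> {0<..real m})" for k
  proof -
    let ?E = "{\<omega> \<in> space M. \<forall>m::nat. card (X \<omega> \<inter> {0<..real m}) < k}"
    let ?F = "\<lambda>m::nat. \<Union>j<k. {\<omega> \<in> space M. card (X \<omega> \<inter> {0<..real m}) = j}"
    have cs: "{\<omega> \<in> space M. card (X \<omega> \<inter> {0<..real m}) = j} \<in> sets M" for m j by (rule count_sets) auto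
    have F: "?F m \<in> sets M" for m using cs by auto
    have Eeq: "?E = (\<Inter>m. ?F m)" by auto
    have E: "?E \<in> sets M" unfolding Eeq using F by (intro sets.countable_INT) auto
    have le: "prob ?E \<le> (\<Sum>j<k. real m ^ j / fact j * exp (- real m))" for m :: nat
    proof -
      have "prob ?E \<le> prob (?F m)" by (rule finite_measure_mono[OF _ F]) auto
      also have "\<dots> \<le> (\<Sum>j<k. prob {\<omega> \<in> space M. card (X \<omega> \<inter> {0<..real m}) = j})"
        by (rule finite_measure_subadditive_finite) (use cs in auto)
      also have "\<dots> = (\<Sum>j<k. real m ^ j / fact j * exp (- real m))"
        by (intro sum.cong refl) (subst count_poisson, auto)
      finally show ?thesis .
    qed
    have "(\<lambda>m. \<Sum>j<k. real m ^ j / fact j * exp (- real m)) \<longlonglongrightarrow> (\<Sum>j<k. 0)"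
    proof (rule tendsto_sum)
      fix j
      have "(\<lambda>m. real m ^ j / exp (real m)) \<longlonglongrightarrow> 0"
        by (rule filterlim_compose[OF tendsto_power_div_exp_0 filterlim_real_sequentially])
      then have "(\<lambda>m. real m ^ j / exp (real m) / fact j) \<longlonglongrightarrow> 0 / fact j" by (intro tendsto_intros) auto
      then show "(\<lambda>m. real m ^ j / fact j * exp (- real m)) \<longlonglongrightarrow> 0"
        by (simp add: exp_minus field_simps)
    qed
    then have "prob ?E \<le> (\<Sum>j<k. 0)" by (rule LIMSEQ_le_const) (use le in auto)
    then have "prob ?E = 0" by (simp add: measure_le_0_iff)
    then have "emeasure M ?E = 0" by (simp add: emeasure_eq_measure)
    then show ?thesis by (intro AE_I[OF _ _ E]) (auto simp: not_le)
  qed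
  moreover have "AE \<omega> in M. \<exists>m::nat. 1 \<le> card (X \<omega> \<inter> {- real m..<0})"
  proof -
    let ?F = "\<lambda>m::nat. {\<omega> \<in> space M. card (X \<omega> \<inter> {0 - real m..<0}) = 0}"
    let ?E = "{\<omega> \<in> space M. \<forall>m::nat. card (X \<omega> \<inter> {0 - real m..<0}) = 0}"
    have F: "?F m \<in> sets M" for m by (rule count_sets) auto
    have Eeq: "?E = (\<Inter>m. ?F m)" by auto
    have E: "?E \<in> sets M" unfolding Eeq using F by (intro sets.countable_INT) auto
    have le: "prob ?E \<le> exp (- real m)" for m :: nat
    proof -
      have "prob ?E \<le> prob (?F m)" by (rule finite_measure_mono[OF _ F]) auto
      also have "\<dots> = exp (- real m)" by (rule prob_no_points(2)) simp
      finally show ?thesis .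
    qed
    have "(\<lambda>m. exp (- real m)) \<longlonglongrightarrow> 0"
      by (rule filterlim_compose[OF exp_at_bot filterlim_compose[OF filterlim_uminus_at_bot_at_top filterlim_real_sequentially]])
    then have "prob ?E \<le> 0" by (rule LIMSEQ_le_const) (use le in auto)
    then have "prob ?E = 0" by (simp add: measure_le_0_iff)
    then have "emeasure M ?E = 0" by (simp add: emeasure_eq_measure)
    then show ?thesis by (intro AE_I[OF _ _ E]) (auto simp: not_le)
  qed
  ultimately show ?thesis
    unfolding generic_def right_unbounded_def left_inhabited_def by (simp add: AE_all_countable)
qed


section \<open>Joint tails of the gaps by the strong Markov property\<close>

definition Z :: "'w \<Rightarrow> real set" where "Z \<omega> = regularized (X \<omega>)"

definition pt :: "nat \<Rightarrow> 'w \<Rightarrow> real" where "pt n \<omega> = nth_point (Z \<omega>) n"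

lemma Z_lf: "\<omega> \<in> space M \<Longrightarrow> locally_finite_set (Z \<omega>)"
  unfolding Z_def using locally_finite_X locally_finite_regularized by blast

lemma Z_generic: "right_unbounded (Z \<omega>)" "left_inhabited (Z \<omega>)"
  using generic_regularized unfolding Z_def generic_def by auto

lemma AE_Z: "AE \<omega> in M. Z \<omega> = X \<omega>"
  using AE_generic by (auto simp: Z_def regularized_def)

lemma measurable_pt_gen:
  assumes "\<And>B. B \<in> sets borel \<Longrightarrow> bounded B \<Longrightarrow> 0 \<notin> B \<Longrightarrow>
      (\<lambda>\<omega>. card (X \<omega> \<inter> B)) \<in> N \<rightarrow>\<^sub>M count_space UNIV"
    and "space N = space M"
  shows "pt n \<in> borel_measurable N" "(\<lambda>\<omega>. left_gap (Z \<omega>)) \<in> borel_measurable N"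
proof -
  have m: "(\<lambda>\<omega>. card (Z \<omega> \<inter> B)) \<in> N \<rightarrow>\<^sub>M count_space UNIV"
    if "B \<in> sets borel" "bounded B" "0 \<notin> B" for B
    unfolding Z_def by (rule measurable_card_regularized[OF assms(1) that])
  show "pt n \<in> borel_measurable N" unfolding pt_def
    by (rule measurable_nth_point) (use Z_lf Z_generic assms(2) in \<open>auto intro!: m\<close>)
  show "(\<lambda>\<omega>. left_gap (Z \<omega>)) \<in> borel_measurable N"
    by (rule measurable_left_gap) (use Z_lf Z_generic assms(2) in \<open>auto intro!: m\<close>)
qed

lemma measurable_pt [measurable]: "pt n \<in> borel_measurable M"
  and measurable_Z_gap [measurable]: "(\<lambda>\<omega>. left_gap (Z \<omega>)) \<in> borel_measurable M"
  by (intro measurable_pt_gen[OF measurable_count]; simp)+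

lemma pt_mono: "\<omega> \<in> space M \<Longrightarrow> strict_mono (\<lambda>n. pt n \<omega>)"
  using nth_point_strict_mono[OF Z_lf Z_generic(1)] by (simp add: pt_def[abs_def])

lemma pt_0: "pt 0 \<omega> = 0"
  by (simp add: pt_def)

lemma pt_nonneg: "\<omega> \<in> space M \<Longrightarrow> 0 \<le> pt n \<omega>"
  using nth_point_nonneg[OF Z_lf Z_generic(1)] by (simp add: pt_def)

text \<open>Joint tail events of the left gap and the first \<open>n\<close> gaps on the right;
  their probabilities determine the joint law.\<close>

definition early :: "real \<Rightarrow> (nat \<Rightarrow> real) \<Rightarrow> nat \<Rightarrow> 'w set" where
  "early s ts n = {\<omega> \<in> space M. s < left_gap (Z \<omega>) \<and> (\<forall>i<n. ts i < pt (Suc i) \<omega> - pt i \<omega>)}"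

lemma early_sets [measurable]: "early s ts n \<in> sets M"
  unfolding early_def by measurable

definition grid_index :: "nat \<Rightarrow> real \<Rightarrow> nat" where
  "grid_index m a = nat \<lceil>a * real (Suc m)\<rceil>"

lemma grid_index_bounds:
  assumes "0 \<le> a"
  shows "a \<le> real (grid_index m a) / real (Suc m)" "real (grid_index m a) / real (Suc m) < a + 1 / real (Suc m)"
proof -
  have "0 \<le> a * real (Suc m)" using assms by (intro mult_nonneg_nonneg) simp_all
  then have "0 \<le> \<lceil>a * real (Suc m)\<rceil>" by linarith
  then have eq: "real (grid_index m a) = of_int \<lceil>a * real (Suc m)\<rceil>"
    unfolding grid_index_def by simp
  have 1: "a * real (Suc m) \<le> real (grid_index m a)" "real (grid_index m a) < a * real (Suc m) + 1"
    unfolding eq by linarith+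
  show "a \<le> real (grid_index m a) / real (Suc m)" "real (grid_index m a) / real (Suc m) < a + 1 / real (Suc m)"
    using 1 by (simp_all add: pos_le_divide_eq pos_divide_less_eq distrib_right del: of_nat_Suc)
qed

lemma measurable_grid_index [measurable]: "grid_index m \<in> borel \<rightarrow>\<^sub>M count_space UNIV"
  unfolding grid_index_def[abs_def] by measurable

text \<open>
  Strong Markov property at the \<open>n\<close>-th point, by rounding the point up to a grid of mesh
  \<open>1 / Suc m\<close>: on the event that the rounded point is \<open>k / Suc m\<close> everything so far is determined by the
  configuration on the left of it.
\<close>

lemma early_grid_past:
  fixes m n :: nat
  assumes s: "0 \<le> s"
  defines "b k \<equiv> real k / real (Suc m)"
  shows "\<exists>F\<in>sets (past (b k)). AE \<omega> in M. \<omega> \<in> F \<longleftrightarrow> \<omega> \<in> early s ts n \<and> grid_index m (pt n \<omega>) = k"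
proof
  let ?p = "\<lambda>i \<omega>. nth_point (past_completed (b k) (X \<omega>)) i"
  let ?F = "{\<omega> \<in> space (past (b k)). card (X \<omega> \<inter> {- s..<0}) = 0 \<and>
    (\<forall>i<n. ts i < ?p (Suc i) \<omega> - ?p i \<omega>) \<and> grid_index m (?p n \<omega>) = k}"
  have b: "0 \<le> b k" by (simp add: b_def)
  have [measurable]: "?p i \<in> borel_measurable (past (b k))" for i by (rule measurable_past_point[OF b])
  have [measurable]: "(\<lambda>\<omega>. card (X \<omega> \<inter> {- s..<0})) \<in> past (b k) \<rightarrow>\<^sub>M count_space UNIV"
    by (rule measurable_count_past) (use b in auto)
  show "?F \<in> sets (past (b k))" by measurable
  show "AE \<omega> in M. \<omega> \<in> ?F \<longleftrightarrow> \<omega> \<in> early s ts n \<and> grid_index m (pt n \<omega>) = k"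
    using AE_Z AE_space
  proof eventually_elim
    fix \<omega> assume Z: "Z \<omega> = X \<omega>" and \<omega>: "\<omega> \<in> space M"
    have le: "a \<le> b k" if "grid_index m a = k" "0 \<le> a" for a
      using grid_index_bounds(1)[of a m] that by (simp add: b_def)
    have lfs: "locally_finite_set (Z \<omega>)" "locally_finite_set (past_completed (b k) (X \<omega>))"
      "right_unbounded (past_completed (b k) (X \<omega>))"
      using Z_lf[OF \<omega>] locally_finite_X[OF \<omega>] by (simp_all add: locally_finite_past_completed right_unbounded_past_completed)
    have agree: "Z \<omega> \<inter> {0<..b k} = past_completed (b k) (X \<omega>) \<inter> {0<..b k}"
      unfolding past_completed_def Z by auto
    have 1: "?p i \<omega> = pt i \<omega>" if "pt i \<omega> \<le> b k" for i
      unfolding pt_def using nth_point_cong[OF lfs(1) Z_generic(1) agree] that by (simp add: pt_def)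
    have 2: "pt i \<omega> = ?p i \<omega>" if "?p i \<omega> \<le> b k" for i
      unfolding pt_def using nth_point_cong[OF lfs(2,3) agree[symmetric]] that by simp
    have mono: "pt i \<omega> \<le> pt n \<omega>" if "i \<le> n" for i
      using strict_mono_less_eq[OF pt_mono[OF \<omega>]] that by simp
    have card: "card (X \<omega> \<inter> {- s..<0}) = 0 \<longleftrightarrow> s < left_gap (Z \<omega>)"
      using less_left_gap_iff[OF lfs(1) Z_generic(2), of s] Z by simp
    have eqs: "?p i \<omega> = pt i \<omega>" if "i \<le> n" "pt n \<omega> \<le> b k" for i
      using 1[of i] mono[OF that(1)] that(2) by simp
    have pnn: "0 \<le> ?p n \<omega>" by (rule nth_point_nonneg[OF lfs(2,3)])
    show "\<omega> \<in> ?F \<longleftrightarrow> \<omega> \<in> early s ts n \<and> grid_index m (pt n \<omega>) = k"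
    \<comment> \<open>A point rounded up to \<open>b k\<close> is at most \<open>b k\<close>. If the
      true point lies beyond, neither event occurs; otherwise the true and the completed enumeration
      agree up to index \<open>n\<close>.\<close>
    proof (cases "pt n \<omega> \<le> b k")
      case True
      then show ?thesis unfolding early_def using card \<omega> eqs by (auto simp: space_past)
    next
      case False
      then have "grid_index m (pt n \<omega>) \<noteq> k" using le[of "pt n \<omega>"] pt_nonneg[OF \<omega>, of n] by auto
      moreover have "grid_index m (?p n \<omega>) \<noteq> k" using le[of "?p n \<omega>"] 2[of n] pnn False by auto
      ultimately show ?thesis by simp
    qed
  qed
qed

text \<open>On each of the countably many values of the rounded point the window is a fixed interval
  to the right of it, while the rest is, up to a null set, an event of the past.\<close>

lemma strong_markov_grid:
  fixes n :: nat and ts :: "nat \<Rightarrow> real"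
  assumes s: "0 \<le> s" and t: "0 \<le> t"
  defines "c m \<omega> \<equiv> real (grid_index m (pt n \<omega>)) / real (Suc m)"
  defines "D m \<equiv> {\<omega> \<in> early s ts n. card (X \<omega> \<inter> {c m \<omega><..c m \<omega> + t}) = 0}"
  shows "D m \<in> sets M" "prob (D m) = prob (early s ts n) * exp (- t)"
proof -
  let ?b = "\<lambda>k. real k / real (Suc m)"
  let ?E = "\<lambda>k. {\<omega> \<in> early s ts n. grid_index m (pt n \<omega>) = k}"
  let ?N = "\<lambda>k. {\<omega> \<in> space M. card (X \<omega> \<inter> {?b k<..?b k + t}) = 0}"
  have N [measurable]: "?N k \<in> sets M" for k by (rule count_sets) auto
  have E [measurable]: "?E k \<in> sets M" for k
  proof -
    have "?E k = early s ts n \<inter> {\<omega> \<in> space M. grid_index m (pt n \<omega>) = k}"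
      using sets.sets_into_space[OF early_sets] by auto
    also have "\<dots> \<in> sets M" by measurable
    finally show ?thesis .
  qed
  have Deq: "D m = (\<Union>k. ?E k \<inter> ?N k)"
    unfolding D_def c_def early_def by auto
  have EN: "?E k \<inter> ?N k \<in> sets M" for k by (rule sets.Int[OF E N])
  show "D m \<in> sets M" unfolding Deq by (rule sets.countable_UN) (use EN in blast)
  have disj: "disjoint_family (\<lambda>k. ?E k \<inter> ?N k)" "disjoint_family ?E"
    unfolding disjoint_family_on_def by auto
  have grid_term: "prob (?E k \<inter> ?N k) = prob (?E k) * exp (- t)" for k
  proof -
    obtain F where F: "F \<in> sets (past (?b k))"
      "AE \<omega> in M. \<omega> \<in> F \<longleftrightarrow> \<omega> \<in> early s ts n \<and> grid_index m (pt n \<omega>) = k"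
      using early_grid_past[OF s, where m = m and n = n and ts = ts and k = k] by (elim bexE)
    have FM [measurable]: "F \<in> sets M"
      using F(1) past_sub_cylinders sets.sigma_sets_subset[OF cylinders_sets] by blast
    have "prob (?E k \<inter> ?N k) = prob (F \<inter> ?N k)"
      by (rule finite_measure_eq_AE[OF _ EN sets.Int[OF FM N]], use F(2) in eventually_elim) auto
    also have "\<dots> = prob F * exp (- t)" by (rule past_indep[OF F(1) order_refl t])
    also have "prob F = prob (?E k)"
      by (rule finite_measure_eq_AE[OF _ FM E], use F(2) in eventually_elim) auto
    finally show ?thesis .
  qed
  have "(\<lambda>k. prob (?E k \<inter> ?N k)) sums prob (\<Union>k. ?E k \<inter> ?N k)"
    by (rule finite_measure_UNION[OF _ disj(1)]) (use EN in blast)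
  then have 1: "(\<lambda>k. prob (?E k) * exp (- t)) sums prob (D m)"
    unfolding Deq grid_term .
  have "(\<lambda>k. prob (?E k)) sums prob (\<Union>k. ?E k)"
    by (rule finite_measure_UNION[OF _ disj(2)]) (use E in blast)
  moreover have "(\<Union>k. ?E k) = early s ts n" by auto
  ultimately have "(\<lambda>k. prob (?E k) * exp (- t)) sums (prob (early s ts n) * exp (- t))"
    by (simp add: sums_mult2)
  with 1 show "prob (D m) = prob (early s ts n) * exp (- t)" by (rule sums_unique2)
qed

text \<open>Rounding up and half-open windows settle the boundary case as well: if the gap equals
  \<open>t\<close>, the window eventually contains the next point.\<close>

lemma grid_limit:
  fixes n :: nat
  assumes \<omega>: "\<omega> \<in> space M" "Z \<omega> = X \<omega>" and t: "0 \<le> t"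
  defines "c m \<equiv> real (grid_index m (pt n \<omega>)) / real (Suc m)"
  shows "eventually (\<lambda>m. card (X \<omega> \<inter> {c m<..c m + t}) = 0 \<longleftrightarrow> t < pt (Suc n) \<omega> - pt n \<omega>) sequentially"
proof -
  let ?a = "pt n \<omega>" and ?r = "pt (Suc n) \<omega>"
  have a: "0 \<le> ?a" using pt_nonneg[OF \<omega>(1)] .
  have c: "?a \<le> c m" "c m < ?a + 1 / real (Suc m)" for m
    using grid_index_bounds[OF a] unfolding c_def by auto
  have ar: "?a < ?r" "?r \<in> X \<omega>"
    using nth_point_less[OF Z_lf[OF \<omega>(1)] Z_generic(1)] nth_point_in[OF Z_lf[OF \<omega>(1)] Z_generic(1)] \<omega>(2)
    unfolding pt_def by auto
  have least: "?r \<le> y" if "y \<in> X \<omega>" "?a < y" for y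
    using nth_point_least[OF Z_lf[OF \<omega>(1)] Z_generic(1), of y n] \<omega>(2) that unfolding pt_def by simp
  have lim: "(\<lambda>m. 1 / real (Suc m)) \<longlonglongrightarrow> 0"
    using LIMSEQ_inverse_real_of_nat by (simp add: inverse_eq_divide)
  show ?thesis
  proof (cases "t < ?r - ?a")
    case True
    then have "0 < ?r - ?a - t" by simp
    then have "eventually (\<lambda>m. 1 / real (Suc m) < ?r - ?a - t) sequentially"
      using lim by (rule order_tendstoD(2)[rotated])
    then show ?thesis
    proof eventually_elim
      case (elim m)
      have "X \<omega> \<inter> {c m<..c m + t} = {}"
      proof (rule ccontr)
        assume "X \<omega> \<inter> {c m<..c m + t} \<noteq> {}"
        then obtain y where "y \<in> X \<omega>" "c m < y" "y \<le> c m + t" by auto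
        then show False using least[of y] c[of m] elim by linarith
      qed
      then show ?case using True by simp
    qed
  next
    case False
    have "0 < ?r - ?a" using ar by simp
    then have "eventually (\<lambda>m. 1 / real (Suc m) < ?r - ?a) sequentially"
      using lim by (rule order_tendstoD(2)[rotated])
    then show ?thesis
    proof eventually_elim
      case (elim m)
      have "?r \<in> X \<omega> \<inter> {c m<..c m + t}" using ar False c[of m] elim by auto
      moreover have "finite (X \<omega> \<inter> {c m<..c m + t})" by (rule locally_finite[OF \<omega>(1)]) simp
      ultimately have "0 < card (X \<omega> \<inter> {c m<..c m + t})" by (intro card_gt_0_iff[THEN iffD2]) auto
      then show ?case using False by simp
    qed
  qed
qed

text \<open>The grid probabilities all equal the claimed product, so dominated convergence only has
  to identify the limit event.\<close>

lemma early_Suc: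
  assumes s: "0 \<le> s" and t: "0 \<le> ts n"
  shows "prob (early s ts (Suc n)) = prob (early s ts n) * exp (- ts n)"
proof -
  define c where "c m \<omega> = real (grid_index m (pt n \<omega>)) / real (Suc m)" for m \<omega>
  define D where "D m = {\<omega> \<in> early s ts n. card (X \<omega> \<inter> {c m \<omega><..c m \<omega> + ts n}) = 0}" for m
  have D: "D m \<in> sets M" "prob (D m) = prob (early s ts n) * exp (- ts n)" for m
    using strong_markov_grid[OF s t, of ts n m] unfolding D_def c_def by auto
  have "(\<lambda>m. \<integral>\<omega>. indicat_real (D m) \<omega> \<partial>M) \<longlonglongrightarrow> (\<integral>\<omega>. indicat_real (early s ts (Suc n)) \<omega> \<partial>M)"
  proof (rule integral_dominated_convergence[where w = "\<lambda>_. 1"])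
    show "AE \<omega> in M. (\<lambda>m. indicat_real (D m) \<omega>) \<longlonglongrightarrow> indicat_real (early s ts (Suc n)) \<omega>"
      using AE_Z AE_space
    proof eventually_elim
      fix \<omega> assume \<omega>: "Z \<omega> = X \<omega>" "\<omega> \<in> space M"
      have "eventually (\<lambda>m. indicat_real (early s ts (Suc n)) \<omega> = indicat_real (D m) \<omega>) sequentially"
        using grid_limit[OF \<omega>(2,1) t, of n]
      proof eventually_elim
        case (elim m)
        then have "\<omega> \<in> D m \<longleftrightarrow> \<omega> \<in> early s ts (Suc n)"
          unfolding D_def c_def early_def by (auto simp: less_Suc_eq)
        then show ?case by (simp add: indicator_def)
      qed
      then show "(\<lambda>m. indicat_real (D m) \<omega>) \<longlonglongrightarrow> indicat_real (early s ts (Suc n)) \<omega>"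
        by (rule Lim_transform_eventually[OF tendsto_const])
    qed
  qed (use D(1) in \<open>auto simp: indicator_def\<close>)
  then have "(\<lambda>m. prob (D m)) \<longlonglongrightarrow> prob (early s ts (Suc n))"
    using D(1) by simp
  then show ?thesis unfolding D(2) LIMSEQ_const_iff by (rule sym)
qed

lemma prob_early:
  assumes s: "0 \<le> s" and ts: "\<And>i. i < n \<Longrightarrow> 0 \<le> ts i"
  shows "prob (early s ts n) = exp (- s) * (\<Prod>i<n. exp (- ts i))"
  using ts
proof (induction n)
  case 0
  have "AE \<omega> in M. \<omega> \<in> early s ts 0 \<longleftrightarrow> \<omega> \<in> {\<omega> \<in> space M. card (X \<omega> \<inter> {0 - s..<0}) = 0}"
    using AE_Z AE_space
  proof eventually_elim
    fix \<omega> assume "Z \<omega> = X \<omega>" "\<omega> \<in> space M"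
    then show "\<omega> \<in> early s ts 0 \<longleftrightarrow> \<omega> \<in> {\<omega> \<in> space M. card (X \<omega> \<inter> {0 - s..<0}) = 0}"
      using less_left_gap_iff[OF Z_lf Z_generic(2), of \<omega> s] by (simp add: early_def)
  qed
  then have "prob (early s ts 0) = prob {\<omega> \<in> space M. card (X \<omega> \<inter> {0 - s..<0}) = 0}"
    by (rule finite_measure_eq_AE) (auto intro: count_sets)
  then show ?case using prob_no_points(2)[OF s, of 0] by simp
next
  case (Suc n)
  then show ?case using early_Suc[OF s, of ts n] by simp
qed

end

section \<open>Independence of gaps and marks\<close>

locale marked_poisson = unit_poisson M X + thin: thinning M "\<lambda>\<omega>. insert 0 (X \<omega>)" Y p
  for M :: "'w measure" and X Y :: "'w \<Rightarrow> real set" and p :: real +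
  assumes p01: "0 < p" "p < 1"
begin

abbreviation "\<G> \<equiv> generated_algebra M (\<lambda>\<omega>. insert 0 (X \<omega>))"

lemma space_G: "space \<G> = space M"
  unfolding generated_algebra_def by (rule space_measure_of) auto

lemma sets_G: "sets \<G> = sigma_sets (space M)
    {{\<omega> \<in> space M. card (insert 0 (X \<omega>) \<inter> B) = k} | B k. B \<in> sets borel \<and> bounded B}"
  unfolding generated_algebra_def by (rule sets_measure_of) auto

lemma G_sub: "sets \<G> \<subseteq> sets M"
  unfolding sets_G
proof (rule sets.sigma_sets_subset, safe)
  fix B :: "real set" and k assume "B \<in> sets borel" "bounded B"
  then have "(\<lambda>\<omega>. card (insert 0 (X \<omega>) \<inter> B)) -` {k} \<inter> space M \<in> sets M"
    by (intro measurable_sets[OF thin.X.measurable_count]) auto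
  then show "{\<omega> \<in> space M. card (insert 0 (X \<omega>) \<inter> B) = k} \<in> sets M"
    by (simp add: vimage_def Int_def conj_commute)
qed

lemma subalg_G: "subalgebra M \<G>"
  using G_sub space_G by (simp add: subalgebra_def)

lemma measurable_count_G:
  assumes "B \<in> sets borel" "bounded B" "0 \<notin> B"
  shows "(\<lambda>\<omega>. card (X \<omega> \<inter> B)) \<in> \<G> \<rightarrow>\<^sub>M count_space UNIV"
proof (subst measurable_count_space_eq2_countable, intro conjI ballI)
  fix k
  have "(\<lambda>\<omega>. card (X \<omega> \<inter> B)) -` {k} \<inter> space \<G> = {\<omega> \<in> space M. card (insert 0 (X \<omega>) \<inter> B) = k}"
    using assms(3) by (auto simp: space_G)
  also have "\<dots> \<in> sets \<G>" unfolding sets_G using assms by (intro sigma_sets.Basic) blast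
  finally show "(\<lambda>\<omega>. card (X \<omega> \<inter> B)) -` {k} \<inter> space \<G> \<in> sets \<G>" .
qed auto

lemma pt_G: "pt n \<in> borel_measurable \<G>"
  and gap_G: "(\<lambda>\<omega>. left_gap (Z \<omega>)) \<in> borel_measurable \<G>"
  by (intro measurable_pt_gen[OF measurable_count_G space_G]; simp)+

lemma early_G: "early s ts n \<in> sets \<G>"
proof -
  note [measurable] = pt_G gap_G
  have "{\<omega> \<in> space \<G>. s < left_gap (Z \<omega>) \<and> (\<forall>i<n. ts i < pt (Suc i) \<omega> - pt i \<omega>)} \<in> sets \<G>"
    by measurable
  then show ?thesis unfolding early_def space_G .
qed

text \<open>Membership of a random point becomes a condition on counts in countably many fixed
  cells. Conversely, if every cell around \<xi> meets \<open>Y \<omega>\<close>, then points of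
  \<open>Y \<omega>\<close> come arbitrarily close, and local finiteness puts \<xi> among
  them.\<close>

lemma mem_Y_iff:
  assumes \<omega>: "\<omega> \<in> space M"
  shows "\<xi> \<in> Y \<omega> \<longleftrightarrow>
    (\<forall>m. 1 \<le> card (Y \<omega> \<inter> {(of_int \<lceil>\<xi> * real (Suc m)\<rceil> - 1) / real (Suc m)<..of_int \<lceil>\<xi> * real (Suc m)\<rceil> / real (Suc m)}))"
    (is "_ \<longleftrightarrow> (\<forall>m. 1 \<le> card (Y \<omega> \<inter> ?I m))")
proof
  have fin: "finite (Y \<omega> \<inter> B)" if "bounded B" for B
    by (rule thin.Y.locally_finite[OF \<omega> that])
  {
    fix m
    have "of_int \<lceil>\<xi> * real (Suc m)\<rceil> - 1 < \<xi> * real (Suc m)" "\<xi> * real (Suc m) \<le> of_int \<lceil>\<xi> * real (Suc m)\<rceil>"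
      by linarith+
    then have "\<xi> \<in> ?I m" by (simp add: pos_divide_less_eq pos_le_divide_eq del: of_nat_Suc)
  } note mem = this
  show "\<forall>m. 1 \<le> card (Y \<omega> \<inter> ?I m)" if "\<xi> \<in> Y \<omega>"
  proof
    fix m
    have "0 < card (Y \<omega> \<inter> ?I m)"
      using that mem[of m] fin[of "?I m"] by (intro card_gt_0_iff[THEN iffD2]) auto
    then show "1 \<le> card (Y \<omega> \<inter> ?I m)" by linarith
  qed
  show "\<xi> \<in> Y \<omega>" if all: "\<forall>m. 1 \<le> card (Y \<omega> \<inter> ?I m)"
  proof (rule ccontr)
    assume nin: "\<xi> \<notin> Y \<omega>"
    obtain d where d: "0 < d" "\<And>y. y \<in> Y \<omega> \<inter> {\<xi> - 1..\<xi> + 1} \<Longrightarrow> y \<noteq> \<xi> \<Longrightarrow> d \<le> dist \<xi> y"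
      using finite_set_avoid[OF fin[of "{\<xi> - 1..\<xi> + 1}"], of \<xi>] by auto
    obtain m where m: "inverse (real (Suc m)) < d" using reals_Archimedean[OF d(1)] by auto
    have "Y \<omega> \<inter> ?I m \<noteq> {}" using all by (metis card.empty not_one_le_zero)
    then obtain y where "y \<in> Y \<omega> \<inter> ?I m" unfolding ex_in_conv[symmetric] by (elim exE)
    then have y: "y \<in> Y \<omega>" "y \<in> ?I m" by (simp_all only: Int_iff)
    have "(of_int \<lceil>\<xi> * real (Suc m)\<rceil> - 1) / real (Suc m) =
        of_int \<lceil>\<xi> * real (Suc m)\<rceil> / real (Suc m) - inverse (real (Suc m))"
      by (simp add: diff_divide_distrib inverse_eq_divide)
    then have dist: "\<bar>y - \<xi>\<bar> < inverse (real (Suc m))"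
      using y(2) mem[of m] by auto
    moreover have "inverse (real (Suc m)) \<le> 1" by (simp add: inverse_le_1_iff)
    ultimately have "y \<in> Y \<omega> \<inter> {\<xi> - 1..\<xi> + 1}" using y(1) by auto
    then have "d \<le> dist \<xi> y" using d(2) y(1) nin by metis
    then show False using m dist by (simp add: dist_real_def)
  qed
qed

lemma marked_sets:
  assumes [measurable]: "\<xi> \<in> borel_measurable M"
  shows "{\<omega> \<in> space M. \<xi> \<omega> \<in> Y \<omega>} \<in> sets M"
proof -
  let ?J = "\<lambda>k m. {(of_int k - 1) / real (Suc m)<..of_int k / real (Suc m)}"
  have J [measurable]: "(\<lambda>\<omega>. card (Y \<omega> \<inter> ?J k m)) \<in> M \<rightarrow>\<^sub>M count_space UNIV" for k :: int and m
    by (rule thin.Y.measurable_count) auto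
  have "{\<omega> \<in> space M. \<xi> \<omega> \<in> Y \<omega>} =
      {\<omega> \<in> space M. \<forall>m. \<exists>k::int. \<lceil>\<xi> \<omega> * real (Suc m)\<rceil> = k \<and> 1 \<le> card (Y \<omega> \<inter> ?J k m)}"
    by (intro Collect_cong conj_cong refl) (subst mem_Y_iff, auto)
  also have "\<dots> \<in> sets M" by measurable
  finally show ?thesis .
qed

lemma marked_pt_sets [measurable]: "{\<omega> \<in> space M. pt i \<omega> \<in> Y \<omega>} \<in> sets M"
  by (rule marked_sets) simp

lemma marked_all_sets:
  assumes "finite I"
  shows "{\<omega> \<in> space M. \<forall>i\<in>I. pt i \<omega> \<in> Y \<omega>} \<in> sets M"
  by (intro sets.sets_Collect_finite_All marked_pt_sets assms)

lemma pt_in: "\<omega> \<in> space M \<Longrightarrow> Z \<omega> = X \<omega> \<Longrightarrow> pt i \<omega> \<in> insert 0 (X \<omega>)"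
  using range_nth_point[OF Z_lf Z_generic(1), of \<omega>] unfolding pt_def by (metis Int_iff rangeI)

text \<open>The points are selections measurable in \<open>\<G>\<close> and almost surely distinct
  points of the process, so the thinning condition makes the conditional probability constant; it is
  then integrated over \<open>A\<close>.\<close>

lemma prob_marked:
  assumes A: "A \<in> sets \<G>" and I: "finite I"
  shows "prob (A \<inter> {\<omega> \<in> space M. \<forall>i\<in>I. pt i \<omega> \<in> Y \<omega>}) = p ^ card I * prob A"
proof -
  interpret sfs: sigma_finite_subalgebra M \<G>
    by (rule finite_measure_subalgebra_is_sigma_finite, unfold_locales) (rule subalg_G)
  define l where "l = sorted_list_of_set I"
  have l: "set l = I" "length l = card I" "distinct l" unfolding l_def using I by auto
  let ?\<xi> = "\<lambda>i. pt (l ! i)" and ?n = "card I"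
  let ?B = "{\<omega> \<in> space M. \<forall>i\<in>I. pt i \<omega> \<in> Y \<omega>}"
  have B: "?B \<in> sets M" by (rule marked_all_sets[OF I])
  have AM: "A \<in> sets M" using A G_sub by auto
  have Beq: "{\<omega> \<in> space M. \<forall>i<?n. ?\<xi> i \<omega> \<in> Y \<omega>} = ?B"
    using l by (auto simp: all_set_conv_all_nth[symmetric]) (metis in_set_conv_nth)
  have "\<forall>i<?n. ?\<xi> i \<in> borel_measurable \<G>" using pt_G by simp
  from thin.thinning_cond[OF this]
  have "AE \<omega> in M. inj_on (\<lambda>i. ?\<xi> i \<omega>) {..<?n} \<and> (\<forall>i<?n. ?\<xi> i \<omega> \<in> insert 0 (X \<omega>)) \<longrightarrow>
      real_cond_exp M \<G> (indicator ?B) \<omega> = p ^ ?n"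
    unfolding Beq .
  then have ae: "AE \<omega> in M. real_cond_exp M \<G> (indicator ?B) \<omega> = p ^ ?n"
    using AE_Z AE_space
  proof eventually_elim
    case (elim \<omega>)
    have "inj_on (\<lambda>i. ?\<xi> i \<omega>) {..<?n}"
    proof (rule inj_onI)
      fix i j assume "i \<in> {..<?n}" "j \<in> {..<?n}" "?\<xi> i \<omega> = ?\<xi> j \<omega>"
      then show "i = j"
        using strict_mono_eq[OF pt_mono[OF elim(3)]] nth_eq_iff_index_eq[OF l(3)] l(2) by simp
    qed
    then show ?case using elim(1) pt_in[OF elim(3,2)] by blast
  qed
  have "prob (A \<inter> ?B) = (\<integral>\<omega>\<in>A. indicat_real ?B \<omega> \<partial>M)"
    unfolding set_lebesgue_integral_def using AM B
    by (simp add: indicator_inter_arith[symmetric])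
  also have "\<dots> = (\<integral>\<omega>\<in>A. real_cond_exp M \<G> (indicator ?B) \<omega> \<partial>M)"
    by (rule sfs.real_cond_exp_intA[OF _ A]) (use B in \<open>auto simp: less_top[symmetric]\<close>)
  also have "\<dots> = (\<integral>\<omega>. indicat_real A \<omega> * p ^ ?n \<partial>M)"
    unfolding set_lebesgue_integral_def
  proof (rule integral_cong_AE)
    show "AE \<omega> in M. indicat_real A \<omega> *\<^sub>R real_cond_exp M \<G> (indicator ?B) \<omega> = indicat_real A \<omega> * p ^ ?n"
      using ae by eventually_elim simp
  qed (use AM in auto)
  also have "\<dots> = p ^ ?n * prob A" using AM by simp
  finally show ?thesis .
qed

text \<open>\<open>Inl\<close> indexes the gaps, starting with the one on the left of \<open>0\<close>, and \<open>Inr\<close> the second marks.\<close>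

definition V :: "nat + nat \<Rightarrow> 'w \<Rightarrow> real" where
  "V j \<omega> = (case j of Inl 0 \<Rightarrow> left_gap (Z \<omega>) | Inl (Suc i) \<Rightarrow> pt (Suc i) \<omega> - pt i \<omega>
    | Inr i \<Rightarrow> indicator (Y \<omega>) (pt i \<omega>))"

lemma V_simps:
  "V (Inl 0) \<omega> = left_gap (Z \<omega>)"
  "V (Inl (Suc i)) \<omega> = pt (Suc i) \<omega> - pt i \<omega>"
  "V (Inr i) \<omega> = indicator (Y \<omega>) (pt i \<omega>)"
  by (simp_all add: V_def)

lemma V_pos: "\<omega> \<in> space M \<Longrightarrow> 0 < V (Inl i) \<omega>"
  using left_gap_pos[OF Z_lf Z_generic(2), of \<omega>] strict_monoD[OF pt_mono[of \<omega>], of "i - 1" i]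
  by (cases i) (auto simp: V_simps)

lemma measurable_V [measurable]: "V j \<in> borel_measurable M"
proof (cases j)
  case (Inl i)
  then show ?thesis by (cases i) (auto simp: V_simps[abs_def])
next
  case (Inr i)
  have "(\<lambda>\<omega>. indicat_real {\<omega> \<in> space M. pt i \<omega> \<in> Y \<omega>} \<omega>) \<in> borel_measurable M" by measurable
  then have "(\<lambda>\<omega>. V (Inr i) \<omega>) \<in> borel_measurable M"
    by (rule measurable_cong[THEN iffD1, rotated]) (auto simp: V_simps indicator_def)
  then show ?thesis using Inr by simp
qed

lemma prob_joint:
  assumes J: "finite J1" "finite J2" and s: "\<And>i. i \<in> J1 \<Longrightarrow> 0 \<le> s i"
  shows "prob {\<omega> \<in> space M. (\<forall>i\<in>J1. s i < V (Inl i) \<omega>) \<and> (\<forall>i\<in>J2. pt i \<omega> \<in> Y \<omega>)} =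
    (\<Prod>i\<in>J1. exp (- s i)) * p ^ card J2"
proof -
  \<comment> \<open>Unconstrained gaps get the threshold 0, which positivity of the gaps makes void;
    this reduces to an initial segment of gaps.\<close>
  define s' where "s' i = (if i \<in> J1 then s i else 0)" for i
  obtain n where n: "J1 \<subseteq> {..<n}" using finite_nat_iff_bounded J(1) by blast
  have s': "0 \<le> s' i" for i using s by (simp add: s'_def)
  let ?E = "early (s' 0) (\<lambda>i. s' (Suc i)) n"
  have E: "?E = {\<omega> \<in> space M. \<forall>i\<in>J1. s i < V (Inl i) \<omega>}"
  proof (intro set_eqI iffI)
    fix \<omega> assume w: "\<omega> \<in> ?E"
    have "s i < V (Inl i) \<omega>" if "i \<in> J1" for i
      using w that n by (cases i) (auto simp: early_def V_simps s'_def subset_iff split: if_splits)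
    then show "\<omega> \<in> {\<omega> \<in> space M. \<forall>i\<in>J1. s i < V (Inl i) \<omega>}" using w by (auto simp: early_def)
  next
    fix \<omega> assume w: "\<omega> \<in> {\<omega> \<in> space M. \<forall>i\<in>J1. s i < V (Inl i) \<omega>}"
    have "s' i < V (Inl i) \<omega>" for i using w V_pos[of \<omega> i] by (auto simp: s'_def)
    from this[of 0] this[of "Suc _"] show "\<omega> \<in> ?E" using w by (auto simp: early_def V_simps)
  qed
  have "prob ?E = exp (- s' 0) * (\<Prod>i<n. exp (- s' (Suc i)))"
    by (rule prob_early) (use s' in auto)
  also have "\<dots> = (\<Prod>i<Suc n. exp (- s' i))" by (simp only: prod.lessThan_Suc_shift)
  also have "\<dots> = (\<Prod>i\<in>J1. exp (- s' i))"
    by (rule prod.mono_neutral_right) (use n in \<open>auto simp: s'_def\<close>)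
  also have "\<dots> = (\<Prod>i\<in>J1. exp (- s i))" by (intro prod.cong) (auto simp: s'_def)
  finally have pE: "prob ?E = (\<Prod>i\<in>J1. exp (- s i))" .
  have "{\<omega> \<in> space M. (\<forall>i\<in>J1. s i < V (Inl i) \<omega>) \<and> (\<forall>i\<in>J2. pt i \<omega> \<in> Y \<omega>)} =
      ?E \<inter> {\<omega> \<in> space M. \<forall>i\<in>J2. pt i \<omega> \<in> Y \<omega>}"
    unfolding E by auto
  then show ?thesis using prob_marked[OF early_G J(2)] pE by (simp add: mult.commute)
qed

lemma prob_gap: "0 \<le> s \<Longrightarrow> prob {\<omega> \<in> space M. s < V (Inl i) \<omega>} = exp (- s)"
  using prob_joint[of "{i}" "{}" "\<lambda>_. s"] by simp

lemma prob_mark: "prob {\<omega> \<in> space M. pt i \<omega> \<in> Y \<omega>} = p"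
  using prob_joint[of "{}" "{i}"] by simp

section \<open>Mutual independence of the coordinates from pi-systems of tail events\<close>

definition gens :: "nat + nat \<Rightarrow> 'w set set" where
  "gens j = (case j of Inl i \<Rightarrow> {{\<omega> \<in> space M. s < V (Inl i) \<omega>} | s. 0 \<le> s}
    | Inr i \<Rightarrow> {{\<omega> \<in> space M. pt i \<omega> \<in> Y \<omega>}})"

lemma gens_sets: "gens j \<subseteq> sets M"
  by (auto simp: gens_def split: sum.split)

lemma indep_gens: "indep_sets gens UNIV"
proof (rule indep_setsI[OF gens_sets])
  fix A and J :: "(nat + nat) set"
  assume J: "finite J" "\<forall>j\<in>J. A j \<in> gens j"
  define J1 J2 where "J1 = Inl -` J" and "J2 = Inr -` J"
  have fin: "finite J1" "finite J2"
    unfolding J1_def J2_def using J(1) by (auto intro: finite_vimageI)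
  have Jeq: "J = J1 <+> J2" unfolding J1_def J2_def by (auto simp: Plus_def image_iff) (metis sum.exhaust)
  have "\<forall>i\<in>J1. \<exists>s\<ge>0. A (Inl i) = {\<omega> \<in> space M. s < V (Inl i) \<omega>}"
  proof
    fix i assume "i \<in> J1"
    then have "A (Inl i) \<in> gens (Inl i)" using J(2) unfolding J1_def by simp
    then obtain s where "A (Inl i) = {\<omega> \<in> space M. s < V (Inl i) \<omega>}" "0 \<le> s"
      unfolding gens_def by auto
    then show "\<exists>s\<ge>0. A (Inl i) = {\<omega> \<in> space M. s < V (Inl i) \<omega>}" by (intro exI conjI)
  qed
  then obtain s where s: "\<And>i. i \<in> J1 \<Longrightarrow> 0 \<le> s i"
    "\<And>i. i \<in> J1 \<Longrightarrow> A (Inl i) = {\<omega> \<in> space M. s i < V (Inl i) \<omega>}"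
    by metis
  have m: "A (Inr i) = {\<omega> \<in> space M. pt i \<omega> \<in> Y \<omega>}" if "i \<in> J2" for i
  proof -
    have "A (Inr i) \<in> gens (Inr i)" using J(2) that unfolding J2_def by simp
    then show ?thesis unfolding gens_def by simp
  qed
  assume "J \<noteq> {}"
  then have "(\<Inter>j\<in>J. A j) = {\<omega> \<in> space M. (\<forall>i\<in>J1. s i < V (Inl i) \<omega>) \<and> (\<forall>i\<in>J2. pt i \<omega> \<in> Y \<omega>)}"
  proof (intro set_eqI)
    fix \<omega>
    obtain j where j: "j \<in> J" using \<open>J \<noteq> {}\<close> by auto
    then have "A j \<subseteq> space M" using J(2) gens_sets[of j] sets.sets_into_space[of "A j" M] by auto
    then have "\<omega> \<in> (\<Inter>j\<in>J. A j) \<longleftrightarrow> \<omega> \<in> space M \<and> (\<forall>j\<in>J. \<omega> \<in> A j)" using j by auto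
    also have "\<dots> \<longleftrightarrow> \<omega> \<in> space M \<and> (\<forall>i\<in>J1. \<omega> \<in> A (Inl i)) \<and> (\<forall>i\<in>J2. \<omega> \<in> A (Inr i))"
      unfolding Jeq Plus_def by auto
    also have "\<dots> \<longleftrightarrow> \<omega> \<in> {\<omega> \<in> space M. (\<forall>i\<in>J1. s i < V (Inl i) \<omega>) \<and> (\<forall>i\<in>J2. pt i \<omega> \<in> Y \<omega>)}"
      using s(2) m by (auto cong: ball_cong)
    finally show "\<omega> \<in> (\<Inter>j\<in>J. A j) \<longleftrightarrow>
      \<omega> \<in> {\<omega> \<in> space M. (\<forall>i\<in>J1. s i < V (Inl i) \<omega>) \<and> (\<forall>i\<in>J2. pt i \<omega> \<in> Y \<omega>)}" .
  qed
  then have "prob (\<Inter>j\<in>J. A j) = (\<Prod>i\<in>J1. exp (- s i)) * p ^ card J2"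
    using prob_joint[OF fin s(1)] by simp
  also have "\<dots> = (\<Prod>i\<in>J1. prob (A (Inl i))) * (\<Prod>i\<in>J2. prob (A (Inr i)))"
    using s m by (simp add: prob_gap prob_mark)
  also have "\<dots> = (\<Prod>j\<in>J. prob (A j))"
    unfolding Jeq using fin by (simp add: prod.Plus)
  finally show "prob (\<Inter>j\<in>J. A j) = (\<Prod>j\<in>J. prob (A j))" .
qed

lemma V_gens: "V j \<in> borel_measurable (sigma (space M) (gens j))"
proof -
  have gp: "gens j \<subseteq> Pow (space M)" using gens_sets sets.space_closed by blast
  have basic: "E \<in> sets (sigma (space M) (gens j))" if "E \<in> gens j" for E
    using that gp by auto
  have sp: "space (sigma (space M) (gens j)) = space M" using gp by (rule space_measure_of)
  show ?thesis
  proof (cases j)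
    case (Inl i)
    show ?thesis
    proof (rule borel_measurable_iff_greater[THEN iffD2], rule allI)
      fix a
      show "{\<omega> \<in> space (sigma (space M) (gens j)). a < V j \<omega>} \<in> sets (sigma (space M) (gens j))"
      proof (cases "0 \<le> a")
        case True
        then show ?thesis unfolding sp by (intro basic) (auto simp: gens_def Inl)
      next
        case False
        then have "a < V j \<omega>" if "\<omega> \<in> space M" for \<omega> using V_pos[OF that, of i] Inl by simp
        then have "{\<omega> \<in> space M. a < V j \<omega>} = space M" by auto
        then show ?thesis unfolding sp using sets.top[of "sigma (space M) (gens j)"] sp by simp
      qed
    qed
  next
    case (Inr i)
    have "{\<omega> \<in> space M. pt i \<omega> \<in> Y \<omega>} \<in> sets (sigma (space M) (gens j))"
      by (rule basic) (simp add: gens_def Inr)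
    then have "indicat_real {\<omega> \<in> space M. pt i \<omega> \<in> Y \<omega>} \<in> borel_measurable (sigma (space M) (gens j))"
      by (rule borel_measurable_indicator)
    then show ?thesis
      by (rule measurable_cong[THEN iffD1, rotated]) (auto simp: V_simps indicator_def Inr sp[unfolded Inr])
  qed
qed

lemma indep_V: "indep_vars (\<lambda>_. borel) V UNIV"
  unfolding indep_vars_def2
proof (intro conjI ballI)
  have "indep_sets (\<lambda>j. sigma_sets (space M) (gens j)) UNIV"
  proof (rule indep_sets_sigma[OF indep_gens])
    fix j
    show "Int_stable (gens j)"
    proof (rule Int_stableI)
      fix A B assume AB: "A \<in> gens j" "B \<in> gens j"
      show "A \<inter> B \<in> gens j"
      proof (cases j)
        case (Inl i)
        then obtain s t where "0 \<le> s" "0 \<le> t" "A = {\<omega> \<in> space M. s < V j \<omega>}" "B = {\<omega> \<in> space M. t < V j \<omega>}"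
          using AB by (auto simp: gens_def)
        then show ?thesis unfolding gens_def Inl by (auto intro!: exI[of _ "max s t"])
      next
        case (Inr i)
        then show ?thesis using AB by (simp add: gens_def)
      qed
    qed
  qed
  then show "indep_sets (\<lambda>i. {V i -` A \<inter> space M |A. A \<in> sets borel}) UNIV"
  proof (rule indep_sets_mono_sets, safe)
    fix j and A :: "real set" assume A: "A \<in> sets borel"
    have gp: "gens j \<subseteq> Pow (space M)" using gens_sets sets.space_closed by blast
    show "V j -` A \<inter> space M \<in> sigma_sets (space M) (gens j)"
      using measurable_sets[OF V_gens A, of j] gp by (simp add: space_measure_of_conv)
  qed
qed (rule measurable_V)

lemma gap_exponential: "distributed M lborel (V (Inl i)) (exponential_density 1)"
proof (rule exponential_distributed_iff[THEN iffD2], simp, intro conjI allI impI measurable_V)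
  fix a :: real assume a: "0 \<le> a"
  have "prob {\<omega> \<in> space M. V (Inl i) \<omega> \<le> a} = 1 - prob {\<omega> \<in> space M. a < V (Inl i) \<omega>}"
    using prob_compl[of "{\<omega> \<in> space M. a < V (Inl i) \<omega>}"]
    by (simp add: set_diff_eq not_less Collect_conj_eq[symmetric] conj_commute cong: conj_cong)
  then show "prob {\<omega> \<in> space M. V (Inl i) \<omega> \<le> a} = 1 - exp (- a * 1)" using prob_gap[OF a] by simp
qed

section \<open>Invariance of the joint law under reindexing\<close>

definition law :: "nat + nat \<Rightarrow> real measure" where "law j = distr M borel (V j)"

lemma law_Inl: "law (Inl i) = law (Inl k)"
proof -
  have "law (Inl i) = density lborel (exponential_density 1)" for i
    using distributed_distr_eq_density[OF gap_exponential[of i]] unfolding law_def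
    by (simp cong: distr_cong)
  then show ?thesis by simp
qed

lemma law_Inr: "law (Inr i) = law (Inr k)"
proof -
  have "emeasure (law (Inr i)) B = ennreal ((if 1 \<in> B then p else 0) + (if 0 \<in> B then 1 - p else 0))"
    if B: "B \<in> sets borel" for B i
  proof -
    let ?E = "{\<omega> \<in> space M. pt i \<omega> \<in> Y \<omega>}"
    have "emeasure (law (Inr i)) B = prob (V (Inr i) -` B \<inter> space M)"
      unfolding law_def using B by (simp add: emeasure_distr emeasure_eq_measure)
    also have "V (Inr i) -` B \<inter> space M = (if 1 \<in> B then ?E else {}) \<union> (if 0 \<in> B then space M - ?E else {})"
    proof -
      have "V (Inr i) \<omega> = (if pt i \<omega> \<in> Y \<omega> then 1 else 0)" for \<omega> by (simp add: V_simps)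
      then show ?thesis by (auto split: if_splits)
    qed
    also have "prob \<dots> = prob (if 1 \<in> B then ?E else {}) + prob (if 0 \<in> B then space M - ?E else {})"
      by (rule finite_measure_Union) auto
    also have "\<dots> = (if 1 \<in> B then p else 0) + (if 0 \<in> B then 1 - p else 0)"
      using prob_mark[of i] prob_compl[OF marked_pt_sets, of i] by simp
    finally show ?thesis .
  qed
  then show ?thesis by (intro measure_eqI) (auto simp: law_def)
qed

definition Vp :: "'w \<Rightarrow> nat + nat \<Rightarrow> real" where "Vp \<omega> j = V j \<omega>"

abbreviation "seqs \<equiv> PiM (UNIV :: (nat + nat) set) (\<lambda>_. borel :: real measure)"

lemma measurable_Vp [measurable]: "Vp \<in> M \<rightarrow>\<^sub>M seqs"
  unfolding Vp_def[abs_def] by (rule measurable_PiM_single') (auto simp: space_PiM)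

lemma distr_Vp: "distr M seqs Vp = PiM UNIV law"
proof -
  have "distr M seqs (\<lambda>\<omega>. \<lambda>j\<in>UNIV. V j \<omega>) = PiM UNIV law"
    unfolding law_def[abs_def] using indep_V
    by (subst indep_vars_iff_distr_eq_PiM[symmetric]) auto
  then show ?thesis by (simp add: Vp_def[abs_def] restrict_def)
qed

text \<open>By independence the joint law is a product, so an injective choice of coordinates with
  matching single laws reproduces it. This compares the environments seen from different
  points.\<close>

lemma same_law:
  assumes f: "inj f" "\<And>j. law (f j) = law j" and S: "S \<in> sets seqs"
  shows "prob {\<omega> \<in> space M. (\<lambda>j. Vp \<omega> (f j)) \<in> S} = prob {\<omega> \<in> space M. Vp \<omega> \<in> S}"
proof -
  have ps: "prob_space (law j)" for j unfolding law_def by (rule prob_space_distr) simp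
  have sl: "sets (PiM UNIV law) = sets seqs" by (intro sets_PiM_cong) (auto simp: law_def)
  have re: "distr (PiM UNIV law) (PiM UNIV (\<lambda>j. law (f j))) (\<lambda>v. \<lambda>j\<in>UNIV. v (f j)) = PiM UNIV (\<lambda>j. law (f j))"
    by (rule distr_PiM_reindex) (use ps f(1) in auto)
  have mf: "(\<lambda>v j. v (f j)) \<in> seqs \<rightarrow>\<^sub>M seqs"
    by (rule measurable_PiM_single') (auto simp: space_PiM)
  have "distr M seqs (\<lambda>\<omega> j. Vp \<omega> (f j)) = distr (distr M seqs Vp) seqs (\<lambda>v j. v (f j))"
    by (subst distr_distr[OF mf measurable_Vp]) (simp add: comp_def)
  also have "\<dots> = distr (PiM UNIV law) (PiM UNIV law) (\<lambda>v j. v (f j))"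
    unfolding distr_Vp by (rule distr_cong) (auto simp: sl)
  also have "\<dots> = PiM UNIV law" using re by (simp add: f(2) restrict_def)
  also have "\<dots> = distr M seqs Vp" by (rule distr_Vp[symmetric])
  finally have eq: "distr M seqs (\<lambda>\<omega> j. Vp \<omega> (f j)) = distr M seqs Vp" .
  have m2: "(\<lambda>\<omega> j. Vp \<omega> (f j)) \<in> M \<rightarrow>\<^sub>M seqs"
    using measurable_comp[OF measurable_Vp mf] by (simp add: comp_def)
  have "measure (distr M seqs (\<lambda>\<omega> j. Vp \<omega> (f j))) S = measure (distr M seqs Vp) S" unfolding eq ..
  then show ?thesis
    using S by (simp add: measure_distr m2 measurable_Vp vimage_def Int_def conj_commute)
qed

end

section \<open>Returns and the hitting time\<close>

text \<open>
  \<open>seq_marks\<close> ignores the entry of the point \<open>0\<close>, so that the events below do not depend on it.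
  \<open>shift i\<close> describes the environment seen from the \<open>i\<close>-th point, and \<open>merge\<close> the environment on the
  right of \<open>x\<^sub>1\<close> with the left gap \<open>g\<close> in place of \<open>x\<^sub>1\<close>.
\<close>

definition seq_point :: "(nat + nat \<Rightarrow> real) \<Rightarrow> nat \<Rightarrow> real" where
  "seq_point v k = (\<Sum>l<k. v (Inl l))"

definition seq_marks :: "(nat + nat \<Rightarrow> real) \<Rightarrow> nat \<Rightarrow> nat" where
  "seq_marks v k = (if k \<noteq> 0 \<and> 0 < v (Inr k) then 2 else 1)"

definition seq_reaches :: "nat \<Rightarrow> (nat + nat \<Rightarrow> real) \<Rightarrow> bool" where
  "seq_reaches n v = reaches (seq_point v) (seq_marks v) n"

definition shift :: "nat \<Rightarrow> nat + nat \<Rightarrow> nat + nat" where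
  "shift i = map_sum (\<lambda>k. Suc (i + k)) (\<lambda>k. i + k)"

definition merge :: "nat + nat \<Rightarrow> nat + nat" where
  "merge = map_sum (\<lambda>k. if k = 0 then 0 else Suc k) (\<lambda>k. k)"

definition right_point :: "(nat + nat \<Rightarrow> real) \<Rightarrow> nat \<Rightarrow> real" where
  "right_point v k = (\<Sum>l<k. v (Inl (Suc l)))"

text \<open>The condition of the overview with the left gap isolated on one side and replaced by a
  constant, so that it is independent of that gap. Natural numbers \<open>G\<close> keep the family
  of events countable.\<close>

definition trapped :: "nat \<Rightarrow> (nat + nat \<Rightarrow> real) \<Rightarrow> bool" where
  "trapped G v \<longleftrightarrow> (\<forall>i m. seq_reaches m (\<lambda>j. v (shift i j)) \<longrightarrow>
    right_point v (i + m + 1) - 2 * right_point v i < real G)"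

lemma shift_simps [simp]: "shift i (Inl k) = Inl (Suc (i + k))" "shift i (Inr k) = Inr (i + k)"
  by (simp_all add: shift_def)

lemma merge_simps [simp]: "merge (Inl k) = Inl (if k = 0 then 0 else Suc k)" "merge (Inr k) = Inr k"
  by (simp_all add: merge_def)

lemma inj_shift: "inj (shift i)"
  unfolding shift_def by (intro sum.inj_map) (auto intro: injI)

lemma inj_merge: "inj merge"
  unfolding merge_def by (intro sum.inj_map) (auto intro!: injI split: if_splits)

lemma seq_reaches_cong:
  assumes "\<And>k. v (Inl k) = v' (Inl k)" "\<And>k. k \<noteq> 0 \<Longrightarrow> v (Inr k) = v' (Inr k)"
  shows "seq_reaches n v = seq_reaches n v'"
proof -
  have "seq_point v = seq_point v'" "seq_marks v = seq_marks v'"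
    using assms by (auto simp: seq_point_def seq_marks_def fun_eq_iff)
  then show ?thesis by (simp add: seq_reaches_def)
qed

lemma right_point_cong: "(\<And>k. v (Inl (Suc k)) = v' (Inl (Suc k))) \<Longrightarrow> right_point v k = right_point v' k"
  by (simp add: right_point_def)

lemma trapped_cong:
  assumes "\<And>k. v (Inl (Suc k)) = v' (Inl (Suc k))" "\<And>k. k \<noteq> 0 \<Longrightarrow> v (Inr k) = v' (Inr k)"
  shows "trapped G v = trapped G v'"
proof -
  have "seq_reaches m (\<lambda>j. v (shift i j)) = seq_reaches m (\<lambda>j. v' (shift i j))" for i m
    by (rule seq_reaches_cong) (use assms in auto)
  then show ?thesis unfolding trapped_def using right_point_cong[of v v'] assms(1) by simp
qed

section \<open>Measurability on the sequence space\<close>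

lemma measurable_component:
  "(\<lambda>v. v j) \<in> PiM UNIV (\<lambda>_. borel :: real measure) \<rightarrow>\<^sub>M borel"
  by (rule measurable_component_singleton) simp

lemma measurable_seq_point [measurable]:
  "(\<lambda>v. seq_point v k) \<in> PiM UNIV (\<lambda>_. borel :: real measure) \<rightarrow>\<^sub>M borel"
  unfolding seq_point_def by (intro borel_measurable_sum measurable_component)

lemma measurable_right_point [measurable]:
  "(\<lambda>v. right_point v k) \<in> PiM UNIV (\<lambda>_. borel :: real measure) \<rightarrow>\<^sub>M borel"
  unfolding right_point_def by (intro borel_measurable_sum measurable_component)

text \<open>There are countably many finite lists of indices, and each one is greedy under countably
  many inequalities between partial sums and marks.\<close>

lemma measurable_seq_reaches [measurable]:
  "Measurable.pred (PiM (UNIV :: (nat + nat) set) (\<lambda>_. borel :: real measure)) (\<lambda>v. seq_reaches n v)"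
proof -
  let ?N = "PiM (UNIV :: (nat + nat) set) (\<lambda>_. borel :: real measure)"
  have const: "Measurable.pred ?N (\<lambda>_. c)" for c by simp
  have lt: "Measurable.pred ?N (\<lambda>v. c < seq_marks v k)" for c k
  proof -
    have "Measurable.pred ?N (\<lambda>v. 0 < v (Inr k))" using measurable_component by measurable
    then have "Measurable.pred ?N (\<lambda>v. (k \<noteq> 0 \<and> 0 < v (Inr k)) \<and> c < 2 \<or> c < 1)"
      by (intro pred_intros_logic(3,5) const)
    moreover have "(\<lambda>v. c < seq_marks v k) = (\<lambda>v. (k \<noteq> 0 \<and> 0 < v (Inr k)) \<and> c < 2 \<or> c < 1)"
      by (auto simp: seq_marks_def fun_eq_iff)
    ultimately show ?thesis by simp
  qed
  have le: "Measurable.pred ?N (\<lambda>v. \<bar>seq_point v i - seq_point v j\<bar> \<le> \<bar>seq_point v k - seq_point v j\<bar>)" for i j k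
    unfolding pred_def by (intro borel_measurable_le borel_measurable_abs borel_measurable_diff measurable_seq_point)
  have path: "Measurable.pred ?N (\<lambda>v. greedy_path (seq_point v) (seq_marks v) l)" for l
    unfolding greedy_path_def
    by (intro pred_intros_countable(1) pred_intros_logic(3,4) const lt le)
  show ?thesis
    unfolding seq_reaches_def reaches_def
    by (intro pred_intros_countable(2) pred_intros_logic(3) const path)
qed

lemma measurable_reindex:
  "(\<lambda>v j. v (f j)) \<in> PiM UNIV (\<lambda>_. borel :: real measure) \<rightarrow>\<^sub>M PiM UNIV (\<lambda>_. borel)"
  by (rule measurable_PiM_single') (auto simp: space_PiM)

lemma measurable_seq_reaches_reindex [measurable]:
  "Measurable.pred (PiM UNIV (\<lambda>_. borel :: real measure)) (\<lambda>v. seq_reaches n (\<lambda>j. v (f j)))"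
  for f :: "nat + nat \<Rightarrow> nat + nat"
  by (rule measurable_compose[OF measurable_reindex measurable_seq_reaches])

lemma measurable_trapped [measurable]:
  "Measurable.pred (PiM (UNIV :: (nat + nat) set) (\<lambda>_. borel :: real measure)) (\<lambda>v. trapped G v)"
proof -
  have "Measurable.pred (PiM (UNIV :: (nat + nat) set) (\<lambda>_. borel :: real measure))
      (\<lambda>v. right_point v k - 2 * right_point v i < real G)" for i k
    using measurable_right_point by measurable
  then show ?thesis unfolding trapped_def
    by (intro pred_intros_countable(1) pred_intros_logic(4) measurable_seq_reaches_reindex)
qed

lemma seq_marks_ge: "1 \<le> seq_marks v k"
  by (simp add: seq_marks_def)

lemma seq_reaches_antimono:
  assumes "\<And>k. 0 < v (Inl k)" "seq_reaches n v" "1 \<le> m" "m \<le> n"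
  shows "seq_reaches m v"
proof -
  have "strict_mono (seq_point v)" unfolding strict_mono_Suc_iff by (simp add: seq_point_def assms(1))
  then show ?thesis using reaches_antimono[of "seq_point v" "seq_marks v"] seq_marks_ge assms(2-)
    unfolding seq_reaches_def by simp
qed

lemma seq_reaches_gap_mono:
  assumes "\<And>k. 0 < v (Inl k)" "seq_reaches n v"
    and "v (Inl 0) \<le> v' (Inl 0)" "\<And>j. j \<noteq> Inl 0 \<Longrightarrow> v' j = v j"
  shows "seq_reaches n v'"
proof -
  have sm: "strict_mono (seq_point v)" unfolding strict_mono_Suc_iff by (simp add: seq_point_def assms(1))
  have marks: "seq_marks v' = seq_marks v" using assms(4) by (auto simp: seq_marks_def fun_eq_iff)
  have shift1: "seq_point v' k = seq_point v k + (v' (Inl 0) - v (Inl 0))" if "1 \<le> k" for k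
    using that assms(4) by (cases k) (auto simp: seq_point_def sum.lessThan_Suc_shift simp del: sum.lessThan_Suc)
  show ?thesis unfolding seq_reaches_def marks
  proof (rule reaches_mono_gap[OF assms(2)[unfolded seq_reaches_def] sm])
    show "seq_point v' k - seq_point v' c = seq_point v k - seq_point v c" if "1 \<le> k" "1 \<le> c" for k c
      using shift1 that by simp
    show "seq_point v 1 - seq_point v 0 \<le> seq_point v' 1 - seq_point v' 0"
      using assms(3) by (simp add: seq_point_def)
  qed
qed

context marked_poisson
begin

lemma law_map: "law (shift i j) = law j" "law (merge j) = law j"
  by (cases j; auto intro: law_Inl law_Inr)+

lemma pt_sum: "pt n \<omega> = right_point (Vp \<omega>) n"
  unfolding right_point_def Vp_def V_simps using sum_lessThan_telescope[of "\<lambda>n. pt n \<omega>" n] by (simp add: pt_0)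

text \<open>Both events are predicates on whole sequences; filling the missing coordinates with 0
  makes them events of the restrictions to \<open>K\<close> and to its complement.\<close>

lemma indep_coords:
  assumes S [measurable]: "Measurable.pred seqs S" and T [measurable]: "Measurable.pred seqs T"
    and SK: "\<And>v v'. (\<And>j. j \<in> K \<Longrightarrow> v j = v' j) \<Longrightarrow> S v = S v'"
    and TK: "\<And>v v'. (\<And>j. j \<notin> K \<Longrightarrow> v j = v' j) \<Longrightarrow> T v = T v'"
  shows "prob {\<omega> \<in> space M. S (Vp \<omega>) \<and> T (Vp \<omega>)} =
    prob {\<omega> \<in> space M. S (Vp \<omega>)} * prob {\<omega> \<in> space M. T (Vp \<omega>)}"
proof -
  let ?r = "\<lambda>K \<omega>. restrict (\<lambda>j. V j \<omega>) K"
  let ?e = "\<lambda>K f j. if j \<in> K then f j else (0::real)"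
  have iv: "indep_var (PiM K (\<lambda>_. borel)) (?r K) (PiM (- K) (\<lambda>_. borel)) (?r (- K))"
    by (rule indep_var_restrict[OF indep_V]) auto
  have e [measurable]: "?e K \<in> PiM K (\<lambda>_. borel) \<rightarrow>\<^sub>M seqs" for K
  proof (rule measurable_PiM_single')
    fix j show "(\<lambda>f. ?e K f j) \<in> borel_measurable (PiM K (\<lambda>_. borel))"
      by (cases "j \<in> K") auto
  qed (auto simp: space_PiM)
  let ?S = "{f \<in> space (PiM K (\<lambda>_. borel)). S (?e K f)}" and ?T = "{f \<in> space (PiM (- K) (\<lambda>_. borel)). T (?e (- K) f)}"
  have sets: "?S \<in> sets (PiM K (\<lambda>_. borel))" "?T \<in> sets (PiM (- K) (\<lambda>_. borel))" by measurable
  have Seq: "S (?e K (?r K \<omega>)) = S (Vp \<omega>)" for \<omega> by (rule SK) (simp add: Vp_def)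
  have Teq: "T (?e (- K) (?r (- K) \<omega>)) = T (Vp \<omega>)" for \<omega> by (rule TK) (simp add: Vp_def)
  have 1: "?r K -` ?S \<inter> space M = {\<omega> \<in> space M. S (Vp \<omega>)}"
    unfolding Seq[symmetric] by (auto simp: space_PiM)
  have 2: "?r (- K) -` ?T \<inter> space M = {\<omega> \<in> space M. T (Vp \<omega>)}"
    unfolding Teq[symmetric] by (auto simp: space_PiM)
  have "(\<lambda>\<omega>. (?r K \<omega>, ?r (- K) \<omega>)) -` (?S \<times> ?T) \<inter> space M =
      (?r K -` ?S \<inter> space M) \<inter> (?r (- K) -` ?T \<inter> space M)"
    by auto
  also have "\<dots> = {\<omega> \<in> space M. S (Vp \<omega>) \<and> T (Vp \<omega>)}" unfolding 1 2 by auto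
  finally show ?thesis using indep_varD[OF iv sets] unfolding 1 2 by simp
qed

text \<open>Reaching is monotone in the index, so for \<open>n \<ge> 1\<close> this is the tail of
  the return number, and summability means that its mean is finite.\<close>

definition reach_prob :: "nat \<Rightarrow> real" where "reach_prob n = prob {\<omega> \<in> space M. seq_reaches n (Vp \<omega>)}"

definition wide_reach_prob :: "nat \<Rightarrow> real" where
  "wide_reach_prob n = prob {\<omega> \<in> space M. 1 < Vp \<omega> (Inl 0) \<and> seq_reaches n (Vp \<omega>)}"

lemma same_law_pred:
  assumes f: "inj f" "\<And>j. law (f j) = law j" and [measurable]: "Measurable.pred seqs P"
  shows "prob {\<omega> \<in> space M. P (\<lambda>j. Vp \<omega> (f j))} = prob {\<omega> \<in> space M. P (Vp \<omega>)}"
proof -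
  have "{v \<in> space seqs. P v} \<in> sets seqs" by measurable
  from same_law[OF f this] show ?thesis by (simp add: space_PiM)
qed

lemma prob_reaches_shift: "prob {\<omega> \<in> space M. seq_reaches n (\<lambda>j. Vp \<omega> (shift i j))} = reach_prob n"
  unfolding reach_prob_def by (rule same_law_pred[OF inj_shift law_map(1)]) simp

lemma prob_reaches_merge: "prob {\<omega> \<in> space M. 1 < Vp \<omega> (Inl 0) \<and> seq_reaches n (\<lambda>j. Vp \<omega> (merge j))} = wide_reach_prob n"
  using same_law_pred[OF inj_merge law_map(2), of "\<lambda>v. 1 < v (Inl 0) \<and> seq_reaches n v"]
  by (simp add: wide_reach_prob_def)

text \<open>
  The hitting time only controls returns over a gap that exceeds \<open>1\<close>. Widening a gap of length
  at most \<open>1\<close> to exactly \<open>1\<close> makes the return harder and the event independent of the gap.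
\<close>

lemma reach_prob_le: "reach_prob n \<le> (1 + exp 1) * wide_reach_prob n"
proof -
  let ?v1 = "\<lambda>v :: nat + nat \<Rightarrow> real. v(Inl 0 := 1)"
  have m1 [measurable]: "(\<lambda>v. seq_reaches n (?v1 v)) \<in> seqs \<rightarrow>\<^sub>M count_space UNIV"
  proof (rule measurable_compose[OF _ measurable_seq_reaches])
    show "?v1 \<in> seqs \<rightarrow>\<^sub>M seqs"
    proof (rule measurable_PiM_single')
      fix j show "(\<lambda>v. ?v1 v j) \<in> borel_measurable seqs" by (cases "j = Inl 0") auto
    qed (auto simp: space_PiM)
  qed
  let ?A = "{\<omega> \<in> space M. 1 < Vp \<omega> (Inl 0) \<and> seq_reaches n (Vp \<omega>)}"
  let ?B = "{\<omega> \<in> space M. seq_reaches n (?v1 (Vp \<omega>))}"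
  let ?C = "{\<omega> \<in> space M. 1 < Vp \<omega> (Inl 0) \<and> seq_reaches n (?v1 (Vp \<omega>))}"
  have pos: "0 < V (Inl k) \<omega>" if "\<omega> \<in> space M" for k \<omega> by (rule V_pos[OF that])
  have m2 [measurable]: "Measurable.pred M (\<lambda>\<omega>. seq_reaches n (?v1 (Vp \<omega>)))"
    by (rule measurable_compose[OF measurable_Vp m1])
  have m3 [measurable]: "Measurable.pred M (\<lambda>\<omega>. seq_reaches n (Vp \<omega>))"
    by (rule measurable_compose[OF measurable_Vp measurable_seq_reaches])
  have m4 [measurable]: "(\<lambda>\<omega>. Vp \<omega> (Inl 0)) \<in> borel_measurable M"
    by (rule measurable_compose[OF measurable_Vp measurable_component])
  have "{\<omega> \<in> space M. seq_reaches n (Vp \<omega>)} \<subseteq> ?A \<union> ?B"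
  proof safe
    fix \<omega> assume \<omega>: "\<omega> \<in> space M" "seq_reaches n (Vp \<omega>)" and "\<not> seq_reaches n (?v1 (Vp \<omega>))"
    then have "\<not> Vp \<omega> (Inl 0) \<le> 1"
      using seq_reaches_gap_mono[of "Vp \<omega>" n "?v1 (Vp \<omega>)"] pos[OF \<omega>(1)] by (auto simp: Vp_def)
    then show "1 < Vp \<omega> (Inl 0)" by simp
  qed
  then have "reach_prob n \<le> prob (?A \<union> ?B)" unfolding reach_prob_def by (intro finite_measure_mono) measurable
  also have "\<dots> \<le> wide_reach_prob n + prob ?B" unfolding wide_reach_prob_def by (rule measure_Un_le) measurable
  finally have 1: "reach_prob n \<le> wide_reach_prob n + prob ?B" .
  have "?C \<subseteq> ?A"
  proof safe
    fix \<omega> assume \<omega>: "\<omega> \<in> space M" "1 < Vp \<omega> (Inl 0)" "seq_reaches n (?v1 (Vp \<omega>))"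
    then show "seq_reaches n (Vp \<omega>)"
      using seq_reaches_gap_mono[of "?v1 (Vp \<omega>)" n "Vp \<omega>"] pos[OF \<omega>(1)] by (auto simp: Vp_def)
  qed
  then have "prob ?C \<le> wide_reach_prob n" unfolding wide_reach_prob_def by (intro finite_measure_mono) measurable
  moreover have "prob ?C = prob {\<omega> \<in> space M. 1 < Vp \<omega> (Inl 0)} * prob ?B"
  proof (rule indep_coords[where K = "{Inl 0}" and S = "\<lambda>v. 1 < v (Inl 0)" and T = "\<lambda>v. seq_reaches n (?v1 v)"])
    show "Measurable.pred seqs (\<lambda>v. 1 < v (Inl 0))" by measurable
    show "Measurable.pred seqs (\<lambda>v. seq_reaches n (?v1 v))" by (rule m1)
    show "seq_reaches n (?v1 v) = seq_reaches n (?v1 v')" if "\<And>j. j \<notin> {Inl 0} \<Longrightarrow> v j = v' j" for v v'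
      by (rule seq_reaches_cong) (use that in auto)
  qed simp
  \<comment> \<open>Dividing by this probability produces the term \<open>exp 1\<close> of the
    constant; the other summand 1 comes from the paths whose gap already exceeds 1.\<close>
  moreover have "prob {\<omega> \<in> space M. 1 < Vp \<omega> (Inl 0)} = exp (- 1)"
    using prob_gap[of 1 0] by (simp add: Vp_def)
  ultimately have "prob ?B \<le> exp 1 * wide_reach_prob n" by (simp add: exp_minus field_simps)
  then show ?thesis using 1 by (simp add: algebra_simps)
qed

definition hit :: "'w \<Rightarrow> enat" where
  "hit \<omega> = hitting_time (greedy_walk (marks (insert 0 (X \<omega>)) (Y \<omega>)) 0) {..0}"

lemma marked_line_generic:
  assumes "\<omega> \<in> space M" "Z \<omega> = X \<omega>" "0 \<notin> Y \<omega>"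
  shows "marked_line (insert 0 (X \<omega>)) (Y \<omega>) (\<lambda>n. pt n \<omega>) (left_gap (Z \<omega>))"
proof
  note lfZ = Z_lf[OF assms(1)]
  show "pt 0 \<omega> = 0" by (rule pt_0)
  show "strict_mono (\<lambda>n. pt n \<omega>)" by (rule pt_mono[OF assms(1)])
  show "range (\<lambda>n. pt n \<omega>) = insert 0 (X \<omega>) \<inter> {0..}"
    using range_nth_point[OF lfZ Z_generic(1)] assms(2) unfolding pt_def by simp
  show "y \<le> - left_gap (Z \<omega>)" if "y \<in> insert 0 (X \<omega>)" "y < 0" for y
    using left_gap_le[OF lfZ Z_generic(2)] that assms(2) by auto
  show "0 < left_gap (Z \<omega>)" by (rule left_gap_pos[OF lfZ Z_generic(2)])
  show "Y \<omega> \<subseteq> insert 0 (X \<omega>)" by (rule thin.thinning_subset[OF assms(1)])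
  show "finite (insert 0 (X \<omega>) \<inter> B)" if "bounded B" for B
    by (rule thin.X.locally_finite[OF assms(1) that])
qed (rule assms(3))

lemma marks_pt:
  assumes "\<omega> \<in> space M" "Z \<omega> = X \<omega>"
  shows "marks (insert 0 (X \<omega>)) (Y \<omega>) (pt k \<omega>) = (if 0 < Vp \<omega> (Inr k) then 2 else 1)"
  using pt_in[OF assms, of k] by (auto simp: marks_def Vp_def V_simps indicator_def)

lemma hit_infinite:
  assumes \<omega>: "\<omega> \<in> space M" "Z \<omega> = X \<omega>"
    and single: "Vp \<omega> (Inr 0) \<le> 0" and gap: "real G < Vp \<omega> (Inl 0)" and tr: "trapped G (Vp \<omega>)"
  shows "hit \<omega> = \<infinity>"
proof -
  have "0 \<notin> Y \<omega>" using single by (auto simp: Vp_def V_simps pt_0 indicator_def split: if_splits)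
  then interpret ml: marked_line "insert 0 (X \<omega>)" "Y \<omega>" "\<lambda>n. pt n \<omega>" "left_gap (Z \<omega>)"
    by (rule marked_line_generic[OF \<omega>])
  have "0 < ml.S (Suc n)" for n
  proof (rule ml.never_nonpos)
    fix i m
    assume "reaches (\<lambda>k. pt (i + k) \<omega> - pt i \<omega>) (\<lambda>k. if k = 0 then 1 else ml.b (i + k)) m"
    moreover have "(\<lambda>k. pt (i + k) \<omega> - pt i \<omega>) = seq_point (\<lambda>j. Vp \<omega> (shift i j))"
    proof
      fix k
      show "pt (i + k) \<omega> - pt i \<omega> = seq_point (\<lambda>j. Vp \<omega> (shift i j)) k"
        by (induction k) (auto simp: seq_point_def Vp_def V_simps)
    qed
    moreover have "(\<lambda>k. if k = 0 then 1 else ml.b (i + k)) = seq_marks (\<lambda>j. Vp \<omega> (shift i j))"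
      unfolding ml.b_def marks_pt[OF \<omega>] by (auto simp: seq_marks_def)
    ultimately have "seq_reaches m (\<lambda>j. Vp \<omega> (shift i j))" by (simp add: seq_reaches_def)
    then have "right_point (Vp \<omega>) (i + m + 1) - 2 * right_point (Vp \<omega>) i < real G"
      using tr unfolding trapped_def by blast
    then show "pt (i + m + 1) \<omega> - pt i \<omega> < pt i \<omega> + left_gap (Z \<omega>)"
      using gap unfolding pt_sum[symmetric] by (simp add: Vp_def V_simps)
  qed
  then have "ml.S n \<notin> {..0}" if "1 \<le> n" for n using that by (cases n) (auto simp: not_le simp del: greedy_walk.simps)
  then show ?thesis unfolding hit_def by (rule hitting_time_never)
qed

definition no_ties :: "'w \<Rightarrow> bool" where
  "no_ties \<omega> \<longleftrightarrow> (\<forall>i j k. i < j \<longrightarrow> j < k \<longrightarrow> pt j \<omega> - pt i \<omega> \<noteq> pt k \<omega> - pt j \<omega>)"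

text \<open>\<open>x 1 < g\<close> couples two gaps. The threshold 1 between them splits it into
  separate conditions on each, so that the event will factor.\<close>

lemma hit_ge:
  assumes \<omega>: "\<omega> \<in> space M" "Z \<omega> = X \<omega>" and nt: "no_ties \<omega>"
    and single: "Vp \<omega> (Inr 0) \<le> 0" and gap: "Vp \<omega> (Inl 1) \<le> 1" "1 < Vp \<omega> (Inl 0)"
    and reach: "seq_reaches n (\<lambda>j. Vp \<omega> (merge j))"
  shows "enat n \<le> hit \<omega>"
proof -
  have "0 \<notin> Y \<omega>" using single by (auto simp: Vp_def V_simps pt_0 indicator_def split: if_splits)
  then interpret ml: marked_line "insert 0 (X \<omega>)" "Y \<omega>" "\<lambda>n. pt n \<omega>" "left_gap (Z \<omega>)"
    by (rule marked_line_generic[OF \<omega>])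
  have "V (Inl (Suc 0)) \<omega> = pt 1 \<omega>" unfolding V_simps by (simp add: pt_0)
  then have "pt 1 \<omega> < left_gap (Z \<omega>)" using gap by (simp add: Vp_def V_simps(1))
  moreover have "seq_point (\<lambda>j. Vp \<omega> (merge j)) = (\<lambda>k. if k = 0 then 0 else left_gap (Z \<omega>) + pt k \<omega> - pt 1 \<omega>)"
  proof
    fix k
    show "seq_point (\<lambda>j. Vp \<omega> (merge j)) k = (if k = 0 then 0 else left_gap (Z \<omega>) + pt k \<omega> - pt 1 \<omega>)"
    proof (induction k)
      case (Suc k)
      then show ?case by (cases k) (auto simp: seq_point_def Vp_def V_simps)
    qed (simp add: seq_point_def)
  qed
  moreover have "seq_marks (\<lambda>j. Vp \<omega> (merge j)) = (\<lambda>k. if k = 0 then 1 else ml.b k)"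
    unfolding ml.b_def marks_pt[OF \<omega>] by (auto simp: seq_marks_def)
  ultimately show ?thesis
    using ml.hitting_time_ge[of n] nt reach unfolding hit_def no_ties_def seq_reaches_def by simp
qed


lemma measurable_Vp_comp [measurable]: "(\<lambda>\<omega>. Vp \<omega> j) \<in> borel_measurable M"
  by (rule measurable_compose[OF measurable_Vp measurable_component])

lemma pred_Vp [measurable]:
  "Measurable.pred seqs P \<Longrightarrow> Measurable.pred M (\<lambda>\<omega>. P (Vp \<omega>))"
  by (rule measurable_compose[OF measurable_Vp])

lemma pred_shift [measurable]: "Measurable.pred M (\<lambda>\<omega>. seq_reaches n (\<lambda>j. Vp \<omega> (f j)))"
  using pred_Vp[OF measurable_seq_reaches_reindex] .

section \<open>Absence of ties\<close>

lemma gap_atomless: "emeasure (distr M borel (V (Inl k))) {c} = 0"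
proof -
  have "distr M borel (V (Inl k)) = density lborel (exponential_density 1)"
    using distributed_distr_eq_density[OF gap_exponential[of k]] by (simp cong: distr_cong)
  moreover have "emeasure (density lborel (exponential_density 1)) {c} =
      (\<integral>\<^sup>+x\<in>{c}. ennreal (exponential_density 1 x) \<partial>lborel)"
    by (rule emeasure_density) auto
  moreover have "\<dots> = 0" by (intro nn_integral_null_set null_setsI) simp_all
  ultimately show ?thesis by simp
qed

text \<open>By independence and Fubini the other coordinates may be frozen; \<open>u\<close> is then
  a constant, which an atomless variable misses almost surely.\<close>

lemma AE_gap_neq:
  assumes [measurable]: "u \<in> borel_measurable seqs"
    and cong: "\<And>v v'. (\<And>j. j \<noteq> Inl k \<Longrightarrow> v j = v' j) \<Longrightarrow> u v = u v'"
  shows "AE \<omega> in M. V (Inl k) \<omega> \<noteq> u (Vp \<omega>)"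
proof -
  let ?U = "\<lambda>\<omega>. u (Vp \<omega>)" and ?K = "- {Inl k} :: (nat + nat) set"
  let ?e = "\<lambda>f j. if j \<in> ?K then f j else (0::real)"
  have e [measurable]: "?e \<in> PiM ?K (\<lambda>_. borel) \<rightarrow>\<^sub>M seqs"
  proof (rule measurable_PiM_single')
    fix j show "(\<lambda>f. ?e f j) \<in> borel_measurable (PiM ?K (\<lambda>_. borel))"
      by (cases "j \<in> ?K") auto
  qed (auto simp: space_PiM)
  have "indep_var (PiM {Inl k} (\<lambda>_. borel)) (\<lambda>\<omega>. restrict (\<lambda>j. V j \<omega>) {Inl k})
      (PiM ?K (\<lambda>_. borel)) (\<lambda>\<omega>. restrict (\<lambda>j. V j \<omega>) ?K)"
    by (rule indep_var_restrict[OF indep_V]) auto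
  then have "indep_var borel ((\<lambda>f. f (Inl k)) \<circ> (\<lambda>\<omega>. restrict (\<lambda>j. V j \<omega>) {Inl k}))
      borel ((\<lambda>f. u (?e f)) \<circ> (\<lambda>\<omega>. restrict (\<lambda>j. V j \<omega>) ?K))"
    by (rule indep_var_compose[OF _ _ measurable_compose[OF e assms(1)]])
      (simp add: measurable_component_singleton)
  moreover have "(\<lambda>f. f (Inl k)) \<circ> (\<lambda>\<omega>. restrict (\<lambda>j. V j \<omega>) {Inl k}) = V (Inl k)"
    by (auto simp: fun_eq_iff)
  moreover have "(\<lambda>f. u (?e f)) \<circ> (\<lambda>\<omega>. restrict (\<lambda>j. V j \<omega>) ?K) = ?U"
    by (auto simp: fun_eq_iff Vp_def intro!: cong)
  ultimately have iv: "indep_var borel (V (Inl k)) borel ?U" by simp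
  let ?A = "distr M borel (V (Inl k))" and ?B = "distr M borel ?U"
  have U [measurable]: "?U \<in> borel_measurable M" using indep_var_rv2[OF iv] .
  interpret A: prob_space ?A by (rule prob_space_distr) simp
  interpret B: prob_space ?B by (rule prob_space_distr) simp
  interpret AB: pair_sigma_finite ?A ?B ..
  let ?D = "{z \<in> space (borel \<Otimes>\<^sub>M borel). fst z = (snd z :: real)}"
  have D: "?D \<in> sets (borel \<Otimes>\<^sub>M borel)" by measurable
  have "{\<omega> \<in> space M. V (Inl k) \<omega> = ?U \<omega>} = (\<lambda>\<omega>. (V (Inl k) \<omega>, ?U \<omega>)) -` ?D \<inter> space M"
    by (auto simp: space_pair_measure)
  then have "emeasure M {\<omega> \<in> space M. V (Inl k) \<omega> = ?U \<omega>} =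
      emeasure (distr M (borel \<Otimes>\<^sub>M borel) (\<lambda>\<omega>. (V (Inl k) \<omega>, ?U \<omega>))) ?D"
    using D by (subst emeasure_distr) auto
  also have "\<dots> = emeasure (?A \<Otimes>\<^sub>M ?B) ?D"
    using iv unfolding indep_var_distribution_eq by simp
  also have "\<dots> = (\<integral>\<^sup>+y. emeasure ?A ((\<lambda>x. (x, y)) -` ?D) \<partial>?B)"
    by (rule AB.emeasure_pair_measure_alt2) (use D in \<open>simp cong: sets_pair_measure_cong\<close>)
  also have "\<dots> = (\<integral>\<^sup>+y. 0 \<partial>?B)"
  proof (rule nn_integral_cong)
    fix y
    have "(\<lambda>x. (x, y)) -` ?D = {y}" by (auto simp: space_pair_measure)
    then show "emeasure ?A ((\<lambda>x. (x, y)) -` ?D) = 0" by (simp add: gap_atomless)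
  qed
  finally have "emeasure M {\<omega> \<in> space M. V (Inl k) \<omega> = ?U \<omega>} = 0" by simp
  then show ?thesis by (intro AE_I[of _ _ "{\<omega> \<in> space M. V (Inl k) \<omega> = ?U \<omega>}"]) auto
qed

lemma AE_no_ties: "AE \<omega> in M. no_ties \<omega>"
proof -
  have "AE \<omega> in M. i < j \<longrightarrow> j < k \<longrightarrow> pt j \<omega> - pt i \<omega> \<noteq> pt k \<omega> - pt j \<omega>" for i j k
  proof (cases "i < j \<and> j < k")
    case True
    then obtain l where k: "k = Suc l" by (cases k) auto
    have less: "i < k" "j < k" using True by auto
    \<comment> \<open>A tie between \<open>i < j < k\<close> solved for the last gap, the one from
      \<open>l\<close> to \<open>Suc l\<close>; the other side involves earlier gaps only.\<close>
    let ?u = "\<lambda>v. 2 * right_point v j - right_point v i - right_point v l"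
    have "AE \<omega> in M. V (Inl k) \<omega> \<noteq> ?u (Vp \<omega>)"
    proof (rule AE_gap_neq)
      fix v v' :: "nat + nat \<Rightarrow> real" assume eq: "\<And>j. j \<noteq> Inl k \<Longrightarrow> v j = v' j"
      have "right_point v n = right_point v' n" if "n < k" for n
        unfolding right_point_def by (intro sum.cong refl eq) (use that in auto)
      then show "?u v = ?u v'" using less k by simp
    qed simp
    then show ?thesis
    proof eventually_elim
      case (elim \<omega>)
      then show ?case unfolding k V_simps pt_sum[symmetric] by auto
    qed
  qed auto
  then show ?thesis unfolding no_ties_def by (simp add: AE_all_countable)
qed

lemma prob_single: "prob {\<omega> \<in> space M. Vp \<omega> (Inr 0) \<le> 0} = 1 - p"
proof -
  have "{\<omega> \<in> space M. Vp \<omega> (Inr 0) \<le> 0} = space M - {\<omega> \<in> space M. pt 0 \<omega> \<in> Y \<omega>}"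
    by (auto simp: Vp_def V_simps indicator_def)
  then show ?thesis using prob_compl[OF marked_pt_sets, of 0] prob_mark by simp
qed

lemma prob_gap_le: "prob {\<omega> \<in> space M. Vp \<omega> (Inl i) \<le> 1} = 1 - exp (- 1)"
proof -
  have "{\<omega> \<in> space M. Vp \<omega> (Inl i) \<le> 1} = space M - {\<omega> \<in> space M. 1 < V (Inl i) \<omega>}"
    by (auto simp: Vp_def)
  moreover have "{\<omega> \<in> space M. 1 < V (Inl i) \<omega>} \<in> sets M" by measurable
  ultimately show ?thesis using prob_compl[of "{\<omega> \<in> space M. 1 < V (Inl i) \<omega>}"] prob_gap[of 1 i] by simp
qed

section \<open>The expected hitting time against the return tails\<close>

lemma expected_hit_ge:
  "(\<Sum>n. ennreal ((1 - p) * (1 - exp (- 1)) * wide_reach_prob n)) \<le> (\<integral>\<^sup>+\<omega>. ennreal_of_enat (hit \<omega>) \<partial>M)"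
proof -
  define G where "G n = {\<omega> \<in> space M. (Vp \<omega> (Inr 0) \<le> 0 \<and> Vp \<omega> (Inl 1) \<le> 1) \<and>
    (1 < Vp \<omega> (Inl 0) \<and> seq_reaches n (\<lambda>j. Vp \<omega> (merge j)))}" for n
  have G [measurable]: "G n \<in> sets M" for n unfolding G_def by measurable
  have PG: "prob (G n) = (1 - p) * (1 - exp (- 1)) * wide_reach_prob n" for n
  proof -
    have "prob (G n) = prob {\<omega> \<in> space M. Vp \<omega> (Inr 0) \<le> 0 \<and> Vp \<omega> (Inl 1) \<le> 1} * wide_reach_prob n"
      unfolding G_def prob_reaches_merge[symmetric]
    proof (rule indep_coords[where K = "{Inr 0, Inl 1}"])
      fix v v' :: "nat + nat \<Rightarrow> real" assume eq: "\<And>j. j \<notin> {Inr 0, Inl 1} \<Longrightarrow> v j = v' j"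
      have "seq_reaches n (\<lambda>j. v (merge j)) = seq_reaches n (\<lambda>j. v' (merge j))"
        by (rule seq_reaches_cong) (auto intro!: eq)
      then show "(1 < v (Inl 0) \<and> seq_reaches n (\<lambda>j. v (merge j))) =
          (1 < v' (Inl 0) \<and> seq_reaches n (\<lambda>j. v' (merge j)))"
        using eq[of "Inl 0"] by simp
    qed auto
    also have "prob {\<omega> \<in> space M. Vp \<omega> (Inr 0) \<le> 0 \<and> Vp \<omega> (Inl 1) \<le> 1} =
        prob {\<omega> \<in> space M. Vp \<omega> (Inr 0) \<le> 0} * prob {\<omega> \<in> space M. Vp \<omega> (Inl 1) \<le> 1}"
      by (rule indep_coords[where K = "{Inr 0}"]) auto
    finally show ?thesis unfolding prob_single prob_gap_le .
  qed
  have "(\<Sum>n. ennreal ((1 - p) * (1 - exp (- 1)) * wide_reach_prob n)) = (\<Sum>n. emeasure M (G n))"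
    by (simp add: PG[symmetric] emeasure_eq_measure)
  also have "\<dots> = (\<Sum>n. \<integral>\<^sup>+\<omega>. indicator (G n) \<omega> \<partial>M)" by simp
  also have "\<dots> = (\<integral>\<^sup>+\<omega>. (\<Sum>n. indicator (G n) \<omega>) \<partial>M)"
    by (rule nn_integral_suminf[symmetric]) simp
  also have "\<dots> \<le> (\<integral>\<^sup>+\<omega>. ennreal_of_enat (hit \<omega>) \<partial>M)"
  proof (rule nn_integral_mono_AE)
    show "AE \<omega> in M. (\<Sum>n. indicator (G n) \<omega>) \<le> ennreal_of_enat (hit \<omega>)"
      using AE_no_ties AE_Z AE_space
    proof eventually_elim
      fix \<omega> assume nt: "no_ties \<omega>" and \<omega>: "Z \<omega> = X \<omega>" "\<omega> \<in> space M"
      have le: "enat n \<le> hit \<omega>" if "\<omega> \<in> G n" for n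
        using hit_ge[OF \<omega>(2,1) nt] that unfolding G_def by auto
      \<comment> \<open>Index 0 must contribute nothing: the sum of indicators may use only the
        \<open>N\<close> indices from 1 to \<open>N\<close> when \<open>hit \<omega>\<close> is
        \<open>N\<close>.\<close>
      have zero: "\<omega> \<notin> G 0"
        by (auto simp: G_def seq_reaches_def not_reaches_0)
      show "(\<Sum>n. indicator (G n) \<omega>) \<le> ennreal_of_enat (hit \<omega>)"
      proof (cases "hit \<omega>")
        case (enat N)
        have "(\<Sum>n. indicator (G n) \<omega> :: ennreal) = (\<Sum>n\<in>{1..N}. indicator (G n) \<omega>)"
        proof (rule suminf_finite)
          fix n assume n: "n \<notin> {1..N}"
          then have "\<omega> \<notin> G n" using zero le[of n] enat by (cases "n = 0") auto
          then show "indicator (G n) \<omega> = (0 :: ennreal)" by simp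
        qed simp
        also have "\<dots> \<le> (\<Sum>n\<in>{1..N}. 1)" by (intro sum_mono) (simp add: indicator_def)
        also have "\<dots> = ennreal_of_enat (hit \<omega>)" using enat by simp
        finally show ?thesis .
      qed simp
    qed
  qed
  finally show ?thesis .
qed

section \<open>Exponential bounds and trapping of all but finitely many walks\<close>

text \<open>Multiplying by \<open>exp (\<theta> * x)\<close> tilts the density into that of rate
  \<open>1 - \<theta>\<close>, up to the factor \<open>1 / (1 - \<theta>)\<close>.\<close>

lemma exp_moment:
  assumes "\<theta> < 1"
  shows "(\<integral>\<^sup>+\<omega>. ennreal (exp (\<theta> * V (Inl i) \<omega>)) \<partial>M) = ennreal (1 / (1 - \<theta>))"
proof -
  let ?d = "\<lambda>x. ennreal (exponential_density (1 - \<theta>) x)"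
  have "(\<integral>\<^sup>+\<omega>. ennreal (exp (\<theta> * V (Inl i) \<omega>)) \<partial>M) =
      (\<integral>\<^sup>+x. ennreal (exponential_density 1 x) * ennreal (exp (\<theta> * x)) \<partial>lborel)"
    by (rule distributed_nn_integral[OF gap_exponential, symmetric]) simp
  also have "\<dots> = (\<integral>\<^sup>+x. ennreal (1 / (1 - \<theta>)) * ?d x \<partial>lborel)"
  proof (rule nn_integral_cong)
    fix x :: real
    have "exponential_density 1 x * exp (\<theta> * x) = 1 / (1 - \<theta>) * exponential_density (1 - \<theta>) x"
    proof -
      have "exp (- x) * exp (\<theta> * x) = exp (- x * (1 - \<theta>))" by (simp add: mult_exp_exp algebra_simps)
      then show ?thesis using assms by (simp add: exponential_density_def)
    qed
    then show "ennreal (exponential_density 1 x) * ennreal (exp (\<theta> * x)) = ennreal (1 / (1 - \<theta>)) * ?d x"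
      using assms exponential_density_nonneg[of 1 x] exponential_density_nonneg[of "1 - \<theta>" x]
      by (simp add: ennreal_mult[symmetric])
  qed
  also have "\<dots> = ennreal (1 / (1 - \<theta>)) * (\<integral>\<^sup>+x. ?d x \<partial>lborel)"
    by (rule nn_integral_cmult) simp
  also have "(\<integral>\<^sup>+x. ?d x \<partial>lborel) = 1"
  proof -
    interpret P: prob_space "density lborel (exponential_density (1 - \<theta>))"
      by (rule prob_space_exponential_density) (use assms in simp)
    show ?thesis using P.emeasure_space_1 by (simp add: emeasure_density)
  qed
  finally show ?thesis by simp
qed

text \<open>Markov's inequality for the exponential of \<theta> times the sum. The sign of \<theta>
  is free, so one bound serves upper and lower deviations.\<close>

lemma chernoff:
  assumes J: "finite J" and \<theta>: "\<theta> < 1"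
  shows "prob {\<omega> \<in> space M. c \<le> \<theta> * (\<Sum>i\<in>J. Vp \<omega> (Inl i))} \<le> exp (- c) * (1 / (1 - \<theta>)) ^ card J"
proof -
  let ?E = "{\<omega> \<in> space M. c \<le> \<theta> * (\<Sum>i\<in>J. Vp \<omega> (Inl i))}"
  have E [measurable]: "?E \<in> sets M" by measurable
  have ind: "indep_vars (\<lambda>_. borel) (\<lambda>j \<omega>. ennreal (exp (\<theta> * V j \<omega>))) (Inl ` J)"
    by (rule indep_vars_compose2[OF indep_vars_subset[OF indep_V]]) auto
  have "emeasure M ?E = (\<integral>\<^sup>+\<omega>. indicator ?E \<omega> \<partial>M)" by simp
  also have "\<dots> \<le> (\<integral>\<^sup>+\<omega>. ennreal (exp (- c)) * (\<Prod>j\<in>Inl ` J. ennreal (exp (\<theta> * V j \<omega>))) \<partial>M)"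
  proof (rule nn_integral_mono)
    fix \<omega>
    have prod: "(\<Prod>j\<in>Inl ` J. ennreal (exp (\<theta> * V j \<omega>))) = ennreal (exp (\<theta> * (\<Sum>i\<in>J. Vp \<omega> (Inl i))))"
      using J by (simp add: prod_ennreal prod.reindex sum.reindex exp_sum[symmetric] sum_distrib_left Vp_def)
    show "indicator ?E \<omega> \<le> ennreal (exp (- c)) * (\<Prod>j\<in>Inl ` J. ennreal (exp (\<theta> * V j \<omega>)))"
    proof (cases "\<omega> \<in> ?E")
      case True
      then have "1 \<le> exp (- c) * exp (\<theta> * (\<Sum>i\<in>J. Vp \<omega> (Inl i)))"
        by (simp add: mult_exp_exp)
      then have "ennreal 1 \<le> ennreal (exp (- c) * exp (\<theta> * (\<Sum>i\<in>J. Vp \<omega> (Inl i))))"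
        by (rule ennreal_leI)
      then show ?thesis using True unfolding prod by (simp add: ennreal_mult)
    qed simp
  qed
  also have "\<dots> = ennreal (exp (- c)) * (\<integral>\<^sup>+\<omega>. (\<Prod>j\<in>Inl ` J. ennreal (exp (\<theta> * V j \<omega>))) \<partial>M)"
    by (rule nn_integral_cmult) measurable
  also have "\<dots> = ennreal (exp (- c)) * (\<Prod>j\<in>Inl ` J. \<integral>\<^sup>+\<omega>. ennreal (exp (\<theta> * V j \<omega>)) \<partial>M)"
    by (subst indep_vars_nn_integral[OF _ ind]) (use J in auto)
  also have "\<dots> = ennreal (exp (- c) * (1 / (1 - \<theta>)) ^ card J)"
    using \<theta> by (simp add: prod.reindex exp_moment ennreal_power ennreal_mult del: divide_ennreal)
  finally show ?thesis
    using \<theta> by (simp add: emeasure_eq_measure)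
qed

text \<open>
  Outside \<open>bad_block n\<close> the walks from the points with index in \<open>{4 * n..<4 * n + 4}\<close> return before
  discovering \<open>n\<close> points, and these cover a distance less than \<open>2 * n\<close>, that is half the mean of \<open>x (4 * n)\<close>.
\<close>

definition bad_block :: "nat \<Rightarrow> 'w set" where
  "bad_block n = {\<omega> \<in> space M. (\<exists>s<4. seq_reaches n (\<lambda>j. Vp \<omega> (shift (4 * n + s) j))) \<or>
    real n \<le> 1 / 2 * (right_point (Vp \<omega>) (5 * n + 4) - right_point (Vp \<omega>) (4 * n)) \<or>
    - 2 * real n \<le> - 1 * right_point (Vp \<omega>) (4 * n)}"

lemma right_point_diff:
  "m \<le> n \<Longrightarrow> right_point v n - right_point v m = (\<Sum>i\<in>{Suc m..n}. v (Inl i))"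
proof -
  assume "m \<le> n"
  then have "right_point v n = right_point v m + (\<Sum>l\<in>{m..<n}. v (Inl (Suc l)))"
    unfolding right_point_def by (metis add_0 le_add_diff_inverse lessThan_atLeast0 sum.atLeastLessThan_concat zero_le)
  moreover have "(\<Sum>l\<in>{m..<n}. v (Inl (Suc l))) = (\<Sum>i\<in>{Suc m..n}. v (Inl i))"
    by (rule sum.reindex_bij_witness[of _ "\<lambda>i. i - 1" Suc]) auto
  ultimately show ?thesis by simp
qed

lemma bad_block_sets [measurable]: "bad_block n \<in> sets M"
  unfolding bad_block_def by measurable

text \<open>Four starting points share the tail bound. With \<theta> = 1/2 the \<open>n + 4\<close>
  gaps of the window give \<open>exp (- n) * 2 ^ (n + 4)\<close>; with \<theta> = -1 the first
  \<open>4 * n\<close> gaps give \<open>exp (2 * n) / 2 ^ (4 * n)\<close>.\<close>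

lemma prob_bad_block: "prob (bad_block n) \<le> 4 * reach_prob n + 16 * (2 * exp (- 1)) ^ n + (exp 2 / 16) ^ n"
proof -
  let ?R = "\<lambda>s. {\<omega> \<in> space M. seq_reaches n (\<lambda>j. Vp \<omega> (shift (4 * n + s) j))}"
  let ?F = "{\<omega> \<in> space M. real n \<le> 1 / 2 * (\<Sum>i\<in>{Suc (4 * n)..5 * n + 4}. Vp \<omega> (Inl i))}"
  let ?S = "{\<omega> \<in> space M. - 2 * real n \<le> - 1 * (\<Sum>i\<in>{Suc 0..4 * n}. Vp \<omega> (Inl i))}"
  have meas: "?R s \<in> sets M" "?F \<in> sets M" "?S \<in> sets M" for s by measurable
  have rp0: "right_point v 0 = 0" for v by (simp add: right_point_def)
  have "bad_block n = (\<Union>s\<in>{..<4}. ?R s) \<union> (?F \<union> ?S)"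
    unfolding bad_block_def using right_point_diff[of "4 * n" "5 * n + 4"] right_point_diff[of 0 "4 * n"] rp0
    by auto
  then have "prob (bad_block n) \<le> prob (\<Union>s\<in>{..<4}. ?R s) + prob (?F \<union> ?S)"
    using meas by (simp only:) (rule measure_Un_le, auto)
  also have "prob (\<Union>s\<in>{..<4}. ?R s) \<le> (\<Sum>s<4. prob (?R s))"
    by (rule finite_measure_subadditive_finite) (use meas in auto)
  also have "(\<Sum>s<4. prob (?R s)) = 4 * reach_prob n" by (simp add: prob_reaches_shift)
  also have "prob (?F \<union> ?S) \<le> prob ?F + prob ?S" by (rule measure_Un_le) (use meas in auto)
  also have "prob ?F \<le> exp (- real n) * (1 / (1 - 1 / 2)) ^ card {Suc (4 * n)..5 * n + 4}"
    by (rule chernoff) auto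
  also have "\<dots> = 16 * (2 * exp (- 1)) ^ n"
  proof -
    have "exp (- real n) = exp (- 1) ^ n" using exp_of_nat_mult[of n "- 1 :: real"] by simp
    then show ?thesis by (simp add: power_add power_mult_distrib)
  qed
  also have "prob ?S \<le> exp (- (- 2 * real n)) * (1 / (1 - (- 1))) ^ card {Suc 0..4 * n}"
    by (rule chernoff) auto
  also have "\<dots> = (exp 2 / 16) ^ n"
  proof -
    have "exp (2 * real n) = exp 2 ^ n" using exp_of_nat_mult[of n "2 :: real"] by (simp add: mult.commute)
    then show ?thesis by (simp add: power_mult power_divide)
  qed
  finally show ?thesis by simp
qed

text \<open>Four starting points per value of \<open>n\<close> turn a finite mean into summability,
  and the ratio four leaves room for both deviation bounds: their geometric ratios 2/e and e^2/16
  are below 1.\<close>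

lemma summable_bad_block:
  assumes "summable reach_prob"
  shows "summable (\<lambda>n. prob (bad_block n))"
proof (rule summable_comparison_test')
  have "(5 / 2 :: real) \<le> exp 1" using exp_lower_Taylor_quadratic[of 1] by simp
  then have "2 * exp (- 1) < (1 :: real)" by (simp add: exp_minus field_simps)
  moreover have "exp 2 / 16 < (1 :: real)"
  proof -
    have "exp (2 :: real) = exp 1 * exp 1" by (simp add: mult_exp_exp)
    also have "\<dots> \<le> 3 * 3" using exp_le by (intro mult_mono) auto
    finally show ?thesis by simp
  qed
  ultimately show "summable (\<lambda>n. 4 * reach_prob n + 16 * (2 * exp (- 1)) ^ n + (exp 2 / 16) ^ n)"
    using assms by (intro summable_add summable_mult summable_geometric) auto
qed (use prob_bad_block in auto)

text \<open>By Borel-Cantelli all but finitely many starting points lie in good blocks, where the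
  left side is negative. The remaining ones have finite return numbers, so a large \<open>G\<close>
  absorbs them.\<close>

lemma eventually_trapped:
  assumes "summable reach_prob"
  shows "AE \<omega> in M. \<exists>G. trapped G (Vp \<omega>)"
proof -
  have 1: "AE \<omega> in M. eventually (\<lambda>n. \<omega> \<in> space M - bad_block n) sequentially"
    by (rule borel_cantelli_AE1) (auto simp: summable_bad_block[OF assms] emeasure_eq_measure)
  have 2: "AE \<omega> in M. \<forall>i. \<exists>m\<ge>1. \<not> seq_reaches m (\<lambda>j. Vp \<omega> (shift i j))"
  proof (rule AE_all_countable[THEN iffD2], rule allI)
    fix i
    have "AE \<omega> in M. eventually (\<lambda>n. \<omega> \<in> space M - {\<omega> \<in> space M. seq_reaches n (\<lambda>j. Vp \<omega> (shift i j))}) sequentially"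
      by (rule borel_cantelli_AE1) (auto simp: prob_reaches_shift assms emeasure_eq_measure)
    then show "AE \<omega> in M. \<exists>m\<ge>1. \<not> seq_reaches m (\<lambda>j. Vp \<omega> (shift i j))"
    proof eventually_elim
      case (elim \<omega>)
      then obtain N where "\<forall>n\<ge>N. \<not> seq_reaches n (\<lambda>j. Vp \<omega> (shift i j))"
        by (auto simp: eventually_sequentially)
      then have "\<not> seq_reaches (max 1 N) (\<lambda>j. Vp \<omega> (shift i j))" by simp
      then show ?case by (intro exI[of _ "max 1 N"]) simp
    qed
  qed
  from 1 2 AE_space show ?thesis
  proof eventually_elim
    fix \<omega>
    assume ev: "eventually (\<lambda>n. \<omega> \<in> space M - bad_block n) sequentially"
      and fin: "\<forall>i. \<exists>m\<ge>1. \<not> seq_reaches m (\<lambda>j. Vp \<omega> (shift i j))" and \<omega>: "\<omega> \<in> space M"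
    let ?x = "right_point (Vp \<omega>)"
    have pos: "0 < Vp \<omega> (Inl k)" for k using V_pos[OF \<omega>] by (simp add: Vp_def)
    have anti: "m < n" if "seq_reaches m (\<lambda>j. Vp \<omega> (shift i j))" "\<not> seq_reaches n (\<lambda>j. Vp \<omega> (shift i j))" "1 \<le> n" for i m n
      using seq_reaches_antimono[of "\<lambda>j. Vp \<omega> (shift i j)" m n] that pos by (force simp: not_less[symmetric])
    have mono: "?x m \<le> ?x n" if "m \<le> n" for m n
      using that strict_mono_less_eq[OF pt_mono[OF \<omega>]] unfolding pt_sum[symmetric] by simp
    have nonneg: "0 \<le> ?x n" for n using pt_nonneg[OF \<omega>] unfolding pt_sum[symmetric] .
    obtain N where N: "\<And>n. N \<le> n \<Longrightarrow> \<omega> \<notin> bad_block n" using ev by (auto simp: eventually_sequentially)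
    obtain L where L: "\<And>i. 1 \<le> L i" "\<And>i. \<not> seq_reaches (L i) (\<lambda>j. Vp \<omega> (shift i j))"
      using fin by metis
    \<comment> \<open>At least 1, because the comparison of return numbers starts at index 1 and
      index 0 is never reached.\<close>
    define N' where "N' = max 1 N"
    \<comment> \<open>Lies beyond every point that matters for the starting points outside the
      controlled blocks.\<close>
    define C where "C = ?x (4 * N' + (\<Sum>i<4 * N'. L i))"
    obtain G :: nat where G: "C < real G" using reals_Archimedean2 by blast
    have "trapped G (Vp \<omega>)"
      unfolding trapped_def
    proof (intro allI impI)
      fix i m assume r: "seq_reaches m (\<lambda>j. Vp \<omega> (shift i j))"
      show "?x (i + m + 1) - 2 * ?x i < real G"
      proof (cases "i < 4 * N'")
        case True
        have "m < L i" using anti[OF r L(2) L(1)] .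
        also have "L i \<le> (\<Sum>i<4 * N'. L i)" using True by (intro member_le_sum) auto
        finally have "i + m + 1 \<le> 4 * N' + (\<Sum>i<4 * N'. L i)" using True by simp
        then have "?x (i + m + 1) \<le> C" unfolding C_def by (rule mono)
        then show ?thesis using G nonneg[of i] by linarith
      next
        case False
        define n s where "n = i div 4" and "s = i mod 4"
        have i: "i = 4 * n + s" "s < 4" unfolding n_def s_def by auto
        have n: "N \<le> n" "1 \<le> n" using False i unfolding N'_def by auto
        have good: "\<not> seq_reaches n (\<lambda>j. Vp \<omega> (shift i j))"
          "?x (5 * n + 4) - ?x (4 * n) < 2 * real n" "2 * real n < ?x (4 * n)"
          using N[OF n(1)] \<omega> i unfolding bad_block_def by auto
        have "m < n" using anti[OF r good(1) n(2)] .
        then have "?x (i + m + 1) \<le> ?x (5 * n + 4)" using i by (intro mono) simp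
        moreover have "?x (4 * n) \<le> ?x i" using i by (intro mono) simp
        ultimately show ?thesis using good(2,3) nonneg[of 0] by linarith
      qed
    qed
    then show "\<exists>G. trapped G (Vp \<omega>)" ..
  qed
qed

lemma expected_hit_infinite_of_summable:
  assumes "summable reach_prob"
  shows "(\<integral>\<^sup>+\<omega>. ennreal_of_enat (hit \<omega>) \<partial>M) = \<infinity>"
proof -
  have "\<exists>G. prob {\<omega> \<in> space M. trapped G (Vp \<omega>)} \<noteq> 0"
  proof (rule ccontr)
    assume "\<nexists>G. prob {\<omega> \<in> space M. trapped G (Vp \<omega>)} \<noteq> 0"
    then have "AE \<omega> in M. \<not> trapped G (Vp \<omega>)" for G
      by (intro AE_I[of _ _ "{\<omega> \<in> space M. trapped G (Vp \<omega>)}"]) (auto simp: emeasure_eq_measure)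
    then have "AE \<omega> in M. \<forall>G. \<not> trapped G (Vp \<omega>)" by (simp add: AE_all_countable)
    with eventually_trapped[OF assms] have "AE \<omega> in M. False" by eventually_elim blast
    then show False by simp
  qed
  then obtain G where G: "prob {\<omega> \<in> space M. trapped G (Vp \<omega>)} \<noteq> 0" by blast
  let ?E = "{\<omega> \<in> space M. (Vp \<omega> (Inr 0) \<le> 0 \<and> real G < Vp \<omega> (Inl 0)) \<and> trapped G (Vp \<omega>)}"
  have E: "?E \<in> sets M" by measurable
  have "prob ?E = prob {\<omega> \<in> space M. Vp \<omega> (Inr 0) \<le> 0 \<and> real G < Vp \<omega> (Inl 0)} *
      prob {\<omega> \<in> space M. trapped G (Vp \<omega>)}"
  proof (rule indep_coords[where K = "{Inr 0, Inl 0}"])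
    show "trapped G v = trapped G v'" if "\<And>j. j \<notin> {Inr 0, Inl 0} \<Longrightarrow> v j = v' j" for v v'
      by (rule trapped_cong) (use that in auto)
  qed auto
  also have "prob {\<omega> \<in> space M. Vp \<omega> (Inr 0) \<le> 0 \<and> real G < Vp \<omega> (Inl 0)} =
      prob {\<omega> \<in> space M. Vp \<omega> (Inr 0) \<le> 0} * prob {\<omega> \<in> space M. real G < Vp \<omega> (Inl 0)}"
    by (rule indep_coords[where K = "{Inr 0}"]) auto
  also have "prob {\<omega> \<in> space M. real G < Vp \<omega> (Inl 0)} = exp (- real G)"
    using prob_gap[of "real G" 0] by (simp add: Vp_def)
  finally have "prob ?E \<noteq> 0" using G p01 by (simp add: prob_single)
  then have "emeasure M ?E \<noteq> 0" by (simp add: emeasure_eq_measure)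
  then have "(\<integral>\<^sup>+\<omega>. \<infinity> * indicator ?E \<omega> \<partial>M) = \<infinity>"
    by (subst nn_integral_cmult_indicator[OF E]) (simp add: ennreal_top_mult)
  moreover have "(\<integral>\<^sup>+\<omega>. \<infinity> * indicator ?E \<omega> \<partial>M) \<le> (\<integral>\<^sup>+\<omega>. ennreal_of_enat (hit \<omega>) \<partial>M)"
  proof (rule nn_integral_mono_AE)
    show "AE \<omega> in M. \<infinity> * indicator ?E \<omega> \<le> ennreal_of_enat (hit \<omega>)"
      using AE_Z AE_space
    proof eventually_elim
      fix \<omega> assume \<omega>: "Z \<omega> = X \<omega>" "\<omega> \<in> space M"
      show "\<infinity> * indicator ?E \<omega> \<le> ennreal_of_enat (hit \<omega>)"
      proof (cases "\<omega> \<in> ?E")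
        case True
        then have "hit \<omega> = \<infinity>" using hit_infinite[OF \<omega>(2,1)] by auto
        then show ?thesis by simp
      qed simp
    qed
  qed
  ultimately show ?thesis by (simp add: top_unique)
qed

lemma expected_hit: "(\<integral>\<^sup>+\<omega>. ennreal_of_enat (hit \<omega>) \<partial>M) = \<infinity>"
proof (rule ccontr)
  assume fin: "(\<integral>\<^sup>+\<omega>. ennreal_of_enat (hit \<omega>) \<partial>M) \<noteq> \<infinity>"
  let ?c = "(1 - p) * (1 - exp (- 1)) :: real"
  have c: "0 < ?c" using p01 by simp
  have nonneg: "0 \<le> wide_reach_prob n" for n by (simp add: wide_reach_prob_def)
  have "(\<Sum>n. ennreal (?c * wide_reach_prob n)) \<noteq> top"
    using expected_hit_ge fin by (metis infinity_ennreal_def top_unique)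
  then have "summable (\<lambda>n. ?c * wide_reach_prob n)"
    by (rule summable_suminf_not_top[rotated]) (use c nonneg in simp)
  then have "summable wide_reach_prob" using p01 by (simp add: summable_cmult_iff)
  then have "summable (\<lambda>n. (1 + exp 1) * wide_reach_prob n)" by (rule summable_mult)
  then have "summable reach_prob"
    by (rule summable_comparison_test'[where N = 0]) (use reach_prob_le in \<open>simp add: reach_prob_def\<close>)
  then show False using expected_hit_infinite_of_summable fin by blast
qed

end

theorem theorem2:
  fixes M :: "'w measure" and X\<^sub>0 Y :: "'w \<Rightarrow> real set" and p :: real
  assumes p: "0 < p" "p < 1"
    and poisson: "poisson_process M X\<^sub>0 1"
    and thin: "thinning M (\<lambda>\<omega>. insert 0 (X\<^sub>0 \<omega>)) Y p"
  shows "(\<integral>\<^sup>+ \<omega>. ennreal_of_enat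
      (hitting_time (greedy_walk (marks (insert 0 (X\<^sub>0 \<omega>)) (Y \<omega>)) 0) {..0}) \<partial>M) = \<infinity>"
proof -
  interpret poisson_process M X\<^sub>0 1 by (rule poisson)
  interpret thinning M "\<lambda>\<omega>. insert 0 (X\<^sub>0 \<omega>)" Y p by (rule thin)
  interpret mp: marked_poisson M X\<^sub>0 Y p by unfold_locales (rule p)+
  show ?thesis using mp.expected_hit unfolding mp.hit_def .
qed

end
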